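(* Let $r\ge 0$ be an integer, let $\mathcal{K}$ be the integral operator with a Green's kernel $\kappa$ (with respect to $r$), let $\lambda\neq 0$ be a simple eigenvalue of $\mathcal{K}$ with spectral projection $E$, and let $Q_n$ be the interpolatory projection onto $\mathcal{X}_n$ at $2r+1$ equidistant points per subinterval, $h=1/n$. Let $\lambda_n^C$ be the eigenvalue of $Q_n\mathcal{K}$ converging to $\lambda$. Let $\varphi_n\in\mathcal{R}(E_n)$, $\|\varphi_n\|_\infty=1$, be a collocation eigenvector ($Q_n\mathcal{K}\varphi_n=\lambda_n^C\varphi_n$), and let $\varphi_n^S=\frac{1}{\lambda_n^C}\mathcal{K}\varphi_n$ be the corresponding iterated collocation eigenvector. Then, for all $n$ large enough, $$\|\varphi_n-E\varphi_n\|_\infty=O(h^{2r+1}),\qquad \|\varphi_n^S-E\varphi_n^S\|_\infty=O(h^{2r+2}),$$ and $$|\lambda-\lambda_n^C|=O(h^{2r+2}).$$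
   Context: Green's kernel (for an integer $r\ge 0$): let $\Omega_1=\{(s,t):0\le t\le s\le 1\}$ and $\Omega_2=\{(s,t):0\le s\le t\le 1\}$. A real-valued continuous function $\kappa$ on $[0,1]^2$ is a Green's kernel if $\kappa=\kappa_1$ on $\Omega_1$ and $\kappa=\kappa_2$ on $\Omega_2$, with $\kappa_1(s,s)=\kappa_2(s,s)$ for all $s\in[0,1]$, $\kappa_i\in C^\alpha(\Omega_i)$, $\alpha>r$, and with $\alpha$ large enough that all partial derivatives $\partial^{j+k}\kappa_i/\partial s^j\partial t^k$, $0\le j,k\le 2r+2$, exist, are continuous and bounded on $\Omega_i$ ($i=1,2$). Operator: $(\mathcal{K}x)(s)=\int_0^1\kappa(s,t)x(t)\,dt$, $s\in[0,1]$, a compact operator; for comparison with its discretizations all operators may be regarded as acting on (complex-valued) $L^\infty[0,1]$. Spectral projections: $\Gamma$ is a simple closed rectifiable positively oriented curve in the resolvent set of $\mathcal{K}$ separating $\lambda$ from the rest of the spectrum (including $0$), and $E=-\frac{1}{2\pi i}\int_\Gamma(\mathcal{K}-zI)^{-1}dz$; $\lambda$ is simple if its range $\mathcal{R}(E)$ has dimension one (algebraic multiplicity one). For $n$ large, $\Gamma$ lies in the resolvent set of $Q_n\mathcal{K}$, $E_n=-\frac{1}{2\pi i}\int_\Gamma(Q_n\mathcal{K}-zI)^{-1}dz$ has rank one, and $Q_n\mathcal{K}$ has exactly one eigenvalue (which is simple) inside $\Gamma$, namely $\lambda_n^C$. Approximating space: for $n\ge1$ let $h=1/n$, $t_j=j/n$,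 $\Delta_j=[t_{j-1},t_j]$. $\mathcal{X}_n$ is the space of $x\in L^\infty[0,1]$ whose restriction to each $\Delta_j$, $j=1,\dots,n$, is a polynomial of degree at most $2r$ (no continuity imposed at the partition points). Interpolatory projection: for $r\ge1$ the nodes in $\Delta_j$ are $\tau_j^i=t_{j-1}+\frac{ih}{2r}$, $i=0,\dots,2r$; for $r=0$ the single node is the midpoint $\tau_j=(t_{j-1}+t_j)/2$. For $x\in C[0,1]$, $Q_nx\in\mathcal{X}_n$ is, on each $\Delta_j$, the polynomial of degree at most $2r$ interpolating $x$ at the nodes in $\Delta_j$. (Since $\mathcal{K}$ maps $L^\infty[0,1]$ into $C[0,1]$, $Q_n\mathcal{K}$ is defined on $L^\infty[0,1]$.) $\|\cdot\|_\infty$ is the (essential) supremum norm on $[0,1]$. Constants in $O(\cdot)$ are independent of $n$. *)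

theory Defs
  imports "HOL-Complex_Analysis.Complex_Analysis" "HOL-Probability.Essential_Supremum"
    "HOL-Library.Landau_Symbols"
begin

section \<open>The complex Banach space of essentially bounded functions on the unit interval\<close>

abbreviation unit_measure :: "real measure"
  where "unit_measure \<equiv> lebesgue_on {0..1}"

definition ess_bounded :: "(real \<Rightarrow> complex) \<Rightarrow> bool"
  where "ess_bounded f \<longleftrightarrow>
    f \<in> borel_measurable unit_measure \<and> (\<exists>C. AE t in unit_measure. norm (f t) \<le> C)"

definition linf_rel :: "(real \<Rightarrow> complex) \<Rightarrow> (real \<Rightarrow> complex) \<Rightarrow> bool"
  where "linf_rel f g \<longleftrightarrow> ess_bounded f \<and> ess_bounded g \<and> (AE t in unit_measure. f t = g t)"

lemma ess_bounded_const [simp]: "ess_bounded (\<lambda>t. c)"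
  by (auto simp: ess_bounded_def)

lemma ess_bounded_add: "ess_bounded f \<Longrightarrow> ess_bounded g \<Longrightarrow> ess_bounded (\<lambda>t. f t + g t)"
proof -
  assume f: "ess_bounded f" and g: "ess_bounded g"
  obtain C D where "AE t in unit_measure. norm (f t) \<le> C" "AE t in unit_measure. norm (g t) \<le> D"
    using f g by (auto simp: ess_bounded_def)
  then have "AE t in unit_measure. norm (f t + g t) \<le> C + D"
    by eventually_elim (rule norm_triangle_mono)
  then show ?thesis using f g by (auto simp: ess_bounded_def)
qed

lemma ess_bounded_cmult: "ess_bounded f \<Longrightarrow> ess_bounded (\<lambda>t. c * f t)"
proof -
  assume f: "ess_bounded f"
  obtain C where "AE t in unit_measure. norm (f t) \<le> C"
    using f by (auto simp: ess_bounded_def)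
  then have "AE t in unit_measure. norm (c * f t) \<le> norm c * C"
    by eventually_elim (simp add: norm_mult mult_left_mono)
  then show ?thesis using f by (auto simp: ess_bounded_def)
qed

lemma ess_bounded_uminus: "ess_bounded f \<Longrightarrow> ess_bounded (\<lambda>t. - f t)"
  using ess_bounded_cmult[of f "-1"] by simp

lemma ess_bounded_diff: "ess_bounded f \<Longrightarrow> ess_bounded g \<Longrightarrow> ess_bounded (\<lambda>t. f t - g t)"
  using ess_bounded_add[OF _ ess_bounded_uminus, of f g] by simp

quotient_type linf = "real \<Rightarrow> complex" / partial: linf_rel
proof (rule part_equivpI)
  show "\<exists>f. linf_rel f f"
    by (rule exI[of _ "\<lambda>t. 0"]) (simp add: linf_rel_def)
  show "symp linf_rel"
    by (rule sympI) (auto simp: linf_rel_def elim: eventually_mono)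
  show "transp linf_rel"
  proof (rule transpI)
    fix f g h assume fg: "linf_rel f g" and gh: "linf_rel g h"
    then have "AE t in unit_measure. f t = g t" "AE t in unit_measure. g t = h t"
      by (simp_all add: linf_rel_def)
    then have "AE t in unit_measure. f t = h t" by eventually_elim simp
    then show "linf_rel f h" using fg gh by (simp add: linf_rel_def)
  qed
qed

definition ess_norm :: "(real \<Rightarrow> complex) \<Rightarrow> real"
  where "ess_norm f = real_of_ereal (esssup unit_measure (\<lambda>t. ereal (norm (f t))))"

lemma emeasure_unit: "emeasure unit_measure (space unit_measure) = 1"
  by (simp add: emeasure_restrict_space)

lemma esssup_ess_bounded:
  assumes "ess_bounded f"
  shows "esssup unit_measure (\<lambda>t. ereal (norm (f t))) = ereal (ess_norm f)" "0 \<le> ess_norm f"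
proof -
  have [measurable]: "f \<in> borel_measurable unit_measure" using assms by (simp add: ess_bounded_def)
  obtain C where C: "AE t in unit_measure. norm (f t) \<le> C"
    using assms by (auto simp: ess_bounded_def)
  have le: "esssup unit_measure (\<lambda>t. ereal (norm (f t))) \<le> ereal C"
    by (rule esssup_I) (use C in auto)
  have "esssup unit_measure (\<lambda>t. ereal 0) \<le> esssup unit_measure (\<lambda>t. ereal (norm (f t)))"
    by (rule esssup_mono) auto
  then have ge: "ereal 0 \<le> esssup unit_measure (\<lambda>t. ereal (norm (f t)))"
    using emeasure_unit by (subst (asm) esssup_const) simp_all
  show "esssup unit_measure (\<lambda>t. ereal (norm (f t))) = ereal (ess_norm f)" "0 \<le> ess_norm f"
    using le ge unfolding ess_norm_def
    by (cases "esssup unit_measure (\<lambda>t. ereal (norm (f t)))"; simp)+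
qed

lemma AE_le_ess_norm: "ess_bounded f \<Longrightarrow> AE t in unit_measure. norm (f t) \<le> ess_norm f"
  using esssup_AE[where M = unit_measure and f = "\<lambda>t. ereal (norm (f t))"]
  by (simp add: esssup_ess_bounded)

lemma ess_norm_le:
  assumes "ess_bounded f" "AE t in unit_measure. norm (f t) \<le> C"
  shows "ess_norm f \<le> C"
proof -
  have [measurable]: "f \<in> borel_measurable unit_measure" using assms by (simp add: ess_bounded_def)
  have "esssup unit_measure (\<lambda>t. ereal (norm (f t))) \<le> ereal C"
    by (rule esssup_I) (use assms in auto)
  then show ?thesis using assms by (simp add: esssup_ess_bounded)
qed

instantiation linf :: real_normed_vector
begin

lift_definition zero_linf :: linf is "\<lambda>t. 0"
  by (simp add: linf_rel_def)

lift_definition plus_linf :: "linf \<Rightarrow> linf \<Rightarrow> linf" is "\<lambda>f g t. f t + g t"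
  unfolding linf_rel_def by (auto intro: ess_bounded_add)

lift_definition minus_linf :: "linf \<Rightarrow> linf \<Rightarrow> linf" is "\<lambda>f g t. f t - g t"
  unfolding linf_rel_def by (auto intro: ess_bounded_diff)

lift_definition uminus_linf :: "linf \<Rightarrow> linf" is "\<lambda>f t. - f t"
  unfolding linf_rel_def by (auto intro: ess_bounded_uminus)

lift_definition scaleR_linf :: "real \<Rightarrow> linf \<Rightarrow> linf" is "\<lambda>c f t. complex_of_real c * f t"
  unfolding linf_rel_def by (auto intro: ess_bounded_cmult)

lift_definition norm_linf :: "linf \<Rightarrow> real" is ess_norm
  unfolding linf_rel_def ess_norm_def ess_bounded_def
  by (intro arg_cong[where f = real_of_ereal] esssup_AE_cong) auto

definition dist_linf :: "linf \<Rightarrow> linf \<Rightarrow> real"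
  where "dist_linf x y = norm (x - y)"

definition sgn_linf :: "linf \<Rightarrow> linf"
  where "sgn_linf x = inverse (norm x) *\<^sub>R x"

definition uniformity_linf :: "(linf \<times> linf) filter"
  where "uniformity_linf = (INF e\<in>{0<..}. principal {(x, y). dist x y < e})"

definition open_linf :: "linf set \<Rightarrow> bool"
  where "open_linf S = (\<forall>x\<in>S. \<forall>\<^sub>F (x', y) in uniformity. x' = x \<longrightarrow> y \<in> S)"

instance
proof
  fix x y z :: linf and a b :: real
  show "x + y + z = x + (y + z)"
    by transfer (auto simp: linf_rel_def add.assoc intro!: ess_bounded_add)
  show "x + y = y + x"
    by transfer (auto simp: linf_rel_def add.commute intro!: ess_bounded_add)
  show "0 + x = x" by transfer (auto simp: linf_rel_def)
  show "- x + x = 0" by transfer (auto simp: linf_rel_def)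
  show "x - y = x + - y"
    by transfer (auto simp: linf_rel_def intro!: ess_bounded_diff)
  show "a *\<^sub>R (x + y) = a *\<^sub>R x + a *\<^sub>R y"
    by transfer (auto simp: linf_rel_def distrib_left distrib_right intro!: ess_bounded_add ess_bounded_cmult)
  show "(a + b) *\<^sub>R x = a *\<^sub>R x + b *\<^sub>R x"
    by transfer (auto simp: linf_rel_def distrib_left distrib_right intro!: ess_bounded_add ess_bounded_cmult)
  show "a *\<^sub>R b *\<^sub>R x = (a * b) *\<^sub>R x"
    by transfer (auto simp: linf_rel_def mult.assoc intro!: ess_bounded_cmult)
  show "1 *\<^sub>R x = x" by transfer (auto simp: linf_rel_def)
  show "dist x y = norm (x - y)" by (simp add: dist_linf_def)
  show "sgn x = inverse (norm x) *\<^sub>R x" by (simp add: sgn_linf_def)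
  show "uniformity = (INF e\<in>{0<..}. principal {(x::linf, y). dist x y < e})"
    by (simp add: uniformity_linf_def)
  fix S :: "linf set"
  show "open S = (\<forall>x\<in>S. \<forall>\<^sub>F (x', y) in uniformity. x' = x \<longrightarrow> y \<in> S)"
    by (simp add: open_linf_def)
next
  fix x y :: linf and a :: real
  show "norm x = 0 \<longleftrightarrow> x = 0"
  proof (transfer, safe)
    fix f assume "linf_rel f f" and 0: "ess_norm f = 0"
    then have f: "ess_bounded f" by (simp add: linf_rel_def)
    show "linf_rel f (\<lambda>t. 0)"
      using AE_le_ess_norm[OF f] f 0 by (simp add: linf_rel_def)
  next
    fix f assume "linf_rel f (\<lambda>t. 0)"
    then have f: "ess_bounded f" and "AE t in unit_measure. norm (f t) \<le> 0"
      by (simp_all add: linf_rel_def)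
    then have "ess_norm f \<le> 0" by (rule ess_norm_le)
    then show "ess_norm f = 0" using esssup_ess_bounded(2)[OF f] by simp
  qed
  show "norm (x + y) \<le> norm x + norm y"
  proof transfer
    fix f g assume "linf_rel f f" "linf_rel g g"
    then have f: "ess_bounded f" and g: "ess_bounded g" by (simp_all add: linf_rel_def)
    have "AE t in unit_measure. norm (f t + g t) \<le> ess_norm f + ess_norm g"
      using AE_le_ess_norm[OF f] AE_le_ess_norm[OF g]
      by eventually_elim (rule norm_triangle_mono)
    then show "ess_norm (\<lambda>t. f t + g t) \<le> ess_norm f + ess_norm g"
      by (intro ess_norm_le ess_bounded_add f g)
  qed
  show "norm (a *\<^sub>R x) = \<bar>a\<bar> * norm x"
  proof transfer
    fix a :: real and f assume "linf_rel f f"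
    then have f: "ess_bounded f" by (simp add: linf_rel_def)
    have le: "ess_norm (\<lambda>t. complex_of_real c * g t) \<le> \<bar>c\<bar> * ess_norm g"
      if g: "ess_bounded g" for c g
    proof (intro ess_norm_le ess_bounded_cmult g)
      show "AE t in unit_measure. norm (complex_of_real c * g t) \<le> \<bar>c\<bar> * ess_norm g"
        using AE_le_ess_norm[OF g]
        by eventually_elim (simp add: norm_mult mult_left_mono)
    qed
    show "ess_norm (\<lambda>t. complex_of_real a * f t) = \<bar>a\<bar> * ess_norm f"
    proof (cases "a = 0")
      case True
      then show ?thesis
        using le[OF f, of 0] esssup_ess_bounded(2)[of "\<lambda>t. 0"] by simp
    next
      case False
      have "ess_norm f = ess_norm (\<lambda>t. complex_of_real (1 / a) * (complex_of_real a * f t))"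
        using False by simp
      also have "\<dots> \<le> \<bar>1 / a\<bar> * ess_norm (\<lambda>t. complex_of_real a * f t)"
        by (intro le ess_bounded_cmult f)
      finally have "\<bar>a\<bar> * ess_norm f \<le> ess_norm (\<lambda>t. complex_of_real a * f t)"
        using False by (simp add: field_simps)
      then show ?thesis using le[OF f, of a] by simp
    qed
  qed
qed

end

lift_definition scaleC_linf :: "complex \<Rightarrow> linf \<Rightarrow> linf"  (infixr \<open>*\<^sub>C\<close> 75) is "\<lambda>c f t. c * f t"
  unfolding linf_rel_def by (auto intro: ess_bounded_cmult)

interpretation linf: vector_space scaleC_linf
proof
  fix a b :: complex and x y :: linf
  show "a *\<^sub>C (x + y) = a *\<^sub>C x + a *\<^sub>C y"
    by transfer (auto simp: linf_rel_def distrib_left distrib_right intro!: ess_bounded_add ess_bounded_cmult)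
  show "(a + b) *\<^sub>C x = a *\<^sub>C x + b *\<^sub>C x"
    by transfer (auto simp: linf_rel_def distrib_left distrib_right intro!: ess_bounded_add ess_bounded_cmult)
  show "a *\<^sub>C b *\<^sub>C x = (a * b) *\<^sub>C x"
    by transfer (auto simp: linf_rel_def mult.assoc intro!: ess_bounded_cmult)
  show "1 *\<^sub>C x = x" by transfer (auto simp: linf_rel_def)
qed

lemma scaleR_scaleC_linf: "a *\<^sub>R x = complex_of_real a *\<^sub>C (x :: linf)"
  by transfer (auto simp: linf_rel_def intro!: ess_bounded_cmult)

lemma norm_scaleC_linf: "norm (c *\<^sub>C x) = norm c * norm x"
proof (cases "c = 0")
  case True then show ?thesis by simp
next
  case False
  have le: "norm (d *\<^sub>C y) \<le> norm d * norm y" for d y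
  proof transfer
    fix d f assume "linf_rel f f"
    then have f: "ess_bounded f" by (simp add: linf_rel_def)
    show "ess_norm (\<lambda>t. d * f t) \<le> cmod d * ess_norm f"
    proof (intro ess_norm_le ess_bounded_cmult f)
      show "AE t in unit_measure. norm (d * f t) \<le> norm d * ess_norm f"
        using AE_le_ess_norm[OF f] by eventually_elim (simp add: norm_mult mult_left_mono)
    qed
  qed
  have "norm x = norm (inverse c *\<^sub>C c *\<^sub>C x)" using False by simp
  also have "\<dots> \<le> norm (inverse c) * norm (c *\<^sub>C x)" by (rule le)
  finally have "norm c * norm x \<le> norm (c *\<^sub>C x)" using False by (simp add: norm_inverse norm_divide field_simps)
  then show ?thesis using le[of c x] by simp
qed

lemma bounded_linear_scaleC_linf: "bounded_linear (\<lambda>x. c *\<^sub>C x)"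
proof (rule bounded_linear_intro[where K = "norm c"])
  show "c *\<^sub>C (x + y) = c *\<^sub>C x + c *\<^sub>C y" for x y by (rule linf.scale_right_distrib)
  show "c *\<^sub>C (a *\<^sub>R x) = a *\<^sub>R (c *\<^sub>C x)" for a x
    by (simp add: scaleR_scaleC_linf mult.commute)
  show "norm (c *\<^sub>C x) \<le> norm x * norm c" for x by (simp add: norm_scaleC_linf)
qed


section \<open>Spectral theory\<close>

text \<open>Operators on the space are elements of the library type of bounded linear maps, which only
  records real linearity; the integral operators below are complex linear.\<close>

type_synonym linf_op = "linf \<Rightarrow>\<^sub>L linf"

definition scaleC_op :: "complex \<Rightarrow> linf_op \<Rightarrow> linf_op"
  where "scaleC_op c T = Blinfun (\<lambda>x. c *\<^sub>C blinfun_apply T x)"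

lemma scaleC_op_apply: "blinfun_apply (scaleC_op c T) x = c *\<^sub>C blinfun_apply T x"
  unfolding scaleC_op_def
  by (simp add: bounded_linear_Blinfun_apply
      bounded_linear_compose[OF bounded_linear_scaleC_linf blinfun.bounded_linear_right])

definition is_resolvent :: "linf_op \<Rightarrow> complex \<Rightarrow> linf_op \<Rightarrow> bool"
  where "is_resolvent T z S \<longleftrightarrow>
    S o\<^sub>L (T - scaleC_op z id_blinfun) = id_blinfun \<and>
    (T - scaleC_op z id_blinfun) o\<^sub>L S = id_blinfun"

definition resolvent_set :: "linf_op \<Rightarrow> complex set"
  where "resolvent_set T = {z. \<exists>S. is_resolvent T z S}"

definition resolvent :: "linf_op \<Rightarrow> complex \<Rightarrow> linf_op"
  where "resolvent T z = (THE S. is_resolvent T z S)"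

definition op_spectrum :: "linf_op \<Rightarrow> complex set"
  where "op_spectrum T = - resolvent_set T"

definition eigenvalue :: "linf_op \<Rightarrow> complex \<Rightarrow> bool"
  where "eigenvalue T \<mu> \<longleftrightarrow> (\<exists>x. x \<noteq> 0 \<and> blinfun_apply T x = \<mu> *\<^sub>C x)"

lemma is_resolvent_unique: "is_resolvent T z S \<Longrightarrow> is_resolvent T z S' \<Longrightarrow> S = S'"
proof -
  let ?A = "T - scaleC_op z id_blinfun"
  assume S: "is_resolvent T z S" and S': "is_resolvent T z S'"
  have id: "U o\<^sub>L id_blinfun = U" "id_blinfun o\<^sub>L U = U" for U :: linf_op
    by (rule blinfun_eqI, simp)+
  have "S = S o\<^sub>L (?A o\<^sub>L S')"
    using S' by (simp only: is_resolvent_def id)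
  also have "\<dots> = (S o\<^sub>L ?A) o\<^sub>L S'"
    by (rule blinfun_eqI) simp
  also have "\<dots> = S'"
    using S by (simp only: is_resolvent_def id)
  finally show ?thesis .
qed

lemma resolvent_eqI: "is_resolvent T z S \<Longrightarrow> resolvent T z = S"
  unfolding resolvent_def by (blast intro: the_equality is_resolvent_unique)

definition rectifiable_path :: "(real \<Rightarrow> complex) \<Rightarrow> bool"
  where "rectifiable_path \<gamma> \<longleftrightarrow> path \<gamma> \<and>
    (\<exists>L. \<forall>d. d division_of {0..1} \<longrightarrow> (\<Sum>J\<in>d. norm (\<gamma> (Sup J) - \<gamma> (Inf J))) \<le> L)"

text \<open>The curve is merely rectifiable, so the integral of an operator-valued function along it is
  the norm limit of Riemann-Stieltjes sums. A cell \<open>J\<close> of a tagged division of the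
  parameter interval is \<open>{Inf J..Sup J}\<close>.\<close>

definition has_curve_integral :: "(complex \<Rightarrow> linf_op) \<Rightarrow> linf_op \<Rightarrow> (real \<Rightarrow> complex) \<Rightarrow> bool"
  where "has_curve_integral F I \<gamma> \<longleftrightarrow>
    (\<forall>e>0. \<exists>d>0. \<forall>p. p tagged_division_of {0..1} \<and> (\<lambda>t. ball t d) fine p \<longrightarrow>
      norm ((\<Sum>(t, J)\<in>p. scaleC_op (\<gamma> (Sup J) - \<gamma> (Inf J)) (F (\<gamma> t))) - I) < e)"

definition curve_integral :: "(real \<Rightarrow> complex) \<Rightarrow> (complex \<Rightarrow> linf_op) \<Rightarrow> linf_op"
  where "curve_integral \<gamma> F = (THE I. has_curve_integral F I \<gamma>)"

definition spectral_projection :: "(real \<Rightarrow> complex) \<Rightarrow> linf_op \<Rightarrow> linf_op"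
  where "spectral_projection \<gamma> T =
    scaleC_op (- (1 / (2 * complex_of_real pi * \<i>))) (curve_integral \<gamma> (resolvent T))"

lemma has_curve_integral_unique:
  assumes "has_curve_integral F I \<gamma>" "has_curve_integral F I' \<gamma>"
  shows "I = I'"
proof (rule ccontr)
  assume "I \<noteq> I'"
  then have e: "norm (I - I') / 2 > 0" by simp
  let ?S = "\<lambda>p. (\<Sum>(t, J)\<in>p. scaleC_op (\<gamma> (Sup J) - \<gamma> (Inf J)) (F (\<gamma> t)))"
  obtain d where d: "d > 0" "\<And>p. p tagged_division_of {0..1} \<Longrightarrow> (\<lambda>t. ball t d) fine p \<Longrightarrow>
      norm (?S p - I) < norm (I - I') / 2"
    using assms(1) e unfolding has_curve_integral_def by meson
  obtain d' where d': "d' > 0" "\<And>p. p tagged_division_of {0..1} \<Longrightarrow> (\<lambda>t. ball t d') fine p \<Longrightarrow>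
      norm (?S p - I') < norm (I - I') / 2"
    using assms(2) e unfolding has_curve_integral_def by meson
  have "gauge (\<lambda>t::real. ball t (min d d'))"
    using d(1) d'(1) by (simp add: gauge_def)
  then obtain p where p: "p tagged_division_of cbox (0::real) 1" "(\<lambda>t. ball t (min d d')) fine p"
    by (rule fine_division_exists[of _ 0 1]) blast
  have "(\<lambda>t. ball t d) fine p" "(\<lambda>t. ball t d') fine p"
    using p(2) by (auto simp: fine_def subset_eq)
  then have "norm (?S p - I) < norm (I - I') / 2" "norm (?S p - I') < norm (I - I') / 2"
    using p(1) d(2) d'(2) by (auto simp: cbox_interval)
  moreover have "norm (I - I') \<le> norm (?S p - I) + norm (?S p - I')"
    using norm_triangle_ineq4[of "?S p - I'" "?S p - I"] by (simp add: algebra_simps)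
  ultimately show False by simp
qed

lemma curve_integral_eqI: "has_curve_integral F I \<gamma> \<Longrightarrow> curve_integral \<gamma> F = I"
  unfolding curve_integral_def by (blast intro: the_equality has_curve_integral_unique)

text \<open>Positive orientation is expressed by winding number \<open>1\<close> about the interior points. The point
  \<open>0\<close> belongs to the spectrum of a compact operator, but is listed explicitly.\<close>

definition separating_curve :: "linf_op \<Rightarrow> complex \<Rightarrow> (real \<Rightarrow> complex) \<Rightarrow> bool"
  where "separating_curve T lam \<gamma> \<longleftrightarrow>
    simple_path \<gamma> \<and> pathfinish \<gamma> = pathstart \<gamma> \<and> rectifiable_path \<gamma> \<and>
    (\<forall>z\<in>inside (path_image \<gamma>). winding_number \<gamma> z = 1) \<and>
    path_image \<gamma> \<subseteq> resolvent_set T \<and>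
    lam \<in> inside (path_image \<gamma>) \<and>
    insert 0 (op_spectrum T) - {lam} \<subseteq> outside (path_image \<gamma>)"


section \<open>Green's kernels\<close>

definition Omega1 :: "(real \<times> real) set"
  where "Omega1 = {(s, t). 0 \<le> t \<and> t \<le> s \<and> s \<le> 1}"

definition Omega2 :: "(real \<times> real) set"
  where "Omega2 = {(s, t). 0 \<le> s \<and> s \<le> t \<and> t \<le> 1}"

text \<open>\<open>D j k\<close> is the partial derivative of order \<open>j\<close> in the first and \<open>k\<close> in the second variable.
  Derivatives are taken within the sections of \<open>\<Omega>\<close>, hence are one-sided on its boundary;
  where a section is a single point the derivative condition is void and the value of \<open>D j k\<close>
  is determined by continuity. The set \<open>A\<close> of orders is meant to be closed downwards.\<close>

definition has_bounded_cont_partials ::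
    "(nat \<times> nat) set \<Rightarrow> (real \<times> real) set \<Rightarrow> (real \<times> real \<Rightarrow> real) \<Rightarrow> bool"
  where "has_bounded_cont_partials A \<Omega> f \<longleftrightarrow>
    (\<exists>D :: nat \<Rightarrow> nat \<Rightarrow> real \<times> real \<Rightarrow> real.
      (\<forall>p\<in>\<Omega>. D 0 0 p = f p) \<and>
      (\<forall>(j, k)\<in>A. continuous_on \<Omega> (D j k) \<and> bounded (D j k ` \<Omega>)) \<and>
      (\<forall>j k. (Suc j, k) \<in> A \<longrightarrow> (\<forall>(s, t)\<in>\<Omega>.
        ((\<lambda>u. D j k (u, t)) has_real_derivative D (Suc j) k (s, t)) (at s within {u. (u, t) \<in> \<Omega>}))) \<and>
      (\<forall>j k. (j, Suc k) \<in> A \<longrightarrow> (\<forall>(s, t)\<in>\<Omega>.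
        ((\<lambda>u. D j k (s, u)) has_real_derivative D j (Suc k) (s, t)) (at t within {u. (s, u) \<in> \<Omega>}))))"

text \<open>The class \<open>C\<^sup>\<alpha>\<close> on one of the closed triangles (where continuity implies boundedness).\<close>

definition C_class :: "nat \<Rightarrow> (real \<times> real) set \<Rightarrow> (real \<times> real \<Rightarrow> real) \<Rightarrow> bool"
  where "C_class \<alpha> \<Omega> f \<longleftrightarrow> has_bounded_cont_partials {(j, k). j + k \<le> \<alpha>} \<Omega> f"

definition green_kernel :: "nat \<Rightarrow> (real \<times> real \<Rightarrow> real) \<Rightarrow> bool"
  where "green_kernel r \<kappa> \<longleftrightarrow>
    continuous_on ({0..1} \<times> {0..1}) \<kappa> \<and>
    (\<exists>\<kappa>1 \<kappa>2 \<alpha>.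
      (\<forall>p\<in>Omega1. \<kappa> p = \<kappa>1 p) \<and> (\<forall>p\<in>Omega2. \<kappa> p = \<kappa>2 p) \<and>
      (\<forall>s\<in>{0..1}. \<kappa>1 (s, s) = \<kappa>2 (s, s)) \<and>
      r < \<alpha> \<and> C_class \<alpha> Omega1 \<kappa>1 \<and> C_class \<alpha> Omega2 \<kappa>2 \<and>
      has_bounded_cont_partials ({..2 * r + 2} \<times> {..2 * r + 2}) Omega1 \<kappa>1 \<and>
      has_bounded_cont_partials ({..2 * r + 2} \<times> {..2 * r + 2}) Omega2 \<kappa>2)"

text \<open>\<open>abs_linf\<close> and \<open>rep_linf\<close> pass from an essentially bounded function to its class and from a
  class to a representative.\<close>

definition kernel_integral :: "(real \<times> real \<Rightarrow> real) \<Rightarrow> linf \<Rightarrow> real \<Rightarrow> complex"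
  where "kernel_integral \<kappa> x s = (LINT t|unit_measure. complex_of_real (\<kappa> (s, t)) * rep_linf x t)"

definition integral_op :: "(real \<times> real \<Rightarrow> real) \<Rightarrow> linf_op"
  where "integral_op \<kappa> = Blinfun (\<lambda>x. abs_linf (kernel_integral \<kappa> x))"


section \<open>Piecewise polynomial interpolation\<close>

definition partition_interval :: "nat \<Rightarrow> nat \<Rightarrow> real set"
  where "partition_interval n j = {(real j - 1) / real n .. real j / real n}"

definition pp_space :: "nat \<Rightarrow> nat \<Rightarrow> linf set"
  where "pp_space r n = {x. \<exists>p :: nat \<Rightarrow> complex poly. \<forall>j\<in>{1..n}. degree (p j) \<le> 2 * r \<and>
    (AE t in unit_measure. t \<in> partition_interval n j \<longrightarrow> rep_linf x t = poly (p j) (of_real t))}"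

definition node :: "nat \<Rightarrow> nat \<Rightarrow> nat \<Rightarrow> nat \<Rightarrow> real"
  where "node r n j i =
    (if r = 0 then ((real j - 1) / real n + real j / real n) / 2
     else (real j - 1) / real n + real i * (1 / real n) / (2 * real r))"

definition interp_poly :: "nat \<Rightarrow> nat \<Rightarrow> (real \<Rightarrow> complex) \<Rightarrow> nat \<Rightarrow> complex poly"
  where "interp_poly r n f j = (THE p. degree p \<le> 2 * r \<and>
    (\<forall>i\<le>2 * r. poly p (of_real (node r n j i)) = f (node r n j i)))"

text \<open>The index of a subinterval containing \<open>t\<close>; the choice at the partition points is
  immaterial in \<open>L\<^sup>\<infinity>\<close>.\<close>

definition piece :: "nat \<Rightarrow> real \<Rightarrow> nat"
  where "piece n t = max 1 (nat \<lceil>real n * t\<rceil>)"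

definition interp :: "nat \<Rightarrow> nat \<Rightarrow> (real \<Rightarrow> complex) \<Rightarrow> linf"
  where "interp r n f = abs_linf (\<lambda>t. poly (interp_poly r n f (piece n t)) (of_real t))"

definition collocation_op :: "nat \<Rightarrow> nat \<Rightarrow> (real \<times> real \<Rightarrow> real) \<Rightarrow> linf_op"
  where "collocation_op r n \<kappa> = Blinfun (\<lambda>x. interp r n (kernel_integral \<kappa> x))"


section \<open>The space is complete and the operators are well defined\<close>

lemma ess_bounded_rep: "ess_bounded (rep_linf x)"
  using Quotient3_rep_reflp[OF Quotient3_linf, of x] by (simp add: linf_rel_def)

lemma rep_abs_linf: "ess_bounded f \<Longrightarrow> AE t in unit_measure. rep_linf (abs_linf f) t = f t"
  using Quotient3_rep_abs[OF Quotient3_linf, of f] by (simp add: linf_rel_def)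

lemma abs_rep_linf: "abs_linf (rep_linf x) = x"
  by (rule Quotient3_abs_rep[OF Quotient3_linf])

lemma norm_abs_linf: "ess_bounded f \<Longrightarrow> norm (abs_linf f) = ess_norm f"
  by (rule norm_linf.abs_eq) (simp add: linf_rel_def)

lemma norm_linf_eq: "norm x = ess_norm (rep_linf x)"
  using norm_abs_linf[OF ess_bounded_rep, of x] by (simp add: abs_rep_linf)

lemma abs_linf_eqI:
  "ess_bounded f \<Longrightarrow> ess_bounded g \<Longrightarrow> AE t in unit_measure. f t = g t \<Longrightarrow> abs_linf f = abs_linf g"
  using Quotient3_rel_abs[OF Quotient3_linf, of f g] by (simp add: linf_rel_def)

lemma abs_linf_add:
  "ess_bounded f \<Longrightarrow> ess_bounded g \<Longrightarrow> abs_linf f + abs_linf g = abs_linf (\<lambda>t. f t + g t)"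
  by (rule plus_linf.abs_eq) (simp_all add: linf_rel_def)

lemma abs_linf_scaleC: "ess_bounded f \<Longrightarrow> c *\<^sub>C abs_linf f = abs_linf (\<lambda>t. c * f t)"
  by (rule scaleC_linf.abs_eq) (simp add: linf_rel_def)

lemma AE_rep_add: "AE t in unit_measure. rep_linf (x + y) t = rep_linf x t + rep_linf y t"
  using rep_abs_linf[OF ess_bounded_add[OF ess_bounded_rep ess_bounded_rep], of x y]
  by (simp add: abs_linf_add[OF ess_bounded_rep ess_bounded_rep, symmetric] abs_rep_linf)

lemma abs_linf_diff:
  "ess_bounded f \<Longrightarrow> ess_bounded g \<Longrightarrow> abs_linf f - abs_linf g = abs_linf (\<lambda>t. f t - g t)"
  by (rule minus_linf.abs_eq) (simp_all add: linf_rel_def)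

instance linf :: banach
proof
  fix X :: "nat \<Rightarrow> linf" assume X: "Cauchy X"
  define f where "f n = rep_linf (X n)" for n
  have f: "ess_bounded (f n)" for n by (simp add: f_def ess_bounded_rep)
  have Xf: "X n = abs_linf (f n)" for n by (simp add: f_def abs_rep_linf)
  have "AE t in unit_measure. norm (f m t - f n t) \<le> norm (X m - X n)" for m n
    using AE_le_ess_norm[OF ess_bounded_diff[OF f f], of m n]
    by (simp add: Xf abs_linf_diff f norm_abs_linf ess_bounded_diff)
  then have close: "AE t in unit_measure. \<forall>m n. norm (f m t - f n t) \<le> norm (X m - X n)"
    by (simp add: AE_all_countable)
  define g where "g t = lim (\<lambda>n. f n t)" for t
  have lim: "AE t in unit_measure. (\<lambda>n. f n t) \<longlonglongrightarrow> g t"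
    using close
  proof eventually_elim
    fix t assume t: "\<forall>m n. norm (f m t - f n t) \<le> norm (X m - X n)"
    have "Cauchy (\<lambda>n. f n t)"
      using X t unfolding Cauchy_def dist_norm by (meson le_less_trans)
    then show "(\<lambda>n. f n t) \<longlonglongrightarrow> g t"
      unfolding g_def by (simp add: Cauchy_convergent_iff convergent_LIMSEQ_iff)
  qed
  have uniform: "AE t in unit_measure. norm (g t - f n t) \<le> e"
    if "\<And>m. m \<ge> n \<Longrightarrow> norm (X m - X n) \<le> e" for n e
    using close lim
  proof eventually_elim
    fix t assume t: "\<forall>m n. norm (f m t - f n t) \<le> norm (X m - X n)" "(\<lambda>n. f n t) \<longlonglongrightarrow> g t"
    have "(\<lambda>m. norm (f m t - f n t)) \<longlonglongrightarrow> norm (g t - f n t)"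
      by (intro tendsto_intros t)
    then show "norm (g t - f n t) \<le> e"
      by (rule LIMSEQ_le_const2) (use t(1) that order.trans in blast)
  qed
  have Cau: "\<exists>N. \<forall>n\<ge>N. \<forall>m\<ge>n. norm (X m - X n) \<le> e" if "e > 0" for e
    using X that unfolding Cauchy_def dist_norm by (meson le_trans less_imp_le)
  have g: "ess_bounded g"
  proof -
    obtain N where "\<And>m. m \<ge> N \<Longrightarrow> norm (X m - X N) \<le> 1"
      using Cau[of 1] by auto
    then have "AE t in unit_measure. norm (g t - f N t) \<le> 1" by (rule uniform)
    with AE_le_ess_norm[OF f[of N]] have "AE t in unit_measure. norm (g t) \<le> ess_norm (f N) + 1"
    proof eventually_elim
      fix t assume "norm (f N t) \<le> ess_norm (f N)" "norm (g t - f N t) \<le> 1"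
      then show "norm (g t) \<le> ess_norm (f N) + 1"
        using norm_triangle_ineq[of "f N t" "g t - f N t"] by simp
    qed
    moreover have "g \<in> borel_measurable unit_measure"
      unfolding g_def[abs_def] using f
      by (intro borel_measurable_lim_metric) (simp add: ess_bounded_def)
    ultimately show ?thesis by (auto simp: ess_bounded_def)
  qed
  have "X \<longlonglongrightarrow> abs_linf g"
  proof (rule LIMSEQ_I)
    fix e :: real assume "e > 0"
    then obtain N where N: "\<And>n m. n \<ge> N \<Longrightarrow> m \<ge> n \<Longrightarrow> norm (X m - X n) \<le> e / 2"
      using Cau[of "e / 2"] by auto
    have "norm (X n - abs_linf g) < e" if n: "n \<ge> N" for n
    proof -
      have "norm (abs_linf g - X n) \<le> e / 2"
        unfolding Xf abs_linf_diff[OF g f] norm_abs_linf[OF ess_bounded_diff[OF g f]]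
        by (intro ess_norm_le ess_bounded_diff g f uniform N n)
      then show ?thesis using \<open>e > 0\<close> by (simp add: norm_minus_commute)
    qed
    then show "\<exists>N. \<forall>n\<ge>N. norm (X n - abs_linf g) < e" by blast
  qed
  then show "convergent X" by (rule convergentI)
qed

lemma AE_rep_scaleC: "AE t in unit_measure. rep_linf (c *\<^sub>C x) t = c * rep_linf x t"
  using rep_abs_linf[OF ess_bounded_cmult[OF ess_bounded_rep], of c x]
  by (simp add: abs_linf_scaleC[OF ess_bounded_rep, symmetric] abs_rep_linf)

lemma ess_bounded_bounded:
  assumes "f \<in> borel_measurable unit_measure" "\<And>t. t \<in> {0..1} \<Longrightarrow> norm (f t) \<le> C"
  shows "ess_bounded f"
  unfolding ess_bounded_def using assms by (auto intro!: exI[of _ C] AE_I2)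

lemma ess_bounded_continuous:
  assumes "continuous_on {0..1} f" shows "ess_bounded f"
proof -
  have "bounded (f ` {0..1})"
    using assms by (intro compact_imp_bounded compact_continuous_image) auto
  then obtain C where "\<And>t. t \<in> {0..1} \<Longrightarrow> norm (f t) \<le> C"
    unfolding bounded_iff by blast
  then show ?thesis
    using assms by (intro ess_bounded_bounded continuous_imp_measurable_on_sets_lebesgue) auto
qed

lemma ess_bounded_mult:
  assumes f: "ess_bounded f" and g: "ess_bounded g"
  shows "ess_bounded (\<lambda>t. f t * g t)"
proof -
  have "AE t in unit_measure. norm (f t * g t) \<le> ess_norm f * ess_norm g"
    using AE_le_ess_norm[OF f] AE_le_ess_norm[OF g]
    by eventually_elim (simp add: norm_mult mult_mono' )
  then show ?thesis using f g by (auto simp: ess_bounded_def)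
qed

lemma integrable_ess_bounded: "ess_bounded f \<Longrightarrow> integrable unit_measure f"
proof -
  assume "ess_bounded f"
  moreover have "finite_measure unit_measure" by (simp add: finite_measure_lebesgue_on)
  ultimately show ?thesis
    unfolding ess_bounded_def by (auto intro: finite_measure.integrable_const_bound)
qed

lemma norm_integral_ess_bounded:
  assumes "ess_bounded f" "AE t in unit_measure. norm (f t) \<le> C"
  shows "norm (LINT t|unit_measure. f t) \<le> C"
proof -
  have fin: "finite_measure unit_measure" by (simp add: finite_measure_lebesgue_on)
  have "norm (LINT t|unit_measure. f t) \<le> (LINT t|unit_measure. norm (f t))"
    by (rule integral_norm_bound)
  also have "\<dots> \<le> (LINT t|unit_measure. C)"
    using assms integrable_ess_bounded[OF assms(1)] finite_measure.integrable_const[OF fin, of C]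
    by (intro integral_mono_AE) auto
  also have "\<dots> = C"
    using emeasure_unit by (simp add: measure_def)
  finally show ?thesis .
qed

context
  fixes \<kappa> :: "real \<times> real \<Rightarrow> real"
  assumes cont: "continuous_on ({0..1} \<times> {0..1}) \<kappa>"
begin

lemma ess_bounded_section:
  assumes "s \<in> {0..1}" shows "ess_bounded (\<lambda>t. complex_of_real (\<kappa> (s, t)))"
proof (rule ess_bounded_continuous)
  have "continuous_on {0..1} (\<lambda>t. \<kappa> (s, t))"
    by (rule continuous_on_compose2[OF cont]) (use assms in \<open>auto intro!: continuous_intros\<close>)
  then show "continuous_on {0..1} (\<lambda>t. complex_of_real (\<kappa> (s, t)))"
    by (intro continuous_intros)
qed

lemma kernel_integral_add:
  assumes "s \<in> {0..1}"
  shows "kernel_integral \<kappa> (x + y) s = kernel_integral \<kappa> x s + kernel_integral \<kappa> y s"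
proof -
  note * = ess_bounded_mult[OF ess_bounded_section[OF assms] ess_bounded_rep]
  have "kernel_integral \<kappa> (x + y) s = (LINT t|unit_measure. complex_of_real (\<kappa> (s, t)) * rep_linf x t
      + complex_of_real (\<kappa> (s, t)) * rep_linf y t)"
    unfolding kernel_integral_def
  proof (rule integral_cong_AE)
    show "AE t in unit_measure. complex_of_real (\<kappa> (s, t)) * rep_linf (x + y) t =
        complex_of_real (\<kappa> (s, t)) * rep_linf x t + complex_of_real (\<kappa> (s, t)) * rep_linf y t"
      using AE_rep_add[of x y] by eventually_elim (simp add: algebra_simps)
  qed (use *[of "x + y"] ess_bounded_add[OF *[of x] *[of y]] in \<open>simp_all add: ess_bounded_def\<close>)
  then show ?thesis
    unfolding kernel_integral_def using integrable_ess_bounded[OF *] by simp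
qed

lemma kernel_integral_scaleC:
  assumes "s \<in> {0..1}"
  shows "kernel_integral \<kappa> (c *\<^sub>C x) s = c * kernel_integral \<kappa> x s"
proof -
  note * = ess_bounded_mult[OF ess_bounded_section[OF assms] ess_bounded_rep]
  have "kernel_integral \<kappa> (c *\<^sub>C x) s =
      (LINT t|unit_measure. c * (complex_of_real (\<kappa> (s, t)) * rep_linf x t))"
    unfolding kernel_integral_def
  proof (rule integral_cong_AE)
    show "AE t in unit_measure. complex_of_real (\<kappa> (s, t)) * rep_linf (c *\<^sub>C x) t =
        c * (complex_of_real (\<kappa> (s, t)) * rep_linf x t)"
      using AE_rep_scaleC[of c x] by eventually_elim (simp add: algebra_simps)
  qed (use *[of "c *\<^sub>C x"] ess_bounded_cmult[OF *[of x], of c] in \<open>simp_all add: ess_bounded_def\<close>)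
  then show ?thesis
    unfolding kernel_integral_def using integrable_ess_bounded[OF *] by simp
qed

lemma kernel_integral_bound:
  obtains B where "0 \<le> B" "\<And>x s. s \<in> {0..1} \<Longrightarrow> norm (kernel_integral \<kappa> x s) \<le> B * norm x"
proof -
  have "bounded (\<kappa> ` ({0..1} \<times> {0..1}))"
    using cont by (intro compact_imp_bounded compact_continuous_image compact_Times) auto
  then obtain B where "\<And>p. p \<in> {0..1} \<times> {0..1} \<Longrightarrow> norm (\<kappa> p) \<le> B" by (meson bounded_iff imageI)
  then have B: "\<bar>\<kappa> (s, t)\<bar> \<le> \<bar>B\<bar>" if "s \<in> {0..1}" "t \<in> {0..1}" for s t
    using that by fastforce
  have "norm (kernel_integral \<kappa> x s) \<le> \<bar>B\<bar> * norm x" if s: "s \<in> {0..1}" for x s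
    unfolding kernel_integral_def
  proof (rule norm_integral_ess_bounded[OF ess_bounded_mult[OF ess_bounded_section[OF s] ess_bounded_rep]])
    have "AE t in unit_measure. t \<in> {0..1}" by (rule AE_I2) simp
    then show "AE t in unit_measure. norm (complex_of_real (\<kappa> (s, t)) * rep_linf x t) \<le> \<bar>B\<bar> * norm x"
      using AE_le_ess_norm[OF ess_bounded_rep[of x]]
      by eventually_elim (use B[OF s] in \<open>auto simp: norm_mult norm_linf_eq intro!: mult_mono\<close>)
  qed
  then show ?thesis by (intro that[of "\<bar>B\<bar>"]) auto
qed

lemma continuous_kernel_integral: "continuous_on {0..1} (kernel_integral \<kappa> x)"
proof (rule continuous_onI)
  fix s e :: real assume s: "s \<in> {0..1}" and e: "e > 0"
  have "uniformly_continuous_on ({0..1} \<times> {0..1}) \<kappa>"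
    using cont by (intro compact_uniformly_continuous compact_Times) auto
  moreover have "e / (norm x + 1) > 0" using e by (simp add: add_nonneg_pos)
  ultimately obtain d where d: "d > 0" "\<And>p q. p \<in> {0..1} \<times> {0..1} \<Longrightarrow> q \<in> {0..1} \<times> {0..1} \<Longrightarrow>
      dist q p < d \<Longrightarrow> dist (\<kappa> q) (\<kappa> p) < e / (norm x + 1)"
    unfolding uniformly_continuous_on_def by meson
  show "\<exists>d>0. \<forall>u\<in>{0..1}. dist u s < d \<longrightarrow> dist (kernel_integral \<kappa> x u) (kernel_integral \<kappa> x s) \<le> e"
  proof (intro exI[of _ d] conjI ballI impI d(1))
    fix u :: real assume u: "u \<in> {0..1}" and us: "dist u s < d"
    note * = ess_bounded_mult[OF ess_bounded_section ess_bounded_rep[of x]]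
    have "kernel_integral \<kappa> x u - kernel_integral \<kappa> x s =
        (LINT t|unit_measure. complex_of_real (\<kappa> (u, t)) * rep_linf x t
          - complex_of_real (\<kappa> (s, t)) * rep_linf x t)"
      unfolding kernel_integral_def
      using integrable_ess_bounded[OF *[OF u]] integrable_ess_bounded[OF *[OF s]] by simp
    also have "norm \<dots> \<le> e / (norm x + 1) * norm x"
    proof (rule norm_integral_ess_bounded[OF ess_bounded_diff[OF *[OF u] *[OF s]]])
      have "AE t in unit_measure. t \<in> {0..1}" by (rule AE_I2) simp
      then show "AE t in unit_measure. norm (complex_of_real (\<kappa> (u, t)) * rep_linf x t
          - complex_of_real (\<kappa> (s, t)) * rep_linf x t) \<le> e / (norm x + 1) * norm x"
        using AE_le_ess_norm[OF ess_bounded_rep[of x]]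
      proof eventually_elim
        fix t :: real assume t: "t \<in> {0..1}" and xt: "norm (rep_linf x t) \<le> ess_norm (rep_linf x)"
        have "dist (u, t) (s, t) < d" using us by (simp add: dist_Pair_Pair)
        then have \<kappa>: "\<bar>\<kappa> (u, t) - \<kappa> (s, t)\<bar> \<le> e / (norm x + 1)"
          using d(2)[of "(s, t)" "(u, t)"] s t u by (simp add: dist_real_def)
        have "complex_of_real (\<kappa> (u, t)) * rep_linf x t - complex_of_real (\<kappa> (s, t)) * rep_linf x t
            = complex_of_real (\<kappa> (u, t) - \<kappa> (s, t)) * rep_linf x t"
          by (simp add: algebra_simps)
        then have "norm (complex_of_real (\<kappa> (u, t)) * rep_linf x t
            - complex_of_real (\<kappa> (s, t)) * rep_linf x t) = \<bar>\<kappa> (u, t) - \<kappa> (s, t)\<bar> * norm (rep_linf x t)"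
          by (simp only: norm_mult norm_of_real)
        also have "\<dots> \<le> e / (norm x + 1) * norm x"
          using xt \<kappa> e by (intro mult_mono) (auto simp: norm_linf_eq[symmetric])
        finally show "norm (complex_of_real (\<kappa> (u, t)) * rep_linf x t
            - complex_of_real (\<kappa> (s, t)) * rep_linf x t) \<le> e / (norm x + 1) * norm x" .
      qed
    qed
    also have "\<dots> \<le> e"
    proof -
      have "norm x + 1 > 0" by (simp add: add_nonneg_pos)
      then show ?thesis using e by (simp add: pos_divide_le_eq)
    qed
    finally show "dist (kernel_integral \<kappa> x u) (kernel_integral \<kappa> x s) \<le> e"
      by (simp add: dist_norm)
  qed
qed

lemma bounded_linear_integral_op: "bounded_linear (\<lambda>x. abs_linf (kernel_integral \<kappa> x))"
proof -
  have eb: "ess_bounded (kernel_integral \<kappa> x)" for x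
    by (rule ess_bounded_continuous[OF continuous_kernel_integral])
  obtain B where B: "\<And>x s. s \<in> {0..1} \<Longrightarrow> norm (kernel_integral \<kappa> x s) \<le> B * norm x"
    by (rule kernel_integral_bound) blast
  show ?thesis
  proof (rule bounded_linear_intro[where K = B])
    show "abs_linf (kernel_integral \<kappa> (x + y)) =
        abs_linf (kernel_integral \<kappa> x) + abs_linf (kernel_integral \<kappa> y)" for x y
      by (subst abs_linf_add[OF eb eb], rule abs_linf_eqI[OF eb ess_bounded_add[OF eb eb]])
        (auto intro!: AE_I2 kernel_integral_add)
    show "abs_linf (kernel_integral \<kappa> (c *\<^sub>R x)) = c *\<^sub>R abs_linf (kernel_integral \<kappa> x)" for c x
      by (unfold scaleR_scaleC_linf, subst abs_linf_scaleC[OF eb],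
          rule abs_linf_eqI[OF eb ess_bounded_cmult[OF eb]])
        (auto intro!: AE_I2 kernel_integral_scaleC)
    show "norm (abs_linf (kernel_integral \<kappa> x)) \<le> norm x * B" for x
      unfolding norm_abs_linf[OF eb]
      by (rule ess_norm_le[OF eb]) (auto intro!: AE_I2 B simp: mult.commute[of _ B])
  qed
qed

lemma integral_op_apply: "blinfun_apply (integral_op \<kappa>) x = abs_linf (kernel_integral \<kappa> x)"
  unfolding integral_op_def by (simp add: bounded_linear_Blinfun_apply bounded_linear_integral_op)

end

lemma node_inj:
  assumes "n \<ge> 1" "i \<le> 2 * r" "m \<le> 2 * r" "node r n j i = node r n j m"
  shows "i = m"
  using assms by (auto simp: node_def split: if_splits)

lemma interp_poly_eqI:
  assumes "n \<ge> 1" "degree p \<le> 2 * r"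
    "\<And>i. i \<le> 2 * r \<Longrightarrow> poly p (of_real (node r n j i)) = f (node r n j i)"
  shows "interp_poly r n f j = p"
  unfolding interp_poly_def
proof (rule the_equality)
  fix q assume q: "degree q \<le> 2 * r \<and> (\<forall>i\<le>2 * r. poly q (of_real (node r n j i)) = f (node r n j i))"
  have inj: "inj_on (\<lambda>i. complex_of_real (node r n j i)) {..2 * r}"
    using node_inj[OF assms(1)] by (auto intro!: inj_onI)
  show "q = p"
  proof (rule poly_eqI_degree[where A = "(\<lambda>i. complex_of_real (node r n j i)) ` {..2 * r}"])
    show "degree q < card ((\<lambda>i. complex_of_real (node r n j i)) ` {..2 * r})"
      "degree p < card ((\<lambda>i. complex_of_real (node r n j i)) ` {..2 * r})"
      using q assms(2) by (simp_all add: card_image[OF inj])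
  qed (use q assms(3) in auto)
qed (use assms in auto)

definition lagrange_basis :: "nat \<Rightarrow> nat \<Rightarrow> nat \<Rightarrow> nat \<Rightarrow> complex poly"
  where "lagrange_basis r n j i = (\<Prod>m\<in>{..2 * r} - {i}.
    smult (1 / of_real (node r n j i - node r n j m)) [:- of_real (node r n j m), 1:])"

lemma lagrange_basis:
  assumes "n \<ge> 1" "i \<le> 2 * r"
  shows "degree (lagrange_basis r n j i) \<le> 2 * r"
    and "m \<le> 2 * r \<Longrightarrow> poly (lagrange_basis r n j i) (of_real (node r n j m)) = (if m = i then 1 else 0)"
proof -
  have "degree (lagrange_basis r n j i) \<le> (\<Sum>m\<in>{..2 * r} - {i}. 1)"
    unfolding lagrange_basis_def
    by (rule order.trans[OF degree_prod_sum_le], simp)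
      (unfold o_def, rule sum_mono, rule order.trans[OF degree_smult_le], simp)
  also have "\<dots> = 2 * r" using assms by (simp add: card_Diff_singleton)
  finally show "degree (lagrange_basis r n j i) \<le> 2 * r" .
  assume m: "m \<le> 2 * r"
  show "poly (lagrange_basis r n j i) (of_real (node r n j m)) = (if m = i then 1 else 0)"
  proof (cases "m = i")
    case True
    have "poly (smult (1 / of_real (node r n j i - node r n j l)) [:- of_real (node r n j l), 1:])
        (complex_of_real (node r n j i)) = 1" if "l \<in> {..2 * r} - {i}" for l
    proof -
      have "node r n j i \<noteq> node r n j l"
        using node_inj[OF assms(1,2), of l j] that by auto
      then show ?thesis by (simp add: diff_divide_distrib[symmetric])
    qed
    then have "poly (lagrange_basis r n j i) (complex_of_real (node r n j i)) = 1"
      unfolding lagrange_basis_def poly_prod by (intro prod.neutral ballI)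
    then show ?thesis using True by simp
  next
    case False
    then show ?thesis using m
      unfolding lagrange_basis_def poly_prod by (auto intro!: prod_zero bexI[of _ m])
  qed
qed

lemma lagrange_interpolation:
  fixes r n :: nat and p :: "(real \<Rightarrow> complex) \<Rightarrow> nat \<Rightarrow> complex poly"
  assumes "n \<ge> 1"
  defines "p \<equiv> \<lambda>f j. \<Sum>i\<le>2 * r. smult (f (node r n j i)) (lagrange_basis r n j i)"
  shows "degree (p f j) \<le> 2 * r"
    and "i \<le> 2 * r \<Longrightarrow> poly (p f j) (of_real (node r n j i)) = f (node r n j i)"
proof -
  show "degree (p f j) \<le> 2 * r"
    unfolding p_def
    by (rule degree_sum_le) (auto intro!: order.trans[OF degree_smult_le] lagrange_basis assms(1))
  assume i: "i \<le> 2 * r"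
  have "poly (p f j) (of_real (node r n j i)) = (\<Sum>m\<le>2 * r. if i = m then f (node r n j m) else 0)"
    unfolding p_def poly_sum by (rule sum.cong) (use i assms(1) lagrange_basis(2) in auto)
  then show "poly (p f j) (of_real (node r n j i)) = f (node r n j i)"
    using i by simp
qed

lemma interp_poly_lagrange:
  assumes "n \<ge> 1"
  shows "interp_poly r n f j = (\<Sum>i\<le>2 * r. smult (f (node r n j i)) (lagrange_basis r n j i))"
  by (intro interp_poly_eqI assms lagrange_interpolation)

lemma interp_poly:
  assumes "n \<ge> 1"
  shows "degree (interp_poly r n f j) \<le> 2 * r"
    and "i \<le> 2 * r \<Longrightarrow> poly (interp_poly r n f j) (of_real (node r n j i)) = f (node r n j i)"
  using lagrange_interpolation[OF assms] by (simp_all add: interp_poly_lagrange[OF assms])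

lemma node_in_interval:
  assumes "n \<ge> 1" "i \<le> 2 * r"
  shows "node r n j i \<in> partition_interval n j"
proof (cases "r = 0")
  case True
  then show ?thesis using assms by (auto simp: node_def partition_interval_def field_simps)
next
  case False
  have "real i * (1 / real n) / (2 * real r) \<le> 1 / real n"
    using assms False by (simp add: field_simps)
  moreover have "real j / real n = (real j - 1) / real n + 1 / real n"
    using assms by (simp add: field_simps)
  ultimately show ?thesis using False by (simp add: node_def partition_interval_def)
qed

lemma partition_interval_subset:
  assumes "j \<in> {1..n}" shows "partition_interval n j \<subseteq> {0..1}"
proof
  fix t assume t: "t \<in> partition_interval n j"
  have "0 \<le> (real j - 1) / real n" "real j / real n \<le> 1"
    using assms by (auto simp: divide_simps)
  then show "t \<in> {0..1}" using t by (auto simp: partition_interval_def)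
qed

lemma piece_in:
  assumes "n \<ge> 1" "t \<in> {0..1}" shows "piece n t \<in> {1..n}"
proof -
  have "real n * t \<le> real n * 1" using assms by (intro mult_left_mono) auto
  then have "\<lceil>real n * t\<rceil> \<le> int n" by (simp add: ceiling_le_iff)
  then show ?thesis using assms by (auto simp: piece_def)
qed

lemma piece_eq:
  assumes "j \<in> {1..n}" "t \<in> partition_interval n j" "t \<noteq> (real j - 1) / real n"
  shows "piece n t = j"
proof -
  have "(real j - 1) / real n < t" "t \<le> real j / real n"
    using assms by (auto simp: partition_interval_def)
  then have "real j - 1 < real n * t" "real n * t \<le> real j"
    using assms(1) by (auto simp: field_simps)
  then have "\<lceil>real n * t\<rceil> = int j" by (intro ceiling_unique) auto
  then show ?thesis using assms(1) by (simp add: piece_def)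
qed

lemma ess_bounded_interp:
  assumes "n \<ge> 1"
  shows "ess_bounded (\<lambda>t. poly (interp_poly r n f (piece n t)) (of_real t))"
proof -
  have "bounded ((\<lambda>t. poly (interp_poly r n f j) (complex_of_real t)) ` {0..1})" for j
    by (intro compact_imp_bounded compact_continuous_image continuous_intros) auto
  then have "\<exists>C. \<forall>t\<in>{0..1}. norm (poly (interp_poly r n f j) (complex_of_real t)) \<le> C" for j
    unfolding bounded_iff by blast
  then obtain C where C: "\<And>j t. t \<in> {0..1} \<Longrightarrow> norm (poly (interp_poly r n f j) (complex_of_real t)) \<le> C j"
    by metis
  show ?thesis
  proof (rule ess_bounded_bounded)
    show "(\<lambda>t. poly (interp_poly r n f (piece n t)) (complex_of_real t)) \<in> borel_measurable unit_measure"
    proof (rule measurable_compose_countable)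
      show "(\<lambda>t. poly (interp_poly r n f j) (complex_of_real t)) \<in> borel_measurable unit_measure" for j
        by (intro continuous_imp_measurable_on_sets_lebesgue continuous_intros) auto
      have "piece n \<in> measurable borel (count_space UNIV)"
        unfolding piece_def[abs_def] by measurable
      then show "piece n \<in> measurable unit_measure (count_space UNIV)"
        by (intro measurable_restrict_space1 measurable_completion) simp
    qed
    fix t :: real assume t: "t \<in> {0..1}"
    have "norm (poly (interp_poly r n f (piece n t)) (complex_of_real t)) \<le> C (piece n t)"
      by (rule C[OF t])
    also have "\<dots> \<le> (\<Sum>j\<in>{1..n}. \<bar>C j\<bar>)"
      using member_le_sum[of "piece n t" "{1..n}" "\<lambda>j. \<bar>C j\<bar>"] piece_in[OF assms t] by simp
    finally show "norm (poly (interp_poly r n f (piece n t)) (complex_of_real t)) \<le> (\<Sum>j\<in>{1..n}. \<bar>C j\<bar>)" .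
  qed
qed

lemma interp_on_interval:
  assumes "j \<in> {1..n}"
  shows "AE t in unit_measure. t \<in> partition_interval n j \<longrightarrow>
    rep_linf (interp r n f) t = poly (interp_poly r n f j) (of_real t)"
proof -
  have n: "n \<ge> 1" using assms by auto
  have "AE t in lebesgue. t \<noteq> (real j - 1) / real n"
    by (rule AE_I[of _ _ "{(real j - 1) / real n}"]) auto
  then have "AE t in unit_measure. t \<noteq> (real j - 1) / real n"
    by (subst AE_restrict_space_iff) (auto elim: eventually_mono)
  then show ?thesis
    using rep_abs_linf[OF ess_bounded_interp[OF n, of r f]]
    by eventually_elim (use piece_eq[OF assms] in \<open>auto simp: interp_def\<close>)
qed

lemma interp_in_pp_space: "n \<ge> 1 \<Longrightarrow> interp r n f \<in> pp_space r n"
  unfolding pp_space_def using interp_poly(1) interp_on_interval by blast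

lemma bounded_linear_collocation_op:
  assumes n: "n \<ge> 1" and cont: "continuous_on ({0..1} \<times> {0..1}) \<kappa>"
  shows "bounded_linear (\<lambda>x. interp r n (kernel_integral \<kappa> x))"
proof -
  note eb = ess_bounded_interp[OF n]
  note poly_lin = interp_poly_lagrange[OF n] poly_sum
  have nd: "node r n j i \<in> {0..1}" if "j \<in> {1..n}" "i \<le> 2 * r" for i j
    using node_in_interval[OF n that(2), of j] partition_interval_subset[OF that(1)] by blast
  obtain B where B: "B \<ge> 0" "\<And>x s. s \<in> {0..1} \<Longrightarrow> norm (kernel_integral \<kappa> x s) \<le> B * norm x"
    by (rule kernel_integral_bound[OF cont]) blast
  have "bounded ((\<lambda>t. poly (lagrange_basis r n j i) (complex_of_real t)) ` {0..1})" for j i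
    by (intro compact_imp_bounded compact_continuous_image continuous_intros) auto
  then have "\<exists>C. \<forall>t\<in>{0..1}. norm (poly (lagrange_basis r n j i) (complex_of_real t)) \<le> C" for j i
    unfolding bounded_iff by blast
  then obtain C where C: "\<And>j i t. t \<in> {0..1} \<Longrightarrow> norm (poly (lagrange_basis r n j i) (complex_of_real t)) \<le> C j i"
    by metis
  let ?K = "\<Sum>j\<in>{1..n}. \<bar>\<Sum>i\<le>2 * r. B * \<bar>C j i\<bar>\<bar>"
  show ?thesis
  proof (rule bounded_linear_intro[where K = ?K])
    fix x y
    have "poly (interp_poly r n (kernel_integral \<kappa> (x + y)) (piece n t)) (of_real t) =
        poly (interp_poly r n (kernel_integral \<kappa> x) (piece n t)) (of_real t) +
        poly (interp_poly r n (kernel_integral \<kappa> y) (piece n t)) (of_real t)" if "t \<in> {0..1}" for t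
      unfolding poly_lin sum.distrib[symmetric]
      by (rule sum.cong) (auto simp: kernel_integral_add[OF cont nd[OF piece_in[OF n that]]] algebra_simps)
    then show "interp r n (kernel_integral \<kappa> (x + y)) =
        interp r n (kernel_integral \<kappa> x) + interp r n (kernel_integral \<kappa> y)"
      unfolding interp_def
      by (subst abs_linf_add[OF eb eb], intro abs_linf_eqI eb ess_bounded_add AE_I2) auto
  next
    fix c :: real and x
    have "poly (interp_poly r n (kernel_integral \<kappa> (of_real c *\<^sub>C x)) (piece n t)) (of_real t) =
        of_real c * poly (interp_poly r n (kernel_integral \<kappa> x) (piece n t)) (of_real t)"
      if "t \<in> {0..1}" for t
      unfolding poly_lin sum_distrib_left
      by (rule sum.cong) (auto simp: kernel_integral_scaleC[OF cont nd[OF piece_in[OF n that]]] algebra_simps)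
    then show "interp r n (kernel_integral \<kappa> (c *\<^sub>R x)) = c *\<^sub>R interp r n (kernel_integral \<kappa> x)"
      unfolding interp_def scaleR_scaleC_linf
      by (subst abs_linf_scaleC[OF eb], intro abs_linf_eqI eb ess_bounded_cmult AE_I2) auto
  next
    fix x
    have "norm (poly (interp_poly r n (kernel_integral \<kappa> x) (piece n t)) (of_real t)) \<le> norm x * ?K"
      if t: "t \<in> {0..1}" for t
    proof -
      note j = piece_in[OF n t]
      have "norm (poly (interp_poly r n (kernel_integral \<kappa> x) (piece n t)) (of_real t))
          \<le> (\<Sum>i\<le>2 * r. (B * norm x) * \<bar>C (piece n t) i\<bar>)"
        unfolding poly_lin
        by (rule sum_norm_le)
          (use B(1) B(2)[OF nd[OF j]] order.trans[OF C[OF t] abs_ge_self]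
           in \<open>auto simp: norm_mult intro!: mult_mono\<close>)
      also have "\<dots> = norm x * (\<Sum>i\<le>2 * r. B * \<bar>C (piece n t) i\<bar>)"
        by (simp add: sum_distrib_left mult_ac)
      also have "\<dots> \<le> norm x * ?K"
        by (intro mult_left_mono norm_ge_zero
            order.trans[OF abs_ge_self member_le_sum[where f = "\<lambda>j. \<bar>\<Sum>i\<le>2 * r. B * \<bar>C j i\<bar>\<bar>"]])
          (use j in auto)
      finally show ?thesis .
    qed
    then show "norm (interp r n (kernel_integral \<kappa> x)) \<le> norm x * ?K"
      unfolding interp_def norm_abs_linf[OF eb] by (intro ess_norm_le eb AE_I2) auto
  qed
qed

lemma collocation_op_apply:
  assumes "n \<ge> 1" "continuous_on ({0..1} \<times> {0..1}) \<kappa>"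
  shows "blinfun_apply (collocation_op r n \<kappa>) x = interp r n (kernel_integral \<kappa> x)"
  unfolding collocation_op_def
  by (simp add: bounded_linear_Blinfun_apply bounded_linear_collocation_op[OF assms])

end

theory Submission
  imports Defs
begin

text \<open>
  Write \<open>K\<close> for the integral operator, \<open>T\<^sub>n\<close> for the collocation operator, \<open>E\<close> for the spectral
  projection and \<open>h = 1 / n\<close>. All three estimates come from one operator, the reduced resolvent
  \<open>S \<mu> = (1 / (2 \<pi> \<i>)) \<integral>\<^sub>\<Gamma> (z - \<mu>)\<^sup>-\<^sup>1 (K - z)\<^sup>-\<^sup>1 dz\<close>. Multiplying the integrand by \<open>K - \<mu>\<close> gives
  \<open>(z - \<mu>)\<^sup>-\<^sup>1 + (K - z)\<^sup>-\<^sup>1\<close>, so \<open>S \<mu> (K - \<mu>) = (K - \<mu>) S \<mu> = 1 - E\<close> because \<open>\<Gamma>\<close> winds once around \<open>\<mu>\<close>;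
  moreover \<open>S \<mu>\<close> stays bounded as \<open>\<mu>\<close> approaches \<open>\<lambda>\<close>. This is proposition \<open>reduced_resolvent\<close>. Since \<open>\<Gamma>\<close>
  is only rectifiable, it rests on the existence of Riemann-Stieltjes integrals of continuous
  operator functions (\<open>curve_integral_exists\<close>) and on computing \<open>\<integral>\<^sub>\<Gamma> (z - \<mu>)\<^sup>-\<^sup>1 dz\<close> from a continuous
  logarithm (\<open>has_curve_integral_winding_number\<close>). The identity at \<open>\<mu> = \<lambda>\<close> shows \<open>E \<psi> = \<psi>\<close> for an
  eigenvector \<open>\<psi>\<close> of \<open>K\<close>, hence the range of \<open>E\<close> is spanned by \<open>\<psi>\<close>.

  If \<open>T\<^sub>n \<phi> = \<mu> \<phi>\<close> then \<open>(K - \<mu>) \<phi> = A \<phi>\<close> with \<open>A = K - T\<^sub>n\<close>, and therefore \<open>\<phi> - E \<phi> = S \<mu> A \<phi>\<close>. Splitting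
  \<open>A \<phi> = A E \<phi> + A (\<phi> - E \<phi>)\<close> and absorbing the second term, which is small since \<open>norm A = O(h)\<close>, reduces
  the first estimate to the size of \<open>A \<psi>\<close> for a single, smooth eigenvector of \<open>K\<close>.
  Similarly \<open>\<phi>S - E \<phi>S = (1 / \<mu>) S \<mu> K A \<phi>\<close> and \<open>\<lambda> (\<lambda> - \<mu>) E \<phi> = E K A \<phi>\<close>, so the other two estimates need \<open>K A \<phi>\<close>, hence \<open>K A \<psi>\<close> and the
  product of the bounds for \<open>A\<close> and for \<open>\<phi> - E \<phi>\<close>. This bookkeeping is \<open>eigenelement_errors\<close>.

  It remains to show \<open>norm A = O(h)\<close>, \<open>norm (A \<psi>) = O(h ^ (2 r + 1))\<close> and
  \<open>norm (K A \<psi>) = O(h ^ (2 r + 2))\<close>. The kernel is Lipschitz across the diagonal, so \<open>K x\<close> is Lipschitz and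
  interpolating it costs \<open>O(h)\<close> (\<open>collocation_op_converges\<close>). An eigenfunction of \<open>K\<close> gains one
  derivative each time it is substituted into the Volterra integrals over the two triangles, up to order
  \<open>2 r + 2\<close> (\<open>green_kernel_eigenfunction_smooth\<close>). For such a function the interpolation error on a
  cell is a multiple of the nodal polynomial up to \<open>O(h ^ (2 r + 2))\<close>
  (\<open>interp_error_expansion\<close>). The nodal polynomial is \<open>O(h ^ (2 r + 1))\<close>, and it is odd about the midpoint
  of the cell since the \<open>2 r + 1\<close> nodes lie symmetrically. So it integrates to zero against constants, and
  against the Lipschitz kernel one more power of \<open>h\<close> is gained (\<open>collocation_op_consistency\<close>).
\<close>

section \<open>Riemann-Stieltjes integrals along a rectifiable curve\<close>

interpretation scaleC_op: bounded_bilinear scaleC_op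
proof
  show "scaleC_op (a + a') T = scaleC_op a T + scaleC_op a' T" for a a' T
    by (rule blinfun_eqI) (simp add: scaleC_op_apply blinfun.add_left linf.scale_left_distrib)
  show "scaleC_op a (T + T') = scaleC_op a T + scaleC_op a T'" for a T T'
    by (rule blinfun_eqI) (simp add: scaleC_op_apply blinfun.add_left linf.scale_right_distrib)
  show "scaleC_op (c *\<^sub>R a) T = c *\<^sub>R scaleC_op a T" for a c T
    by (rule blinfun_eqI) (simp add: scaleC_op_apply blinfun.scaleR_left scaleR_scaleC_linf scaleR_conv_of_real)
  show "scaleC_op a (c *\<^sub>R T) = c *\<^sub>R scaleC_op a T" for a c T
    by (rule blinfun_eqI) (simp add: scaleC_op_apply blinfun.scaleR_left scaleR_scaleC_linf mult.commute)
  have "norm (scaleC_op a T) \<le> norm a * norm T * 1" for a T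
  proof (rule norm_blinfun_bound)
    show "norm (blinfun_apply (scaleC_op a T) x) \<le> norm a * norm T * 1 * norm x" for x
      by (simp add: scaleC_op_apply norm_scaleC_linf mult.assoc mult_left_mono norm_blinfun)
  qed simp
  then show "\<exists>K. \<forall>a T. norm (scaleC_op a T) \<le> norm a * norm T * K" by blast
qed

lemma norm_scaleC_op: "norm (scaleC_op c T) \<le> norm c * norm T"
  by (rule norm_blinfun_bound)
    (simp_all add: scaleC_op_apply norm_scaleC_linf mult.assoc mult_left_mono norm_blinfun)

lemma scaleC_op_scaleC_op: "scaleC_op a (scaleC_op b T) = scaleC_op (a * b) T"
  by (rule blinfun_eqI) (simp add: scaleC_op_apply)

lemma scaleC_op_one: "scaleC_op 1 T = T"
  by (rule blinfun_eqI) (simp add: scaleC_op_apply)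

definition increment :: "(real \<Rightarrow> complex) \<Rightarrow> real set \<Rightarrow> complex"
  where "increment \<gamma> J = (if J = {} then 0 else \<gamma> (Sup J) - \<gamma> (Inf J))"

text \<open>Clamping \<open>\<gamma>\<close> to the interval \<open>J\<close> turns the sum into a telescoping one.\<close>

lemma sum_increment_Int:
  assumes q: "q tagged_division_of {0..1}" and J: "J = {u..v}" "u \<le> v" "J \<subseteq> {0..1}"
  shows "(\<Sum>(t, J')\<in>q. increment \<gamma> (J \<inter> J')) = increment \<gamma> J"
proof -
  let ?\<gamma> = "\<lambda>x. \<gamma> (min v (max u x))"
  have uv: "0 \<le> u" "v \<le> 1" using J by auto
  have "(\<Sum>(t, J')\<in>q. increment \<gamma> (J \<inter> J')) = (\<Sum>(t, J')\<in>q. ?\<gamma> (Sup J') - ?\<gamma> (Inf J'))"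
  proof (rule sum.cong[OF refl], clarify)
    fix t J' assume tJ: "(t, J') \<in> q"
    obtain c d where J': "J' = cbox c d" using tagged_division_ofD(4)[OF q tJ] by blast
    moreover have "t \<in> J'" using tagged_division_ofD(2)[OF q tJ] .
    ultimately have cd: "J' = {c..d}" "c \<le> d" by auto
    have "J \<inter> J' = {max u c..min v d}" using J(1) cd(1) by auto
    then show "increment \<gamma> (J \<inter> J') = ?\<gamma> (Sup J') - ?\<gamma> (Inf J')"
      using J(2) cd by (auto simp: increment_def min_def max_def)
  qed
  also have "\<dots> = ?\<gamma> 1 - ?\<gamma> 0"
    by (rule additive_tagged_division_1[OF _ q]) simp
  also have "\<dots> = increment \<gamma> J" using J(1,2) uv by (auto simp: increment_def min_def max_def)
  finally show ?thesis .
qed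

lemma tagged_division_interval:
  assumes "p tagged_division_of {0..1::real}" "(t, J) \<in> p"
  obtains u v where "J = {u..v}" "u \<le> v" "J \<subseteq> {0..1}" "t \<in> J"
proof -
  obtain u v where "J = cbox u v" using tagged_division_ofD(4)[OF assms] by blast
  moreover have "t \<in> J" "J \<subseteq> {0..1}" using tagged_division_ofD(2,3)[OF assms] by auto
  ultimately show ?thesis by (intro that[of u v]) auto
qed

text \<open>The nonempty intersections of the cells of two tagged divisions form a division of the unit interval,
and a nondegenerate one determines the two cells it comes from, tags included, because the interiors
of distinct cells are disjoint. So the sum over pairs is at most a variation sum.\<close>

lemma sum_increment_refinement:
  assumes V: "\<And>d. d division_of {0..1} \<Longrightarrow> (\<Sum>J\<in>d. norm (\<gamma> (Sup J) - \<gamma> (Inf J))) \<le> V"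
    and p: "p tagged_division_of {0..1}" and q: "q tagged_division_of {0..1}"
  shows "(\<Sum>(t, J)\<in>p. \<Sum>(t', J')\<in>q. norm (increment \<gamma> (J \<inter> J'))) \<le> V"
proof -
  let ?N = "\<lambda>A. norm (increment \<gamma> A)"
  let ?f = "\<lambda>(x, y). snd x \<inter> snd y :: real set"
  let ?d = "{k1 \<inter> k2 | k1 k2. k1 \<in> snd ` p \<and> k2 \<in> snd ` q \<and> k1 \<inter> k2 \<noteq> {}}"
  define R where "R = {z \<in> p \<times> q. increment \<gamma> (?f z) \<noteq> 0}"
  have fin: "finite (p \<times> q)" using tagged_division_ofD(1)[OF p] tagged_division_ofD(1)[OF q] by simp
  have d: "?d division_of {0..1}"
    using division_inter[OF division_of_tagged_division[OF p] division_of_tagged_division[OF q]] by simp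
  have inj: "inj_on ?f R"
  proof (rule inj_onI)
    fix z w assume zw: "z \<in> R" "w \<in> R" "?f z = ?f w"
    obtain t J t' J' s I s' I' where zw_eq: "z = ((t, J), (t', J'))" "w = ((s, I), (s', I'))"
      by (metis prod.collapse)
    from zw have mem: "(t, J) \<in> p" "(t', J') \<in> q" "(s, I) \<in> p" "(s', I') \<in> q"
      and eq: "J \<inter> J' = I \<inter> I'" and nz: "increment \<gamma> (J \<inter> J') \<noteq> 0"
      by (auto simp: R_def zw_eq)
    obtain u v u' v' where "J = {u..v}" "J' = {u'..v'}"
      by (rule tagged_division_interval[OF p mem(1)], rule tagged_division_interval[OF q mem(2)]) blast
    then have A: "J \<inter> J' = {max u u'..min v v'}" by auto
    have "max u u' < min v v'"
    proof (rule ccontr)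
      assume "\<not> max u u' < min v v'"
      then have "max u u' = min v v' \<or> {max u u'..min v v'} = {}" by auto
      then have "increment \<gamma> {max u u'..min v v'} = 0" unfolding increment_def by force
      then show False using nz A by simp
    qed
    then have int: "interior (J \<inter> J') \<noteq> {}" unfolding A interior_atLeastAtMost_real by auto
    have sub: "interior (J \<inter> J') \<subseteq> interior J" "interior (J \<inter> J') \<subseteq> interior J'"
      "interior (J \<inter> J') \<subseteq> interior I" "interior (J \<inter> J') \<subseteq> interior I'"
      by (rule interior_mono, insert eq, blast)+
    have "(t, J) = (s, I)"
    proof (rule ccontr)
      assume "(t, J) \<noteq> (s, I)"
      then have "interior J \<inter> interior I = {}" by (rule tagged_division_ofD(5)[OF p mem(1,3)])
      then show False using int sub by blast
    qed
    moreover have "(t', J') = (s', I')"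
    proof (rule ccontr)
      assume "(t', J') \<noteq> (s', I')"
      then have "interior J' \<inter> interior I' = {}" by (rule tagged_division_ofD(5)[OF q mem(2,4)])
      then show False using int sub by blast
    qed
    ultimately show "z = w" by (simp add: zw_eq)
  qed
  have "(\<Sum>(t, J)\<in>p. \<Sum>(t', J')\<in>q. ?N (J \<inter> J')) = (\<Sum>z\<in>p \<times> q. ?N (?f z))"
    by (simp add: case_prod_unfold sum.cartesian_product)
  also have "\<dots> = (\<Sum>z\<in>R. ?N (?f z))"
    by (rule sum.mono_neutral_right[OF fin]) (auto simp: R_def)
  also have "\<dots> = (\<Sum>A\<in>?f ` R. ?N A)"
    by (simp add: sum.reindex[OF inj])
  also have "\<dots> \<le> (\<Sum>A\<in>?d. ?N A)"
  proof (rule sum_mono2)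
    show "finite ?d" using division_ofD(1)[OF d] .
    show "?f ` R \<subseteq> ?d"
    proof (rule image_subsetI)
      fix z assume "z \<in> R"
      then have "fst z \<in> p" "snd z \<in> q" "?f z \<noteq> {}"
        by (auto simp: R_def increment_def split_beta split: if_splits)
      then show "?f z \<in> ?d"
        by (intro CollectI exI[of _ "snd (fst z)"] exI[of _ "snd (snd z)"]) (simp add: split_beta)
    qed
  qed simp
  also have "\<dots> = (\<Sum>J\<in>?d. norm (\<gamma> (Sup J) - \<gamma> (Inf J)))"
    by (rule sum.cong) (auto simp: increment_def)
  also have "\<dots> \<le> V" by (rule V[OF d])
  finally show ?thesis .
qed

lemma sum_increment_le:
  fixes \<gamma> :: "real \<Rightarrow> complex"
  assumes V: "\<And>d. d division_of {0..1} \<Longrightarrow> (\<Sum>J\<in>d. norm (\<gamma> (Sup J) - \<gamma> (Inf J))) \<le> V"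
    and p: "p tagged_division_of {0..1}"
  shows "(\<Sum>(t, J)\<in>p. norm (\<gamma> (Sup J) - \<gamma> (Inf J))) \<le> V"
proof -
  have "(\<Sum>(t, J)\<in>p. norm (increment \<gamma> J)) = (\<Sum>J\<in>snd ` p. norm (increment \<gamma> J))"
    by (rule sum.over_tagged_division_lemma[OF p])
      (force simp: increment_def box_real cbox_interval)
  moreover have "(\<Sum>(t, J)\<in>p. norm (increment \<gamma> J)) = (\<Sum>(t, J)\<in>p. norm (\<gamma> (Sup J) - \<gamma> (Inf J)))"
    by (rule sum.cong) (auto simp: increment_def dest: tagged_division_ofD(2)[OF p])
  moreover have "(\<Sum>J\<in>snd ` p. norm (increment \<gamma> J)) = (\<Sum>J\<in>snd ` p. norm (\<gamma> (Sup J) - \<gamma> (Inf J)))"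
    by (rule sum.cong) (auto simp: increment_def dest: tagged_division_ofD(2)[OF p])
  ultimately show ?thesis using V[OF division_of_tagged_division[OF p]] by simp
qed

definition stieltjes_sum :: "(real \<Rightarrow> complex) \<Rightarrow> (real \<Rightarrow> linf_op) \<Rightarrow> (real \<times> real set) set \<Rightarrow> linf_op"
  where "stieltjes_sum \<gamma> G p = (\<Sum>(t, J)\<in>p. scaleC_op (\<gamma> (Sup J) - \<gamma> (Inf J)) (G t))"

lemma stieltjes_sum_refine:
  assumes "p tagged_division_of {0..1}" "q tagged_division_of {0..1}"
  shows "stieltjes_sum \<gamma> G p = (\<Sum>(t, J)\<in>p. \<Sum>(t', J')\<in>q. scaleC_op (increment \<gamma> (J \<inter> J')) (G t))"
  unfolding stieltjes_sum_def
proof (rule sum.cong[OF refl], clarify)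
  fix t J assume "(t, J) \<in> p"
  then obtain u v where J: "J = {u..v}" "u \<le> v" "J \<subseteq> {0..1}" "t \<in> J"
    using tagged_division_interval[OF assms(1)] by metis
  have "\<gamma> (Sup J) - \<gamma> (Inf J) = increment \<gamma> J" using J by (auto simp: increment_def)
  also have "\<dots> = (\<Sum>(t, J')\<in>q. increment \<gamma> (J \<inter> J'))"
    by (rule sum_increment_Int[OF assms(2) J(1-3), symmetric])
  finally show "scaleC_op (\<gamma> (Sup J) - \<gamma> (Inf J)) (G t) =
      (\<Sum>(t', J')\<in>q. scaleC_op (increment \<gamma> (J \<inter> J')) (G t))"
    by (simp add: scaleC_op.sum_left case_prod_unfold)
qed

lemma norm_stieltjes_sum_le:
  assumes V: "\<And>d. d division_of {0..1} \<Longrightarrow> (\<Sum>J\<in>d. norm (\<gamma> (Sup J) - \<gamma> (Inf J))) \<le> V"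
    and p: "p tagged_division_of {0..1}"
    and G: "\<And>t. t \<in> {0..1} \<Longrightarrow> norm (G t) \<le> B"
  shows "norm (stieltjes_sum \<gamma> G p) \<le> V * B"
proof -
  have B: "0 \<le> B" by (rule order.trans[OF norm_ge_zero G[of 0]]) simp
  have "norm (stieltjes_sum \<gamma> G p) \<le> (\<Sum>(t, J)\<in>p. norm (\<gamma> (Sup J) - \<gamma> (Inf J)) * B)"
    unfolding stieltjes_sum_def
  proof (rule sum_norm_le, clarify)
    fix t J assume tJ: "(t, J) \<in> p"
    then have "t \<in> {0..1}" using tagged_division_ofD(2,3)[OF p] by blast
    then show "norm (scaleC_op (\<gamma> (Sup J) - \<gamma> (Inf J)) (G t)) \<le> norm (\<gamma> (Sup J) - \<gamma> (Inf J)) * B"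
      by (intro order.trans[OF norm_scaleC_op] mult_left_mono G) auto
  qed
  also have "\<dots> = (\<Sum>(t, J)\<in>p. norm (\<gamma> (Sup J) - \<gamma> (Inf J))) * B"
    by (simp add: sum_distrib_right case_prod_unfold)
  also have "\<dots> \<le> V * B" by (intro mult_right_mono sum_increment_le[OF V p] B)
  finally show ?thesis .
qed

text \<open>Both sums can be written over the common refinement of \<open>p\<close> and \<open>q\<close>; there the tags of two
overlapping cells are close, so only the oscillation of \<open>G\<close> at small distances remains.\<close>

lemma stieltjes_sum_close:
  assumes V: "\<And>d. d division_of {0..1} \<Longrightarrow> (\<Sum>J\<in>d. norm (\<gamma> (Sup J) - \<gamma> (Inf J))) \<le> V"
    and p: "p tagged_division_of {0..1}" "(\<lambda>t. ball t d) fine p"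
    and q: "q tagged_division_of {0..1}" "(\<lambda>t. ball t d') fine q"
    and G: "\<And>t t'. t \<in> {0..1} \<Longrightarrow> t' \<in> {0..1} \<Longrightarrow> dist t t' < d + d' \<Longrightarrow> norm (G t - G t') \<le> e"
    and "0 \<le> e"
  shows "norm (stieltjes_sum \<gamma> G p - stieltjes_sum \<gamma> G q) \<le> V * e"
proof -
  let ?I = "\<lambda>x y. increment \<gamma> (snd x \<inter> snd y)"
  \<comment> \<open>the second sum is refined by the first and its summation order exchanged\<close>
  have eq: "stieltjes_sum \<gamma> G p - stieltjes_sum \<gamma> G q =
      (\<Sum>x\<in>p. \<Sum>y\<in>q. scaleC_op (?I x y) (G (fst x) - G (fst y)))"
    unfolding stieltjes_sum_refine[OF p(1) q(1), of \<gamma> G] stieltjes_sum_refine[OF q(1) p(1), of \<gamma> G]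
      case_prod_unfold scaleC_op.diff_right sum_subtractf
    by (subst (3) sum.swap) (simp add: Int_commute)
  have cell: "norm (scaleC_op (?I x y) (G (fst x) - G (fst y))) \<le> norm (?I x y) * e"
    if "x \<in> p" "y \<in> q" for x y
  proof (cases "snd x \<inter> snd y = {}")
    case True
    then show ?thesis by (simp add: increment_def scaleC_op.zero_left)
  next
    case False
    then obtain w where w: "w \<in> snd x" "w \<in> snd y" by blast
    have "snd x \<subseteq> ball (fst x) d" "snd y \<subseteq> ball (fst y) d'"
      using p(2) q(2) that by (auto simp: fine_def split: prod.splits)
    then have "dist (fst x) w < d" "dist (fst y) w < d'" using w by auto
    then have "dist (fst x) (fst y) < d + d'"
      using dist_triangle2[of "fst x" "fst y" w] by simp
    moreover have "fst x \<in> {0..1}" "fst y \<in> {0..1}"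
      using that tagged_division_ofD(2,3)[OF p(1)] tagged_division_ofD(2,3)[OF q(1)]
      by (metis prod.collapse subsetD)+
    ultimately show ?thesis
      by (intro order.trans[OF norm_scaleC_op] mult_left_mono G) auto
  qed
  have "norm (stieltjes_sum \<gamma> G p - stieltjes_sum \<gamma> G q) \<le> (\<Sum>x\<in>p. \<Sum>y\<in>q. norm (?I x y) * e)"
    unfolding eq by (intro sum_norm_le cell)
  also have "\<dots> = (\<Sum>x\<in>p. \<Sum>y\<in>q. norm (?I x y)) * e" by (simp add: sum_distrib_right)
  also have "\<dots> \<le> V * e"
    using sum_increment_refinement[OF V p(1) q(1)] \<open>0 \<le> e\<close>
    by (intro mult_right_mono) (simp_all add: case_prod_unfold)
  finally show ?thesis .
qed

lemma has_curve_integral_iff: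
  "has_curve_integral F I \<gamma> \<longleftrightarrow> (\<forall>e>0. \<exists>d>0. \<forall>p. p tagged_division_of {0..1} \<and> (\<lambda>t. ball t d) fine p
     \<longrightarrow> norm (stieltjes_sum \<gamma> (\<lambda>t. F (\<gamma> t)) p - I) < e)"
  by (simp add: has_curve_integral_def stieltjes_sum_def)

lemma fine_tagged_division_unit:
  assumes "d > 0"
  obtains p where "p tagged_division_of {0..1::real}" "(\<lambda>t. ball t d) fine p"
proof -
  have "gauge (\<lambda>t::real. ball t d)" using assms by (simp add: gauge_def)
  then obtain p where "p tagged_division_of cbox (0::real) 1" "(\<lambda>t. ball t d) fine p"
    by (rule fine_division_exists[of _ 0 1]) blast
  then show ?thesis using that by (simp add: cbox_interval)
qed

lemma rectifiable_pathE:
  assumes "rectifiable_path \<gamma>"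
  obtains V where "V > 0" "\<And>d. d division_of {0..1} \<Longrightarrow> (\<Sum>J\<in>d. norm (\<gamma> (Sup J) - \<gamma> (Inf J))) \<le> V"
proof -
  obtain L where L: "\<And>d. d division_of {0..1} \<Longrightarrow> (\<Sum>J\<in>d. norm (\<gamma> (Sup J) - \<gamma> (Inf J))) \<le> L"
    using assms unfolding rectifiable_path_def by blast
  show ?thesis by (rule that[of "max 1 L"]) (use L in \<open>auto simp: le_max_iff_disj\<close>)
qed

text \<open>By \<open>stieltjes_sum_close\<close> and uniform continuity the sums over fine divisions satisfy a Cauchy
condition, and the operator space is complete.\<close>

lemma curve_integral_exists:
  assumes \<gamma>: "rectifiable_path \<gamma>" and F: "continuous_on (path_image \<gamma>) F"
  obtains I where "has_curve_integral F I \<gamma>"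
proof -
  obtain V where V0: "V > 0"
    and V: "\<And>d. d division_of {0..1} \<Longrightarrow> (\<Sum>J\<in>d. norm (\<gamma> (Sup J) - \<gamma> (Inf J))) \<le> V"
    using rectifiable_pathE[OF \<gamma>] by metis
  let ?G = "\<lambda>t. F (\<gamma> t)" and ?S = "stieltjes_sum \<gamma> (\<lambda>t. F (\<gamma> t))"
  have "continuous_on {0..1} ?G"
    using \<gamma> F continuous_on_compose2[of "path_image \<gamma>" F "{0..1}" \<gamma>]
    by (simp add: rectifiable_path_def path_def path_image_def)
  then have uc: "uniformly_continuous_on {0..1} ?G"
    by (intro compact_uniformly_continuous) auto
  have close: "\<exists>d>0. \<forall>p q. p tagged_division_of {0..1} \<longrightarrow> (\<lambda>t. ball t d) fine p \<longrightarrow>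
      q tagged_division_of {0..1} \<longrightarrow> (\<lambda>t. ball t d) fine q \<longrightarrow> norm (?S p - ?S q) \<le> e"
    if "e > 0" for e
  proof -
    have "e / V > 0" using that V0 by simp
    then obtain d where d: "d > 0" "\<And>t t'. t \<in> {0..1} \<Longrightarrow> t' \<in> {0..1} \<Longrightarrow> dist t' t < d \<Longrightarrow>
        dist (?G t') (?G t) < e / V"
      using uc unfolding uniformly_continuous_on_def by metis
    have "norm (?S p - ?S q) \<le> V * (e / V)"
      if "p tagged_division_of {0..1}" "(\<lambda>t. ball t (d/2)) fine p"
        "q tagged_division_of {0..1}" "(\<lambda>t. ball t (d/2)) fine q" for p q
    proof (rule stieltjes_sum_close[OF V that])
      show "norm (?G t - ?G t') \<le> e / V"
        if "t \<in> {0..1}" "t' \<in> {0..1}" "dist t t' < d / 2 + d / 2" for t t'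
        using d(2)[OF that(2,1)] that(3) by (simp add: dist_norm)
    qed (use \<open>e / V > 0\<close> in auto)
    then show ?thesis using d(1) V0 by (intro exI[of _ "d/2"]) simp
  qed
  have "\<forall>k. \<exists>d>0. \<forall>p q. p tagged_division_of {0..1} \<longrightarrow> (\<lambda>t. ball t d) fine p \<longrightarrow>
      q tagged_division_of {0..1} \<longrightarrow> (\<lambda>t. ball t d) fine q \<longrightarrow>
      norm (?S p - ?S q) \<le> inverse (real (Suc k))"
    by (intro allI close) simp
  then obtain \<delta> where \<delta>: "\<And>k. \<delta> k > 0" "\<And>k p q. p tagged_division_of {0..1} \<Longrightarrow>
      (\<lambda>t. ball t (\<delta> k)) fine p \<Longrightarrow> q tagged_division_of {0..1} \<Longrightarrow> (\<lambda>t. ball t (\<delta> k)) fine q \<Longrightarrow>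
      norm (?S p - ?S q) \<le> inverse (real (Suc k))"
    by metis
  \<comment> \<open>decreasing mesh sizes, so that \<open>p k\<close> is \<open>\<delta> l\<close>-fine for every \<open>l \<le> k\<close>\<close>
  define \<eta> where "\<eta> k = Min (\<delta> ` {..k})" for k
  have \<eta>: "\<eta> k > 0" "l \<le> k \<Longrightarrow> \<eta> k \<le> \<delta> l" for k l using \<delta>(1) by (auto simp: \<eta>_def)
  have "\<forall>k. \<exists>p. p tagged_division_of {0..1::real} \<and> (\<lambda>t. ball t (\<eta> k)) fine p"
    using fine_tagged_division_unit[OF \<eta>(1)] by metis
  then obtain p where p: "\<And>k. p k tagged_division_of {0..1::real}" "\<And>k. (\<lambda>t. ball t (\<eta> k)) fine p k"
    by metis
  have pf: "(\<lambda>t. ball t (\<delta> l)) fine p k" if "l \<le> k" for k l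
    using p(2)[of k] subset_ball[OF \<eta>(2)[OF that]] unfolding fine_def by blast
  have "Cauchy (\<lambda>k. ?S (p k))"
  proof (rule CauchyI)
    fix e :: real assume "e > 0"
    then obtain l where "inverse (real (Suc l)) < e" using reals_Archimedean by blast
    then have "norm (?S (p m) - ?S (p n)) < e" if "m \<ge> l" "n \<ge> l" for m n
      using \<delta>(2)[OF p(1) pf[OF that(1)] p(1) pf[OF that(2)]] by simp
    then show "\<exists>M. \<forall>m\<ge>M. \<forall>n\<ge>M. norm (?S (p m) - ?S (p n)) < e" by blast
  qed
  then obtain I where I: "(\<lambda>k. ?S (p k)) \<longlonglongrightarrow> I"
    by (auto simp: Cauchy_convergent_iff convergent_def)
  have "has_curve_integral F I \<gamma>"
    unfolding has_curve_integral_iff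
  proof (intro allI impI)
    fix e :: real assume "e > 0"
    then obtain l where l: "inverse (real (Suc l)) < e" using reals_Archimedean by blast
    have "norm (?S q - I) < e" if q: "q tagged_division_of {0..1}" "(\<lambda>t. ball t (\<delta> l)) fine q" for q
    proof -
      have "(\<lambda>k. norm (?S q - ?S (p k))) \<longlonglongrightarrow> norm (?S q - I)" by (intro tendsto_intros I)
      then have "norm (?S q - I) \<le> inverse (real (Suc l))"
        by (rule LIMSEQ_le_const2) (use \<delta>(2)[OF q p(1) pf] in blast)
      then show ?thesis using l by simp
    qed
    then show "\<exists>d>0. \<forall>p. p tagged_division_of {0..1} \<and> (\<lambda>t. ball t d) fine p \<longrightarrow> norm (?S p - I) < e"
      using \<delta>(1) by blast
  qed
  then show ?thesis by (rule that)
qed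

lemma has_curve_integral_bounded_linear:
  assumes "has_curve_integral F I \<gamma>" "bounded_linear L"
    and L: "\<And>c T. L (scaleC_op c T) = scaleC_op c (L T)"
  shows "has_curve_integral (\<lambda>z. L (F z)) (L I) \<gamma>"
  unfolding has_curve_integral_iff
proof (intro allI impI)
  interpret L: bounded_linear L by fact
  fix e :: real assume e: "e > 0"
  obtain K where K: "K > 0" "\<And>x. norm (L x) \<le> norm x * K" using L.pos_bounded by blast
  have "e / K > 0" using e K by simp
  then obtain d where d: "d > 0" "\<And>p. p tagged_division_of {0..1} \<Longrightarrow> (\<lambda>t. ball t d) fine p \<Longrightarrow>
      norm (stieltjes_sum \<gamma> (\<lambda>t. F (\<gamma> t)) p - I) < e / K"
    using assms(1) unfolding has_curve_integral_iff by meson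
  have "norm (stieltjes_sum \<gamma> (\<lambda>t. L (F (\<gamma> t))) p - L I) < e"
    if "p tagged_division_of {0..1}" "(\<lambda>t. ball t d) fine p" for p
  proof -
    have "stieltjes_sum \<gamma> (\<lambda>t. L (F (\<gamma> t))) p - L I = L (stieltjes_sum \<gamma> (\<lambda>t. F (\<gamma> t)) p - I)"
      by (simp add: stieltjes_sum_def L.sum L.diff L case_prod_unfold)
    also have "norm \<dots> \<le> norm (stieltjes_sum \<gamma> (\<lambda>t. F (\<gamma> t)) p - I) * K" by (rule K(2))
    also have "\<dots> < e" using d(2)[OF that] K(1) by (simp add: pos_less_divide_eq)
    finally show ?thesis .
  qed
  then show "\<exists>d>0. \<forall>p. p tagged_division_of {0..1} \<and> (\<lambda>t. ball t d) fine p \<longrightarrow>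
      norm (stieltjes_sum \<gamma> (\<lambda>t. L (F (\<gamma> t))) p - L I) < e"
    using d(1) by blast
qed

lemma has_curve_integral_add:
  assumes "has_curve_integral F I \<gamma>" "has_curve_integral G J \<gamma>"
  shows "has_curve_integral (\<lambda>z. F z + G z) (I + J) \<gamma>"
  unfolding has_curve_integral_iff
proof (intro allI impI)
  fix e :: real assume e: "e > 0"
  then have "e / 2 > 0" by simp
  then obtain d where d: "d > 0" "\<And>p. p tagged_division_of {0..1} \<Longrightarrow> (\<lambda>t. ball t d) fine p \<Longrightarrow>
      norm (stieltjes_sum \<gamma> (\<lambda>t. F (\<gamma> t)) p - I) < e / 2"
    using assms(1) unfolding has_curve_integral_iff by meson
  obtain d' where d': "d' > 0" "\<And>p. p tagged_division_of {0..1} \<Longrightarrow> (\<lambda>t. ball t d') fine p \<Longrightarrow>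
      norm (stieltjes_sum \<gamma> (\<lambda>t. G (\<gamma> t)) p - J) < e / 2"
    using assms(2) \<open>e / 2 > 0\<close> unfolding has_curve_integral_iff by meson
  have "norm (stieltjes_sum \<gamma> (\<lambda>t. F (\<gamma> t) + G (\<gamma> t)) p - (I + J)) < e"
    if p: "p tagged_division_of {0..1}" "(\<lambda>t. ball t (min d d')) fine p" for p
  proof -
    have fine: "(\<lambda>t. ball t d) fine p" "(\<lambda>t. ball t d') fine p"
      using p(2) by (auto simp: fine_def subset_eq)
    have "stieltjes_sum \<gamma> (\<lambda>t. F (\<gamma> t) + G (\<gamma> t)) p - (I + J) =
        (stieltjes_sum \<gamma> (\<lambda>t. F (\<gamma> t)) p - I) + (stieltjes_sum \<gamma> (\<lambda>t. G (\<gamma> t)) p - J)"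
      by (simp add: stieltjes_sum_def scaleC_op.add_right sum.distrib case_prod_unfold)
    also have "norm \<dots> < e"
      by (rule norm_triangle_lt) (use d(2)[OF p(1) fine(1)] d'(2)[OF p(1) fine(2)] in linarith)
    finally show ?thesis .
  qed
  then show "\<exists>d>0. \<forall>p. p tagged_division_of {0..1} \<and> (\<lambda>t. ball t d) fine p \<longrightarrow>
      norm (stieltjes_sum \<gamma> (\<lambda>t. F (\<gamma> t) + G (\<gamma> t)) p - (I + J)) < e"
    using d(1) d'(1) by (intro exI[of _ "min d d'"]) simp
qed

lemma norm_has_curve_integral_le:
  assumes V: "\<And>d. d division_of {0..1} \<Longrightarrow> (\<Sum>J\<in>d. norm (\<gamma> (Sup J) - \<gamma> (Inf J))) \<le> V"
    and I: "has_curve_integral F I \<gamma>"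
    and B: "\<And>z. z \<in> path_image \<gamma> \<Longrightarrow> norm (F z) \<le> B"
  shows "norm I \<le> V * B"
proof (rule field_le_epsilon)
  fix e :: real assume "e > 0"
  then obtain d where d: "d > 0" "\<And>p. p tagged_division_of {0..1} \<Longrightarrow> (\<lambda>t. ball t d) fine p \<Longrightarrow>
      norm (stieltjes_sum \<gamma> (\<lambda>t. F (\<gamma> t)) p - I) < e"
    using I unfolding has_curve_integral_iff by meson
  obtain p where p: "p tagged_division_of {0..1::real}" "(\<lambda>t. ball t d) fine p"
    using fine_tagged_division_unit[OF d(1)] by blast
  have "norm (stieltjes_sum \<gamma> (\<lambda>t. F (\<gamma> t)) p) \<le> V * B"
    by (rule norm_stieltjes_sum_le[OF V p(1)]) (auto intro!: B simp: path_image_def)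
  then show "norm I \<le> V * B + e"
    using d(2)[OF p] norm_triangle_sub[of I "stieltjes_sum \<gamma> (\<lambda>t. F (\<gamma> t)) p"]
    by (simp add: norm_minus_commute)
qed

lemma has_curve_integral_cong:
  assumes "has_curve_integral F I \<gamma>" "\<And>z. z \<in> path_image \<gamma> \<Longrightarrow> F z = G z"
  shows "has_curve_integral G I \<gamma>"
proof -
  have "stieltjes_sum \<gamma> (\<lambda>t. F (\<gamma> t)) p = stieltjes_sum \<gamma> (\<lambda>t. G (\<gamma> t)) p"
    if p: "p tagged_division_of {0..1}" for p
    unfolding stieltjes_sum_def
  proof (rule sum.cong[OF refl], clarify)
    fix t J assume "(t, J) \<in> p"
    then have "t \<in> {0..1}" using tagged_division_ofD(2,3)[OF p] by blast
    then have "\<gamma> t \<in> path_image \<gamma>" by (simp add: path_image_def)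
    then show "scaleC_op (\<gamma> (Sup J) - \<gamma> (Inf J)) (F (\<gamma> t)) = scaleC_op (\<gamma> (Sup J) - \<gamma> (Inf J)) (G (\<gamma> t))"
      using assms(2) by simp
  qed
  then show ?thesis using assms(1) unfolding has_curve_integral_iff by metis
qed

text \<open>To first order the increment of the exponential near \<open>0\<close> equals the increment of the argument. The error
is measured by the increment of the exponential itself, because it is the path \<open>exp \<circ> g\<close>, not \<open>g\<close>, whose
total variation is known to be finite.\<close>

lemma exp_increment_bound:
  fixes a b :: complex
  assumes "norm a \<le> \<eta>" "norm b \<le> \<eta>" "\<eta> \<le> 1 / 4"
  shows "norm (exp a - exp b - (a - b)) \<le> 4 * \<eta> * norm (exp a - exp b)"
proof -
  have \<eta>: "0 \<le> \<eta>" using assms(1) norm_ge_zero order.trans by blast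
  have "norm ((exp a - a) - (exp b - b)) \<le> (2 * \<eta>) * norm (a - b)"
  proof (rule field_differentiable_bound)
    show "((\<lambda>z. exp z - z) has_field_derivative exp z - 1) (at z within cball 0 \<eta>)" for z :: complex
      by (auto intro!: derivative_eq_intros)
    show "norm (exp z - 1) \<le> 2 * \<eta>" if "z \<in> cball 0 \<eta>" for z :: complex
    proof -
      have z: "norm z \<le> \<eta>" using that by simp
      have "norm (exp z - 1) \<le> exp (norm z) * norm z"
        using Taylor_exp_field[of z 0] by simp
      also have "\<dots> \<le> 2 * \<eta>"
        using z assms(3) exp_bound_half[of "norm z"] by (intro mult_mono) auto
      finally show ?thesis .
    qed
  qed (use assms in auto)
  then have 1: "norm (exp a - exp b - (a - b)) \<le> 2 * \<eta> * norm (a - b)" by (simp add: algebra_simps)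
  have "norm (a - b) \<le> norm (exp a - exp b) + norm (exp a - exp b - (a - b))"
    using norm_triangle_ineq4[of "exp a - exp b" "exp a - exp b - (a - b)"] by simp
  also have "\<dots> \<le> norm (exp a - exp b) + 1 / 2 * norm (a - b)"
    using order.trans[OF 1 mult_right_mono[of "2 * \<eta>" "1 / 2" "norm (a - b)"]] assms(3) by simp
  finally have "norm (a - b) \<le> 2 * norm (exp a - exp b)" by simp
  then have "2 * \<eta> * norm (a - b) \<le> 2 * \<eta> * (2 * norm (exp a - exp b))"
    using \<eta> by (intro mult_left_mono) auto
  with 1 show ?thesis by simp
qed

text \<open>A continuous logarithm \<open>g\<close> of \<open>\<gamma> - \<zeta>\<close> changes along the whole path by \<open>2 \<pi> \<i>\<close> times the winding number.
Each summand \<open>(\<gamma> v - \<gamma> u) / (\<gamma> t - \<zeta>)\<close> equals \<open>exp (g v - g t) - exp (g u - g t)\<close>, which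
\<open>exp_increment_bound\<close> compares with \<open>g v - g u\<close>, and the latter telescopes.\<close>

lemma has_curve_integral_winding_number:
  assumes \<gamma>: "rectifiable_path \<gamma>" and \<zeta>: "\<zeta> \<notin> path_image \<gamma>"
  shows "has_curve_integral (\<lambda>z. scaleC_op (1 / (z - \<zeta>)) id_blinfun)
    (scaleC_op (2 * complex_of_real pi * \<i> * winding_number \<gamma> \<zeta>) id_blinfun) \<gamma>"
  unfolding has_curve_integral_iff
proof (intro allI impI)
  fix e :: real assume e: "e > 0"
  obtain V where V0: "V > 0"
    and V: "\<And>d. d division_of {0..1} \<Longrightarrow> (\<Sum>J\<in>d. norm (\<gamma> (Sup J) - \<gamma> (Inf J))) \<le> V"
    using rectifiable_pathE[OF \<gamma>] by metis
  have path: "path \<gamma>" using \<gamma> by (simp add: rectifiable_path_def)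
  obtain g where g: "path g"
      "pathfinish g - pathstart g = 2 * complex_of_real pi * \<i> * winding_number \<gamma> \<zeta>"
      "\<And>t. t \<in> {0..1} \<Longrightarrow> \<gamma> t = \<zeta> + exp (g t)"
    using winding_number_as_continuous_log[OF path \<zeta>] by metis
  obtain \<rho> where \<rho>: "\<rho> > 0" "\<And>z. z \<in> path_image \<gamma> \<Longrightarrow> \<rho> \<le> dist \<zeta> z"
    using separate_point_closed[OF closed_path_image[OF path] \<zeta>] by metis
  define \<eta> where "\<eta> = min (1 / 4) (e * \<rho> / (8 * V))"
  have \<eta>: "0 < \<eta>" "\<eta> \<le> 1 / 4" "\<eta> \<le> e * \<rho> / (8 * V)" using e \<rho>(1) V0 by (auto simp: \<eta>_def)
  have "uniformly_continuous_on {0..1} g"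
    using g(1) by (intro compact_uniformly_continuous) (auto simp: path_def)
  then obtain d where d: "d > 0"
      "\<And>s t. s \<in> {0..1} \<Longrightarrow> t \<in> {0..1} \<Longrightarrow> dist s t < d \<Longrightarrow> dist (g s) (g t) < \<eta>"
    using \<eta>(1) unfolding uniformly_continuous_on_def by metis
  have "norm (stieltjes_sum \<gamma> (\<lambda>t. scaleC_op (1 / (\<gamma> t - \<zeta>)) id_blinfun) p
      - scaleC_op (2 * complex_of_real pi * \<i> * winding_number \<gamma> \<zeta>) id_blinfun) < e"
    if p: "p tagged_division_of {0..1}" "(\<lambda>t. ball t d) fine p" for p
  proof -
    have cell: "norm ((\<gamma> (Sup J) - \<gamma> (Inf J)) / (\<gamma> t - \<zeta>) - (g (Sup J) - g (Inf J)))
        \<le> norm (\<gamma> (Sup J) - \<gamma> (Inf J)) * (4 * \<eta> / \<rho>)" if tJ: "(t, J) \<in> p" for t J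
    proof -
      obtain u v where J: "J = {u..v}" "u \<le> v" "J \<subseteq> {0..1}" "t \<in> J"
        using tagged_division_interval[OF p(1) tJ] .
      have uv: "Sup J = v" "Inf J = u" "u \<in> J" "v \<in> J" using J by auto
      have I: "t \<in> {0..1}" "u \<in> {0..1}" "v \<in> {0..1}" using J uv by auto
      have "J \<subseteq> ball t d" using p(2) tJ by (auto simp: fine_def)
      then have "dist u t < d" "dist v t < d" using uv by (auto simp: dist_commute)
      then have near: "norm (g v - g t) \<le> \<eta>" "norm (g u - g t) \<le> \<eta>"
        using d(2)[OF I(3,1)] d(2)[OF I(2,1)] by (auto simp: dist_norm)
      have nz: "\<gamma> t - \<zeta> = exp (g t)" using g(3)[OF I(1)] by simp
      have quot: "exp (g v - g t) - exp (g u - g t) = (\<gamma> v - \<gamma> u) / (\<gamma> t - \<zeta>)"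
        unfolding nz using g(3)[OF I(2)] g(3)[OF I(3)] by (simp add: exp_diff diff_divide_distrib)
      have "norm ((\<gamma> v - \<gamma> u) / (\<gamma> t - \<zeta>) - (g v - g u))
          \<le> 4 * \<eta> * norm ((\<gamma> v - \<gamma> u) / (\<gamma> t - \<zeta>))"
        using exp_increment_bound[OF near \<eta>(2)] unfolding quot by simp
      also have "\<dots> = norm (\<gamma> v - \<gamma> u) * (4 * \<eta> / norm (\<gamma> t - \<zeta>))" by (simp add: norm_divide)
      also have "\<dots> \<le> norm (\<gamma> v - \<gamma> u) * (4 * \<eta> / \<rho>)"
      proof -
        have "\<rho> \<le> norm (\<gamma> t - \<zeta>)"
          using \<rho>(2)[of "\<gamma> t"] I(1) by (simp add: path_image_def dist_norm norm_minus_commute)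
        then show ?thesis using \<rho>(1) \<eta>(1) by (intro mult_left_mono divide_left_mono mult_pos_pos) auto
      qed
      finally show ?thesis using uv by simp
    qed
    define \<sigma> where "\<sigma> = (\<Sum>(t, J)\<in>p. (\<gamma> (Sup J) - \<gamma> (Inf J)) / (\<gamma> t - \<zeta>))"
    have "norm (\<sigma> - (g 1 - g 0)) = norm (\<Sum>(t, J)\<in>p. (\<gamma> (Sup J) - \<gamma> (Inf J)) / (\<gamma> t - \<zeta>)
        - (g (Sup J) - g (Inf J)))"
      unfolding \<sigma>_def using additive_tagged_division_1[OF _ p(1), of g]
      by (simp add: case_prod_unfold sum_subtractf)
    also have "\<dots> \<le> (\<Sum>(t, J)\<in>p. norm (\<gamma> (Sup J) - \<gamma> (Inf J)) * (4 * \<eta> / \<rho>))"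
      by (rule sum_norm_le) (use cell in auto)
    also have "\<dots> = (\<Sum>(t, J)\<in>p. norm (\<gamma> (Sup J) - \<gamma> (Inf J))) * (4 * \<eta> / \<rho>)"
      by (simp only: sum_distrib_right case_prod_unfold)
    also have "\<dots> \<le> V * (4 * \<eta> / \<rho>)"
      by (rule mult_right_mono[OF sum_increment_le[OF V p(1)]]) (use \<eta> \<rho> in auto)
    also have "\<dots> < e"
    proof -
      have "8 * V * \<eta> \<le> e * \<rho>" using \<eta>(3) V0 by (simp add: field_simps)
      then have "4 * V * \<eta> < e * \<rho>" using mult_pos_pos[OF V0 \<eta>(1)] by simp
      then show ?thesis using \<rho>(1) by (simp add: field_simps)
    qed
    finally have \<sigma>: "norm (\<sigma> - (g 1 - g 0)) < e" .
    have "stieltjes_sum \<gamma> (\<lambda>t. scaleC_op (1 / (\<gamma> t - \<zeta>)) id_blinfun) p = scaleC_op \<sigma> id_blinfun"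
      by (simp add: stieltjes_sum_def \<sigma>_def scaleC_op_scaleC_op scaleC_op.sum_left case_prod_unfold)
    then have "norm (stieltjes_sum \<gamma> (\<lambda>t. scaleC_op (1 / (\<gamma> t - \<zeta>)) id_blinfun) p
        - scaleC_op (2 * complex_of_real pi * \<i> * winding_number \<gamma> \<zeta>) id_blinfun)
        = norm (scaleC_op (\<sigma> - (g 1 - g 0)) id_blinfun)"
      using g(2) by (simp add: scaleC_op.diff_left pathstart_def pathfinish_def)
    also have "\<dots> \<le> norm (\<sigma> - (g 1 - g 0)) * 1"
      by (rule order.trans[OF norm_scaleC_op mult_left_mono[OF norm_blinfun_id_le]]) simp
    also have "\<dots> < e" using \<sigma> by simp
    finally show ?thesis .
  qed
  then show "\<exists>d>0. \<forall>p. p tagged_division_of {0..1} \<and> (\<lambda>t. ball t d) fine p \<longrightarrow>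
      norm (stieltjes_sum \<gamma> (\<lambda>t. scaleC_op (1 / (\<gamma> t - \<zeta>)) id_blinfun) p
      - scaleC_op (2 * complex_of_real pi * \<i> * winding_number \<gamma> \<zeta>) id_blinfun) < e"
    using d(1) by blast
qed

section \<open>The reduced resolvent\<close>

lemma is_resolvent_resolvent: "z \<in> resolvent_set T \<Longrightarrow> is_resolvent T z (resolvent T z)"
  unfolding resolvent_set_def using resolvent_eqI by auto

lemma resolvent_apply:
  assumes "z \<in> resolvent_set T"
  shows "blinfun_apply (resolvent T z) (blinfun_apply T x - z *\<^sub>C x) = x"
    and "blinfun_apply T (blinfun_apply (resolvent T z) x) - z *\<^sub>C blinfun_apply (resolvent T z) x = x"
proof -
  have "blinfun_apply (resolvent T z o\<^sub>L (T - scaleC_op z id_blinfun)) x = x"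
    "blinfun_apply ((T - scaleC_op z id_blinfun) o\<^sub>L resolvent T z) x = x"
    using is_resolvent_resolvent[OF assms] by (simp_all add: is_resolvent_def)
  then show "blinfun_apply (resolvent T z) (blinfun_apply T x - z *\<^sub>C x) = x"
    "blinfun_apply T (blinfun_apply (resolvent T z) x) - z *\<^sub>C blinfun_apply (resolvent T z) x = x"
    by (simp_all add: blinfun.diff_left scaleC_op_apply)
qed

lemma resolvent_identity:
  assumes z: "z \<in> resolvent_set T" and w: "w \<in> resolvent_set T"
  shows "resolvent T z - resolvent T w = resolvent T z o\<^sub>L scaleC_op (z - w) (resolvent T w)"
proof (rule blinfun_eqI)
  fix x
  let ?y = "blinfun_apply (resolvent T w) x"
  have "x = (blinfun_apply T ?y - z *\<^sub>C ?y) + (z - w) *\<^sub>C ?y"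
    using resolvent_apply(2)[OF w, of x] by (simp add: linf.scale_left_diff_distrib)
  then have "blinfun_apply (resolvent T z) x = ?y + blinfun_apply (resolvent T z) ((z - w) *\<^sub>C ?y)"
    using resolvent_apply(1)[OF z, of ?y] by (metis blinfun.add_right)
  then show "blinfun_apply (resolvent T z - resolvent T w) x =
      blinfun_apply (resolvent T z o\<^sub>L scaleC_op (z - w) (resolvent T w)) x"
    by (simp add: blinfun.diff_left scaleC_op_apply)
qed

lemma norm_resolvent_diff_le:
  assumes "z \<in> resolvent_set T" "w \<in> resolvent_set T"
  shows "norm (resolvent T z - resolvent T w) \<le> norm (resolvent T z) * (norm (z - w) * norm (resolvent T w))"
  unfolding resolvent_identity[OF assms]
  by (rule order.trans[OF norm_blinfun_compose]) (intro mult_left_mono norm_scaleC_op norm_ge_zero)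

text \<open>Close to \<open>w\<close> the resolvent identity first bounds the resolvent by twice its size at \<open>w\<close>; inserted into the
identity once more, this bound gives continuity.\<close>

lemma continuous_on_resolvent: "continuous_on (resolvent_set T) (resolvent T)"
proof (rule continuous_onI)
  fix w and e :: real assume w: "w \<in> resolvent_set T" and e: "e > 0"
  define b where "b = norm (resolvent T w) + 1"
  have b: "b > 0" "norm (resolvent T w) \<le> b" by (simp_all add: b_def add_nonneg_pos)
  define d where "d = min (1 / (2 * b)) (e / (2 * b * b))"
  have d: "d > 0" "d * b \<le> 1 / 2" "2 * b * (d * b) \<le> e"
  proof -
    show "d > 0" using b e by (simp add: d_def)
    have "d \<le> 1 / (2 * b)" "d \<le> e / (2 * b * b)" by (simp_all add: d_def)
    then show "d * b \<le> 1 / 2" "2 * b * (d * b) \<le> e" using b by (simp_all add: field_simps)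
  qed
  have "dist (resolvent T z) (resolvent T w) \<le> e" if z: "z \<in> resolvent_set T" "dist z w < d" for z
  proof -
    have "norm (z - w) * norm (resolvent T w) \<le> d * b"
      using z(2) b d(1) by (intro mult_mono) (auto simp: dist_norm)
    then have diff: "norm (resolvent T z - resolvent T w) \<le> norm (resolvent T z) * (d * b)"
      by (rule order.trans[OF norm_resolvent_diff_le[OF z(1) w] mult_left_mono]) simp
    also have "\<dots> \<le> norm (resolvent T z) * (1 / 2)" by (rule mult_left_mono[OF d(2)]) simp
    finally have "norm (resolvent T z) \<le> 2 * b"
      using norm_triangle_sub[of "resolvent T z" "resolvent T w"] b(2) by simp
    then have "norm (resolvent T z) * (d * b) \<le> 2 * b * (d * b)"
      using b d(1) by (intro mult_right_mono) auto
    with diff d(3) show ?thesis by (simp add: dist_norm)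
  qed
  then show "\<exists>d>0. \<forall>z\<in>resolvent_set T. dist z w < d \<longrightarrow> dist (resolvent T z) (resolvent T w) \<le> e"
    using d(1) by blast
qed

text \<open>Up to the factor \<open>1 / (2 \<pi> \<i>)\<close>, the integral of \<open>(z - \<mu>)\<^sup>-\<^sup>1 (T - z)\<^sup>-\<^sup>1\<close> inverts \<open>T - \<mu>\<close> modulo the spectral projection. It is defined also
when \<open>\<mu>\<close> is the eigenvalue, and since \<open>\<mu>\<close> keeps a positive distance from the curve its norm is bounded
uniformly in \<open>\<mu>\<close>.\<close>

proposition reduced_resolvent:
  assumes sep: "separating_curve T lam \<gamma>"
    and lin: "\<And>c x. blinfun_apply T (c *\<^sub>C x) = c *\<^sub>C blinfun_apply T x"
  defines "E \<equiv> spectral_projection \<gamma> T"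
  obtains \<delta> C S where "\<delta> > 0"
    "\<And>\<mu>. norm (\<mu> - lam) < \<delta> \<Longrightarrow> S \<mu> o\<^sub>L (T - scaleC_op \<mu> id_blinfun) = id_blinfun - E"
    "\<And>\<mu>. norm (\<mu> - lam) < \<delta> \<Longrightarrow> (T - scaleC_op \<mu> id_blinfun) o\<^sub>L S \<mu> = id_blinfun - E"
    "\<And>\<mu>. norm (\<mu> - lam) < \<delta> \<Longrightarrow> norm (S \<mu>) \<le> C"
proof -
  have rect: "rectifiable_path \<gamma>" and wind: "\<And>z. z \<in> inside (path_image \<gamma>) \<Longrightarrow> winding_number \<gamma> z = 1"
    and res: "path_image \<gamma> \<subseteq> resolvent_set T" and lam: "lam \<in> inside (path_image \<gamma>)"
    using sep by (auto simp: separating_curve_def)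
  have path: "path \<gamma>" using rect by (simp add: rectifiable_path_def)
  let ?P = "path_image \<gamma>" and ?R = "resolvent T"
  have contR: "continuous_on ?P ?R" using continuous_on_resolvent res by (rule continuous_on_subset)
  have "bounded (?R ` ?P)"
    by (intro compact_imp_bounded compact_continuous_image contR compact_path_image path)
  then obtain M where M: "\<And>z. z \<in> ?P \<Longrightarrow> norm (?R z) \<le> M" unfolding bounded_iff by blast
  obtain V where V0: "V > 0"
    and V: "\<And>d. d division_of {0..1} \<Longrightarrow> (\<Sum>J\<in>d. norm (\<gamma> (Sup J) - \<gamma> (Inf J))) \<le> V"
    using rectifiable_pathE[OF rect] by metis
  have "open (inside ?P)" by (rule open_inside[OF closed_path_image[OF path]])
  then obtain \<rho> where \<rho>: "\<rho> > 0" "ball lam \<rho> \<subseteq> inside ?P" using lam openE by blast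
  \<comment> \<open>half the radius, so that points of the curve stay at distance \<open>\<delta>\<close> from every admissible \<open>\<mu>\<close>\<close>
  define \<delta> where "\<delta> = \<rho> / 2"
  have \<delta>: "\<delta> > 0" using \<rho> by (simp add: \<delta>_def)
  have away: "\<delta> \<le> norm (z - \<mu>)" if "z \<in> ?P" "norm (\<mu> - lam) < \<delta>" for z \<mu>
  proof -
    have "z \<notin> inside ?P" using that(1) inside_no_overlap by blast
    then have "z \<notin> ball lam \<rho>" using \<rho>(2) by blast
    then have "\<rho> \<le> norm (z - lam)" by (simp add: dist_norm norm_minus_commute)
    moreover have "norm (z - lam) \<le> norm (z - \<mu>) + norm (\<mu> - lam)"
      using norm_triangle_ineq[of "z - \<mu>" "\<mu> - lam"] by simp
    ultimately show ?thesis using that(2) by (simp add: \<delta>_def)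
  qed
  have inside: "\<mu> \<in> inside ?P" "\<mu> \<notin> ?P" if "norm (\<mu> - lam) < \<delta>" for \<mu>
  proof -
    have "\<mu> \<in> ball lam \<rho>" using that \<rho>(1) by (simp add: \<delta>_def dist_norm norm_minus_commute)
    then show "\<mu> \<in> inside ?P" using \<rho>(2) by blast
    then show "\<mu> \<notin> ?P" using inside_no_overlap by blast
  qed
  define F where "F \<mu> z = scaleC_op (1 / (z - \<mu>)) (?R z)" for \<mu> z
  have contF: "continuous_on ?P (F \<mu>)" if "norm (\<mu> - lam) < \<delta>" for \<mu>
    unfolding F_def using inside(2)[OF that]
    by (intro scaleC_op.continuous_on contR continuous_intros) auto
  have "\<exists>J. norm (\<mu> - lam) < \<delta> \<longrightarrow> has_curve_integral (F \<mu>) J \<gamma>" for \<mu>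
    using curve_integral_exists[OF rect contF] by metis
  then obtain J where J: "\<And>\<mu>. norm (\<mu> - lam) < \<delta> \<Longrightarrow> has_curve_integral (F \<mu>) (J \<mu>) \<gamma>" by metis
  obtain I where I: "has_curve_integral ?R I \<gamma>" using curve_integral_exists[OF rect contR] .
  let ?c = "2 * complex_of_real pi * \<i>"
  define S where "S \<mu> = scaleC_op (1 / ?c) (J \<mu>)" for \<mu>
  have E: "E = scaleC_op (- (1 / ?c)) I"
    unfolding E_def spectral_projection_def by (simp add: curve_integral_eqI[OF I])
  have key: "has_curve_integral (\<lambda>z. scaleC_op (1 / (z - \<mu>)) id_blinfun + ?R z) (scaleC_op ?c id_blinfun + I) \<gamma>"
    if "norm (\<mu> - lam) < \<delta>" for \<mu>
    using has_curve_integral_add[OF has_curve_integral_winding_number[OF rect inside(2)[OF that]] I]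
      wind[OF inside(1)[OF that]] by simp
  have final: "scaleC_op (1 / ?c) (scaleC_op ?c id_blinfun + I) = id_blinfun - E"
    by (simp add: E scaleC_op.add_right scaleC_op_scaleC_op scaleC_op_one scaleC_op.minus_left)
  show ?thesis
  proof (rule that[OF \<delta>, of S])
    fix \<mu> assume \<mu>: "norm (\<mu> - lam) < \<delta>"
    let ?A = "T - scaleC_op \<mu> id_blinfun"
    have Alin: "blinfun_apply ?A (c *\<^sub>C x) = c *\<^sub>C blinfun_apply ?A x" for c x
      by (simp add: blinfun.diff_left scaleC_op_apply lin linf.scale_right_diff_distrib mult.commute)
    have nz: "z - \<mu> \<noteq> 0" if "z \<in> ?P" for z using inside(2)[OF \<mu>] that by auto
    have "has_curve_integral (\<lambda>z. F \<mu> z o\<^sub>L ?A) (J \<mu> o\<^sub>L ?A) \<gamma>"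
      by (rule has_curve_integral_bounded_linear[OF J[OF \<mu>] bounded_bilinear.bounded_linear_left[OF bounded_bilinear_blinfun_compose]])
        (rule blinfun_eqI, simp add: scaleC_op_apply)
    moreover have "F \<mu> z o\<^sub>L ?A = scaleC_op (1 / (z - \<mu>)) id_blinfun + ?R z" if z: "z \<in> ?P" for z
    proof (rule blinfun_eqI)
      fix x
      have "blinfun_apply ?A x = (blinfun_apply T x - z *\<^sub>C x) + (z - \<mu>) *\<^sub>C x"
        by (simp add: blinfun.diff_left scaleC_op_apply linf.scale_left_diff_distrib)
      moreover have "blinfun_apply (?R z) ((z - \<mu>) *\<^sub>C x) = (z - \<mu>) *\<^sub>C blinfun_apply (?R z) x"
      proof -
        let ?y = "blinfun_apply (?R z) x"
        have "(z - \<mu>) *\<^sub>C x = blinfun_apply T ((z - \<mu>) *\<^sub>C ?y) - z *\<^sub>C ((z - \<mu>) *\<^sub>C ?y)"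
          using arg_cong[OF resolvent_apply(2)[of z T x], of "\<lambda>u. (z - \<mu>) *\<^sub>C u"] z res
          by (auto simp: lin linf.scale_right_diff_distrib mult.commute)
        then show ?thesis using resolvent_apply(1)[of z T "(z - \<mu>) *\<^sub>C ?y"] z res by auto
      qed
      ultimately have "blinfun_apply (?R z) (blinfun_apply ?A x) = x + (z - \<mu>) *\<^sub>C blinfun_apply (?R z) x"
        using resolvent_apply(1)[of z T x] z res by (auto simp: blinfun.add_right)
      then show "blinfun_apply (F \<mu> z o\<^sub>L ?A) x = blinfun_apply (scaleC_op (1 / (z - \<mu>)) id_blinfun + ?R z) x"
        using nz[OF z] by (simp add: F_def scaleC_op_apply blinfun.add_left linf.scale_right_distrib)
    qed
    ultimately have "has_curve_integral (\<lambda>z. scaleC_op (1 / (z - \<mu>)) id_blinfun + ?R z) (J \<mu> o\<^sub>L ?A) \<gamma>"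
      by (rule has_curve_integral_cong)
    then have "J \<mu> o\<^sub>L ?A = scaleC_op ?c id_blinfun + I"
      by (rule has_curve_integral_unique[OF _ key[OF \<mu>]])
    moreover have "S \<mu> o\<^sub>L ?A = scaleC_op (1 / ?c) (J \<mu> o\<^sub>L ?A)"
      by (rule blinfun_eqI) (simp add: S_def scaleC_op_apply)
    ultimately show "S \<mu> o\<^sub>L ?A = id_blinfun - E" by (simp only: final)
    have "has_curve_integral (\<lambda>z. ?A o\<^sub>L F \<mu> z) (?A o\<^sub>L J \<mu>) \<gamma>"
      by (rule has_curve_integral_bounded_linear[OF J[OF \<mu>] bounded_bilinear.bounded_linear_right[OF bounded_bilinear_blinfun_compose]])
        (rule blinfun_eqI, simp add: scaleC_op_apply Alin)
    moreover have "?A o\<^sub>L F \<mu> z = scaleC_op (1 / (z - \<mu>)) id_blinfun + ?R z" if z: "z \<in> ?P" for z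
    proof (rule blinfun_eqI)
      fix x
      let ?y = "blinfun_apply (?R z) x"
      have "blinfun_apply ?A ?y = (blinfun_apply T ?y - z *\<^sub>C ?y) + (z - \<mu>) *\<^sub>C ?y"
        by (simp add: blinfun.diff_left scaleC_op_apply linf.scale_left_diff_distrib)
      also have "\<dots> = x + (z - \<mu>) *\<^sub>C ?y" using resolvent_apply(2)[of z T x] z res by auto
      finally show "blinfun_apply (?A o\<^sub>L F \<mu> z) x = blinfun_apply (scaleC_op (1 / (z - \<mu>)) id_blinfun + ?R z) x"
        using nz[OF z] by (simp add: F_def scaleC_op_apply Alin blinfun.add_left linf.scale_right_distrib
            del: blinfun.diff_left)
    qed
    ultimately have "has_curve_integral (\<lambda>z. scaleC_op (1 / (z - \<mu>)) id_blinfun + ?R z) (?A o\<^sub>L J \<mu>) \<gamma>"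
      by (rule has_curve_integral_cong)
    then have "?A o\<^sub>L J \<mu> = scaleC_op ?c id_blinfun + I"
      by (rule has_curve_integral_unique[OF _ key[OF \<mu>]])
    moreover have "?A o\<^sub>L S \<mu> = scaleC_op (1 / ?c) (?A o\<^sub>L J \<mu>)"
      by (rule blinfun_eqI) (simp add: S_def scaleC_op_apply Alin del: blinfun.diff_left)
    ultimately show "?A o\<^sub>L S \<mu> = id_blinfun - E" by (simp only: final)
    have bound: "norm (F \<mu> z) \<le> 1 / \<delta> * M" if z: "z \<in> ?P" for z
    proof -
      have "norm (F \<mu> z) \<le> norm (1 / (z - \<mu>)) * norm (?R z)" unfolding F_def by (rule norm_scaleC_op)
      also have "\<dots> \<le> 1 / \<delta> * M"
        using away[OF z \<mu>] \<delta> M[OF z] by (intro mult_mono) (auto simp: norm_divide intro!: frac_le)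
      finally show ?thesis .
    qed
    have "norm (J \<mu>) \<le> V * (1 / \<delta> * M)"
      using V J[OF \<mu>] bound by (rule norm_has_curve_integral_le)
    then show "norm (S \<mu>) \<le> norm (1 / ?c) * (V * (1 / \<delta> * M))"
      unfolding S_def by (rule order.trans[OF norm_scaleC_op mult_left_mono]) simp
  qed
qed

section \<open>Smooth functions on the unit interval\<close>

text \<open>Functions with continuous derivatives up to order \<open>m\<close> on the closed unit interval, the derivatives being
one-sided at the end points.\<close>

primrec C_unit :: "nat \<Rightarrow> (real \<Rightarrow> complex) \<Rightarrow> bool"
  where "C_unit 0 f \<longleftrightarrow> continuous_on {0..1} f"
  | "C_unit (Suc m) f \<longleftrightarrow> (\<exists>f'. C_unit m f' \<and>
      (\<forall>s\<in>{0..1}. (f has_vector_derivative f' s) (at s within {0..1})))"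

lemma C_unit_SucI:
  assumes "C_unit m f'" "\<And>s. s \<in> {0..1} \<Longrightarrow> (f has_vector_derivative f' s) (at s within {0..1})"
  shows "C_unit (Suc m) f"
  using assms by auto

lemma C_unit_SucE:
  assumes "C_unit (Suc m) f"
  obtains f' where "C_unit m f'"
    "\<And>s. s \<in> {0..1} \<Longrightarrow> (f has_vector_derivative f' s) (at s within {0..1})"
  using assms unfolding C_unit.simps by blast

lemma C_unit_Suc_imp: "C_unit (Suc m) f \<Longrightarrow> C_unit m f"
proof (induction m arbitrary: f)
  case 0
  then show ?case
    by (auto simp: continuous_on_eq_continuous_within intro: has_vector_derivative_continuous)
next
  case (Suc m)
  from Suc.prems obtain f' where f': "C_unit (Suc m) f'"
    "\<And>s. s \<in> {0..1} \<Longrightarrow> (f has_vector_derivative f' s) (at s within {0..1})"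
    by (rule C_unit_SucE) blast
  show ?case by (rule C_unit_SucI[OF Suc.IH[OF f'(1)] f'(2)])
qed

lemma C_unit_continuous: "C_unit m f \<Longrightarrow> continuous_on {0..1} f"
proof (induction m)
  case (Suc m)
  then show ?case using C_unit_Suc_imp by blast
qed simp

lemma C_unit_cong:
  assumes "C_unit m f" "\<And>s. s \<in> {0..1} \<Longrightarrow> g s = f s"
  shows "C_unit m g"
proof (cases m)
  case 0
  then show ?thesis using assms continuous_on_cong[of "{0..1}" "{0..1}" g f] by simp
next
  case (Suc k)
  then obtain f' where "C_unit k f'"
    "\<And>s. s \<in> {0..1} \<Longrightarrow> (f has_vector_derivative f' s) (at s within {0..1})"
    using assms(1) C_unit_SucE[of k f] by (metis Suc)
  then have "C_unit (Suc k) g"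
    by (intro C_unit_SucI[of k f'] has_vector_derivative_transform[OF _ assms(2)])
  then show ?thesis using Suc by simp
qed

lemma C_unit_add: "C_unit m f \<Longrightarrow> C_unit m g \<Longrightarrow> C_unit m (\<lambda>s. f s + g s)"
proof (induction m arbitrary: f g)
  case 0
  then show ?case by (simp add: continuous_on_add)
next
  case (Suc m)
  obtain f' where f': "C_unit m f'"
    "\<And>s. s \<in> {0..1} \<Longrightarrow> (f has_vector_derivative f' s) (at s within {0..1})"
    using Suc.prems(1) by (rule C_unit_SucE) blast
  obtain g' where g': "C_unit m g'"
    "\<And>s. s \<in> {0..1} \<Longrightarrow> (g has_vector_derivative g' s) (at s within {0..1})"
    using Suc.prems(2) by (rule C_unit_SucE) blast
  show ?case using f' g'
    by (intro C_unit_SucI[of m "\<lambda>s. f' s + g' s"] Suc.IH has_vector_derivative_add)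
qed

lemma C_unit_mult: "C_unit m f \<Longrightarrow> C_unit m g \<Longrightarrow> C_unit m (\<lambda>s. f s * g s)"
proof (induction m arbitrary: f g)
  case 0
  then show ?case by (simp add: continuous_on_mult)
next
  case (Suc m)
  obtain f' where f': "C_unit m f'"
    "\<And>s. s \<in> {0..1} \<Longrightarrow> (f has_vector_derivative f' s) (at s within {0..1})"
    using Suc.prems(1) by (rule C_unit_SucE) blast
  obtain g' where g': "C_unit m g'"
    "\<And>s. s \<in> {0..1} \<Longrightarrow> (g has_vector_derivative g' s) (at s within {0..1})"
    using Suc.prems(2) by (rule C_unit_SucE) blast
  show ?case
  proof (rule C_unit_SucI)
    show "C_unit m (\<lambda>s. f s * g' s + f' s * g s)"
      by (rule C_unit_add[OF Suc.IH[OF C_unit_Suc_imp[OF Suc.prems(1)] g'(1)]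
            Suc.IH[OF f'(1) C_unit_Suc_imp[OF Suc.prems(2)]]])
  qed (intro has_vector_derivative_mult f' g')
qed

lemma C_unit_const: "C_unit m (\<lambda>s. c)"
proof (induction m arbitrary: c)
  case (Suc m)
  show ?case by (rule C_unit_SucI[OF Suc.IH[of 0]]) (rule has_vector_derivative_const)
qed simp

lemma C_unit_reflect: "C_unit m f \<Longrightarrow> C_unit m (\<lambda>s. f (1 - s))"
proof (induction m arbitrary: f)
  case 0
  then show ?case
    by (auto intro!: continuous_on_compose2[of "{0..1}" f] continuous_intros)
next
  case (Suc m)
  from Suc.prems obtain f' where f': "C_unit m f'"
    "\<And>s. s \<in> {0..1} \<Longrightarrow> (f has_vector_derivative f' s) (at s within {0..1})"
    by (rule C_unit_SucE) blast
  show ?case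
  proof (rule C_unit_SucI[of m "\<lambda>s. (-1) * f' (1 - s)"])
    show "C_unit m (\<lambda>s. (-1) * f' (1 - s))" by (intro C_unit_mult C_unit_const Suc.IH f'(1))
    fix s :: real assume s: "s \<in> {0..1}"
    have "((\<lambda>s. 1 - s) has_vector_derivative -1) (at s within {0..1})"
      by (auto intro!: derivative_eq_intros)
    moreover have "(f has_vector_derivative f' (1 - s)) (at (1 - s) within (\<lambda>s. 1 - s) ` {0..1})"
      by (rule has_vector_derivative_within_subset[OF f'(2)]) (use s in auto)
    ultimately have "(f \<circ> (\<lambda>s. 1 - s) has_vector_derivative (-1) *\<^sub>R f' (1 - s)) (at s within {0..1})"
      by (rule vector_diff_chain_within)
    then show "((\<lambda>s. f (1 - s)) has_vector_derivative (-1) * f' (1 - s)) (at s within {0..1})"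
      by (simp add: o_def)
  qed
qed

section \<open>Regularity of Volterra integrals over the triangle\<close>

text \<open>Kernels on the lower triangle only; the upper triangle is reduced to it by the point reflection of the
square.\<close>

definition volterra :: "(real \<times> real \<Rightarrow> real) \<Rightarrow> (real \<Rightarrow> complex) \<Rightarrow> real \<Rightarrow> complex"
  where "volterra D f s = integral {0..s} (\<lambda>t. complex_of_real (D (s, t)) * f t)"

lemma Omega1_section1: "0 \<le> t \<Longrightarrow> {u. (u, t) \<in> Omega1} = {t..1}"
  by (auto simp: Omega1_def)

lemma continuous_on_Omega1_max:
  assumes "continuous_on Omega1 D"
  shows "continuous_on ({0..1} \<times> {0..1}) (\<lambda>(s, t). D (max s t, t))"
  using assms unfolding case_prod_unfold
  by (rule continuous_on_compose2) (auto intro!: continuous_intros simp: Omega1_def)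

lemma continuous_on_Omega1_diagonal:
  assumes "continuous_on Omega1 D"
  shows "continuous_on {0..1} (\<lambda>t. D (t, t))"
  using assms by (rule continuous_on_compose2) (auto intro!: continuous_intros simp: Omega1_def)

lemma continuous_on_section:
  assumes "continuous_on (A \<times> B) (\<lambda>(s, t). X s t)" "s \<in> A"
  shows "continuous_on B (X s)"
proof -
  have "continuous_on B (\<lambda>t. (\<lambda>(s, t). X s t) (s, t))"
    by (rule continuous_on_compose2[OF assms(1)]) (use assms(2) in \<open>auto intro!: continuous_intros\<close>)
  then show ?thesis by simp
qed

text \<open>The kernel is extended constantly in \<open>s\<close> above the diagonal. The integral over the full interval then
depends continuously on the parameter \<open>s\<close>, and the excess has an integrand independent of \<open>s\<close>.\<close>

lemma continuous_on_volterra: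
  assumes D: "continuous_on Omega1 D" and f: "continuous_on {0..1} f"
  shows "continuous_on {0..1} (volterra D f)"
proof -
  let ?X = "\<lambda>s t. complex_of_real (D (max s t, t)) * f t"
  let ?d = "\<lambda>t. complex_of_real (D (t, t)) * f t"
  have X: "continuous_on ({0..1} \<times> {0..1}) (\<lambda>(s, t). ?X s t)"
    using continuous_on_Omega1_max[OF D] unfolding case_prod_unfold
    by (intro continuous_intros continuous_on_compose2[OF f]) auto
  have Xs: "continuous_on {0..1} (?X s)" if "s \<in> {0..1}" for s
    by (rule continuous_on_section[OF X that])
  have d: "continuous_on {0..1} ?d"
    using continuous_on_Omega1_diagonal[OF D] by (intro continuous_intros f)
  have "volterra D f s = integral {0..1} (?X s) - (integral {0..1} ?d - integral {0..s} ?d)"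
    if s: "s \<in> {0..1}" for s
  proof -
    have "integral {0..1} (?X s) = integral {0..s} (?X s) + integral {s..1} (?X s)"
      using s by (intro Henstock_Kurzweil_Integration.integral_combine[symmetric] integrable_continuous_real Xs) auto
    also have "integral {0..s} (?X s) = volterra D f s"
      unfolding volterra_def by (rule integral_cong) (auto simp: max_def)
    also have "integral {s..1} (?X s) = integral {s..1} ?d"
      by (rule integral_cong) (auto simp: max_def)
    also have "\<dots> = integral {0..1} ?d - integral {0..s} ?d"
      using Henstock_Kurzweil_Integration.integral_combine[of 0 s 1 ?d] s integrable_continuous_real[OF d]
      by (simp add: algebra_simps)
    finally show ?thesis by simp
  qed
  moreover have "continuous_on {0..1} (\<lambda>s. integral {0..1} (?X s) - (integral {0..1} ?d - integral {0..s} ?d))"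
    using integral_continuous_on_param[of "{0..1::real}" 0 1 ?X] X
    by (intro continuous_intros indefinite_integral_continuous_1 integrable_continuous_real d)
      (simp add: cbox_interval)
  ultimately show ?thesis by (subst continuous_on_cong[OF refl]) auto
qed

text \<open>Leibniz' rule with a moving end point. To reduce it to a fixed interval of integration the kernel is
continued above the diagonal by its tangent \<open>D (t, t) + (s - t) D' (t, t)\<close>, which keeps it continuously
differentiable in \<open>s\<close>. The surplus integral over \<open>{s..1}\<close> has an integrand affine in \<open>s\<close>, so its derivative
follows from the fundamental theorem.\<close>

lemma has_vector_derivative_volterra:
  assumes D: "continuous_on Omega1 D" and D': "continuous_on Omega1 D'"
    and deriv: "\<And>s t. (s, t) \<in> Omega1 \<Longrightarrow>
      ((\<lambda>u. D (u, t)) has_real_derivative D' (s, t)) (at s within {u. (u, t) \<in> Omega1})"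
    and f: "continuous_on {0..1} f" and s: "s \<in> {0..1}"
  shows "(volterra D f has_vector_derivative
    complex_of_real (D (s, s)) * f s + volterra D' f s) (at s within {0..1})"
proof -
  define X where "X s t = D (max s t, t) + min (s - t) 0 * D' (t, t)" for s t
  define X' where "X' s t = D' (max s t, t)" for s t
  have contX: "continuous_on ({0..1} \<times> {0..1}) (\<lambda>(s, t). X s t)"
    using continuous_on_Omega1_max[OF D] unfolding X_def case_prod_unfold
    by (intro continuous_intros continuous_on_compose2[OF continuous_on_Omega1_diagonal[OF D']]) auto
  have contX': "continuous_on ({0..1} \<times> {0..1}) (\<lambda>(s, t). X' s t)"
    unfolding X'_def by (rule continuous_on_Omega1_max[OF D'])
  have derX: "((\<lambda>u. X u t) has_real_derivative X' u t) (at u within {0..1})"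
    if u: "u \<in> {0..1}" and t: "t \<in> {0..1}" for u t
  proof -
    have right: "((\<lambda>u. X u t) has_real_derivative X' u t) (at u within {t..1})" if "t \<le> u"
    proof -
      have "((\<lambda>u. D (u, t)) has_real_derivative D' (u, t)) (at u within {t..1})"
        using deriv[of u t] u t that Omega1_section1[of t] by (auto simp: Omega1_def)
      then have "((\<lambda>u. X u t) has_real_derivative D' (u, t)) (at u within {t..1})"
        by (rule has_field_derivative_transform_within[where d = 1]) (use u that in \<open>auto simp: X_def max_def min_def\<close>)
      then show ?thesis using that by (simp add: X'_def max_def)
    qed
    have left: "((\<lambda>u. X u t) has_real_derivative X' u t) (at u within {0..t})" if "u \<le> t"
    proof -
      have "((\<lambda>u. D (t, t) + (u - t) * D' (t, t)) has_real_derivative D' (t, t)) (at u within {0..t})"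
        by (auto intro!: derivative_eq_intros)
      then have "((\<lambda>u. X u t) has_real_derivative D' (t, t)) (at u within {0..t})"
        by (rule has_field_derivative_transform_within[where d = 1]) (use u that in \<open>auto simp: X_def max_def min_def\<close>)
      then show ?thesis using that by (simp add: X'_def max_def)
    qed
    consider "u < t" | "t < u" | "u = t" by linarith
    then show ?thesis
    proof cases
      case 1
      have "at u within {0..1} = at u within {0..t}"
        by (rule at_within_nhd[of _ "{..<t}"]) (use 1 t in auto)
      then show ?thesis using left 1 by simp
    next
      case 2
      have "at u within {0..1} = at u within {t..1}"
        by (rule at_within_nhd[of _ "{t<..}"]) (use 2 t in auto)
      then show ?thesis using right 2 by simp
    next
      case 3
      have "{0..1} = {0..t} \<union> {t..1}" using t by auto
      then show ?thesis using left right 3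
        by (simp add: has_field_derivative_iff Lim_within_Un)
    qed
  qed
  let ?d = "\<lambda>t. complex_of_real (D (t, t) - t * D' (t, t)) * f t"
  let ?e = "\<lambda>t. complex_of_real (D' (t, t)) * f t"
  have d: "continuous_on {0..1} ?d" and e: "continuous_on {0..1} ?e"
    by (intro continuous_intros continuous_on_Omega1_diagonal D D' f)+
  note int_d = integrable_continuous_real[OF d] and int_e = integrable_continuous_real[OF e]
  have sectX: "continuous_on {0..1} (\<lambda>t. complex_of_real (X u t) * f t)" if "u \<in> {0..1}" for u
    by (intro continuous_intros f continuous_on_section[OF contX that])
  have sectX': "continuous_on {0..1} (\<lambda>t. complex_of_real (X' u t) * f t)" if "u \<in> {0..1}" for u
    by (intro continuous_intros f continuous_on_section[OF contX' that])
  let ?A = "\<lambda>u. integral {0..1} (\<lambda>t. complex_of_real (X u t) * f t)"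
  let ?A' = "\<lambda>u. integral {0..1} (\<lambda>t. complex_of_real (X' u t) * f t)"
  let ?P = "\<lambda>u. integral {0..u} ?d" and ?Q = "\<lambda>u. integral {0..u} ?e"
  have V: "volterra D f u = ?A u - (?P 1 - ?P u) - of_real u * (?Q 1 - ?Q u)" if u: "u \<in> {0..1}" for u
  proof -
    have sub: "{u..1} \<subseteq> {0..1}" using u by auto
    have "?A u = integral {0..u} (\<lambda>t. complex_of_real (X u t) * f t)
        + integral {u..1} (\<lambda>t. complex_of_real (X u t) * f t)"
      using u by (intro Henstock_Kurzweil_Integration.integral_combine[symmetric] integrable_continuous_real sectX) auto
    also have "integral {0..u} (\<lambda>t. complex_of_real (X u t) * f t) = volterra D f u"
      unfolding volterra_def by (rule integral_cong) (auto simp: X_def)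
    also have "integral {u..1} (\<lambda>t. complex_of_real (X u t) * f t)
        = integral {u..1} (\<lambda>t. ?d t + of_real u * ?e t)"
      by (rule integral_cong) (auto simp: X_def max_def min_def algebra_simps)
    also have "\<dots> = integral {u..1} ?d + of_real u * integral {u..1} ?e"
      using integrable_on_subinterval[OF int_d sub] integrable_on_subinterval[OF int_e sub]
      by (subst integral_add) (auto intro: integrable_on_mult_right)
    also have "integral {u..1} ?d = ?P 1 - ?P u"
      using Henstock_Kurzweil_Integration.integral_combine[of 0 u 1 ?d] u int_d by (simp add: algebra_simps)
    also have "integral {u..1} ?e = ?Q 1 - ?Q u"
      using Henstock_Kurzweil_Integration.integral_combine[of 0 u 1 ?e] u int_e by (simp add: algebra_simps)
    finally show ?thesis by simp
  qed
  have A': "?A' s = volterra D' f s + (?Q 1 - ?Q s)"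
  proof -
    have "?A' s = integral {0..s} (\<lambda>t. complex_of_real (X' s t) * f t)
        + integral {s..1} (\<lambda>t. complex_of_real (X' s t) * f t)"
      using s by (intro Henstock_Kurzweil_Integration.integral_combine[symmetric] integrable_continuous_real sectX') auto
    also have "integral {0..s} (\<lambda>t. complex_of_real (X' s t) * f t) = volterra D' f s"
      unfolding volterra_def by (rule integral_cong) (auto simp: X'_def max_def)
    also have "integral {s..1} (\<lambda>t. complex_of_real (X' s t) * f t) = integral {s..1} ?e"
      by (rule integral_cong) (auto simp: X'_def max_def)
    also have "\<dots> = ?Q 1 - ?Q s"
      using Henstock_Kurzweil_Integration.integral_combine[of 0 s 1 ?e] s int_e by (simp add: algebra_simps)
    finally show ?thesis .
  qed
  have "(?A has_vector_derivative ?A' s) (at s within {0..1})"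
    unfolding cbox_interval[symmetric]
  proof (rule leibniz_rule_vector_derivative)
    fix u t :: real assume "u \<in> cbox 0 1" "t \<in> cbox 0 1"
    then have "((\<lambda>u. X u t) has_real_derivative X' u t) (at u within {0..1})" using derX by simp
    then show "((\<lambda>u. complex_of_real (X u t) * f t) has_vector_derivative complex_of_real (X' u t) * f t)
        (at u within cbox 0 1)"
      by (intro has_vector_derivative_mult_left has_vector_derivative_of_real)
        (simp add: has_real_derivative_iff_has_vector_derivative)
  next
    show "(\<lambda>t. complex_of_real (X u t) * f t) integrable_on cbox 0 1" if "u \<in> cbox 0 1" for u
      using integrable_continuous_real[OF sectX] that by simp
    show "continuous_on (cbox 0 1 \<times> cbox 0 1) (\<lambda>(u, t). complex_of_real (X' u t) * f t)"
      using contX' unfolding case_prod_unfold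
      by (intro continuous_intros continuous_on_compose2[OF f]) auto
  qed (use s in auto)
  moreover have "(?P has_vector_derivative ?d s) (at s within {0..1})"
    "(?Q has_vector_derivative ?e s) (at s within {0..1})"
    by (rule integral_has_vector_derivative[OF _ s], fact)+
  moreover have "((\<lambda>u. complex_of_real u) has_vector_derivative 1) (at s within {0..1})"
    by (rule has_vector_derivative_of_real[of "\<lambda>u. u" 1, simplified])
  ultimately have "((\<lambda>u. ?A u - (?P 1 - ?P u) - of_real u * (?Q 1 - ?Q u)) has_vector_derivative
      ?A' s - (0 - ?d s) - (of_real s * (0 - ?e s) + 1 * (?Q 1 - ?Q s))) (at s within {0..1})"
    by (intro has_vector_derivative_diff has_vector_derivative_mult has_vector_derivative_const)
  moreover have "?A' s - (0 - ?d s) - (of_real s * (0 - ?e s) + 1 * (?Q 1 - ?Q s))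
      = complex_of_real (D (s, s)) * f s + volterra D' f s"
    unfolding A' by (simp add: algebra_simps)
  ultimately show ?thesis
    using has_vector_derivative_transform[OF s V] by simp
qed

text \<open>The path from \<open>(a, a)\<close> to \<open>(b, b)\<close> runs through \<open>(b, a)\<close>, since this corner lies in the triangle whereas
\<open>(a, b)\<close> does not.\<close>

lemma Omega1_diagonal_increment:
  assumes deriv1: "\<And>s t. (s, t) \<in> Omega1 \<Longrightarrow>
      ((\<lambda>u. D (u, t)) has_real_derivative D1 (s, t)) (at s within {u. (u, t) \<in> Omega1})"
    and deriv2: "\<And>s t. (s, t) \<in> Omega1 \<Longrightarrow>
      ((\<lambda>u. D (s, u)) has_real_derivative D2 (s, t)) (at t within {u. (s, u) \<in> Omega1})"
    and ab: "0 \<le> a" "a < b" "b \<le> 1"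
  shows "\<exists>\<xi>\<in>{a..b}. \<exists>\<eta>\<in>{a..b}. D (b, b) - D (a, a) = (D1 (\<xi>, a) + D2 (b, \<eta>)) * (b - a)"
proof -
  have "\<exists>\<xi>\<in>{a<..<b}. D (b, a) - D (a, a) = (\<lambda>h. h * D1 (\<xi>, a)) (b - a)"
  proof (rule mvt_simple[OF ab(2)])
    fix x assume x: "a \<le> x" "x \<le> b"
    have "((\<lambda>u. D (u, a)) has_real_derivative D1 (x, a)) (at x within {a..b})"
      by (rule has_field_derivative_subset[OF deriv1])
        (use x ab in \<open>auto simp: Omega1_def\<close>)
    then show "((\<lambda>u. D (u, a)) has_derivative (\<lambda>h. h * D1 (x, a))) (at x within {a..b})"
      by (simp add: has_field_derivative_def mult_commute_abs)
  qed
  moreover have "\<exists>\<eta>\<in>{a<..<b}. D (b, b) - D (b, a) = (\<lambda>h. h * D2 (b, \<eta>)) (b - a)"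
  proof (rule mvt_simple[OF ab(2)])
    fix x assume x: "a \<le> x" "x \<le> b"
    have "((\<lambda>u. D (b, u)) has_real_derivative D2 (b, x)) (at x within {a..b})"
      by (rule has_field_derivative_subset[OF deriv2])
        (use x ab in \<open>auto simp: Omega1_def\<close>)
    then show "((\<lambda>u. D (b, u)) has_derivative (\<lambda>h. h * D2 (b, x))) (at x within {a..b})"
      by (simp add: has_field_derivative_def mult_commute_abs)
  qed
  ultimately obtain \<xi> \<eta> where "\<xi> \<in> {a<..<b}" "\<eta> \<in> {a<..<b}"
    "D (b, a) - D (a, a) = (b - a) * D1 (\<xi>, a)" "D (b, b) - D (b, a) = (b - a) * D2 (b, \<eta>)"
    by blast
  then show ?thesis
    by (intro bexI[of _ \<xi>] bexI[of _ \<eta>]) (auto simp: algebra_simps)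
qed

lemma has_real_derivative_diagonal:
  assumes D1: "continuous_on Omega1 D1" and D2: "continuous_on Omega1 D2"
    and deriv1: "\<And>s t. (s, t) \<in> Omega1 \<Longrightarrow>
      ((\<lambda>u. D (u, t)) has_real_derivative D1 (s, t)) (at s within {u. (u, t) \<in> Omega1})"
    and deriv2: "\<And>s t. (s, t) \<in> Omega1 \<Longrightarrow>
      ((\<lambda>u. D (s, u)) has_real_derivative D2 (s, t)) (at t within {u. (s, u) \<in> Omega1})"
    and s: "s \<in> {0..1}"
  shows "((\<lambda>u. D (u, u)) has_real_derivative D1 (s, s) + D2 (s, s)) (at s within {0..1})"
  unfolding has_field_derivative_def has_derivative_within_alt
proof (intro conjI allI impI)
  show "bounded_linear ((*) (D1 (s, s) + D2 (s, s)))" by (rule bounded_linear_mult_right)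
  fix e :: real assume e: "e > 0"
  have ss: "(s, s) \<in> Omega1" using s by (auto simp: Omega1_def)
  have "e / 2 > 0" using e by simp
  then obtain d1 where d1: "d1 > 0" "\<And>p. p \<in> Omega1 \<Longrightarrow> dist p (s, s) < d1 \<Longrightarrow> dist (D1 p) (D1 (s, s)) < e / 2"
    using D1 ss unfolding continuous_on_iff by metis
  obtain d2 where d2: "d2 > 0" "\<And>p. p \<in> Omega1 \<Longrightarrow> dist p (s, s) < d2 \<Longrightarrow> dist (D2 p) (D2 (s, s)) < e / 2"
    using D2 ss \<open>e / 2 > 0\<close> unfolding continuous_on_iff by metis
  define d where "d = min d1 d2 / 2"
  have d: "d > 0" using d1 d2 by (simp add: d_def)
  have near: "dist (x, y) (s, s) < d1" "dist (x, y) (s, s) < d2" if "\<bar>x - s\<bar> < d" "\<bar>y - s\<bar> < d" for x y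
  proof -
    have "dist (x, y) (s, s) \<le> \<bar>x - s\<bar> + \<bar>y - s\<bar>"
      unfolding dist_Pair_Pair by (rule order.trans[OF sqrt_sum_squares_le_sum_abs]) (simp add: dist_real_def)
    then show "dist (x, y) (s, s) < d1" "dist (x, y) (s, s) < d2" using that by (auto simp: d_def)
  qed
  have quot: "\<bar>D (b, b) - D (a, a) - (D1 (s, s) + D2 (s, s)) * (b - a)\<bar> \<le> e * (b - a)"
    if ab: "0 \<le> a" "a < b" "b \<le> 1" and close: "\<bar>a - s\<bar> < d" "\<bar>b - s\<bar> < d" for a b
  proof -
    obtain \<xi> \<eta> where \<xi>: "\<xi> \<in> {a..b}" "\<eta> \<in> {a..b}"
      and eq: "D (b, b) - D (a, a) = (D1 (\<xi>, a) + D2 (b, \<eta>)) * (b - a)"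
      using Omega1_diagonal_increment[OF deriv1 deriv2 ab] by blast
    have "(\<xi>, a) \<in> Omega1" "(b, \<eta>) \<in> Omega1" using \<xi> ab by (auto simp: Omega1_def)
    moreover have "\<bar>\<xi> - s\<bar> < d" "\<bar>\<eta> - s\<bar> < d" using \<xi> close by auto
    ultimately have "\<bar>D1 (\<xi>, a) - D1 (s, s)\<bar> < e / 2" "\<bar>D2 (b, \<eta>) - D2 (s, s)\<bar> < e / 2"
      using d1(2) d2(2) near close by (auto simp: dist_real_def)
    then have "\<bar>(D1 (\<xi>, a) + D2 (b, \<eta>)) - (D1 (s, s) + D2 (s, s))\<bar> \<le> e" by linarith
    then have "\<bar>((D1 (\<xi>, a) + D2 (b, \<eta>)) - (D1 (s, s) + D2 (s, s))) * (b - a)\<bar> \<le> e * (b - a)"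
      using ab by (simp add: abs_mult mult_right_mono)
    then show ?thesis unfolding eq by (simp add: algebra_simps)
  qed
  have "norm (D (y, y) - D (s, s) - (D1 (s, s) + D2 (s, s)) * (y - s)) \<le> e * norm (y - s)"
    if y: "y \<in> {0..1}" "norm (y - s) < d" for y
  proof -
    consider "y = s" | "s < y" | "y < s" by linarith
    then show ?thesis
    proof cases
      case 2
      then show ?thesis using quot[of s y] y s d by simp
    next
      case 3
      have "\<bar>D (s, s) - D (y, y) - (D1 (s, s) + D2 (s, s)) * (s - y)\<bar> \<le> e * (s - y)"
        using quot[of y s] y s d 3 by simp
      moreover have "D (y, y) - D (s, s) - (D1 (s, s) + D2 (s, s)) * (y - s)
          = - (D (s, s) - D (y, y) - (D1 (s, s) + D2 (s, s)) * (s - y))"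
        by (simp add: algebra_simps)
      ultimately show ?thesis using 3 by simp
    qed simp
  qed
  then show "\<exists>d>0. \<forall>y\<in>{0..1}. norm (y - s) < d \<longrightarrow>
      norm (D (y, y) - D (s, s) - (D1 (s, s) + D2 (s, s)) * (y - s)) \<le> e * norm (y - s)"
    using d by blast
qed

text \<open>Partial derivatives on the lower triangle, of order at most \<open>N\<close> in each variable.\<close>

locale triangle_partials =
  fixes N :: nat and D :: "nat \<Rightarrow> nat \<Rightarrow> real \<times> real \<Rightarrow> real"
  assumes cont: "\<And>j k. j \<le> N \<Longrightarrow> k \<le> N \<Longrightarrow> continuous_on Omega1 (D j k)"
    and deriv1: "\<And>j k s t. Suc j \<le> N \<Longrightarrow> k \<le> N \<Longrightarrow> (s, t) \<in> Omega1 \<Longrightarrow>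
      ((\<lambda>u. D j k (u, t)) has_real_derivative D (Suc j) k (s, t)) (at s within {u. (u, t) \<in> Omega1})"
    and deriv2: "\<And>j k s t. j \<le> N \<Longrightarrow> Suc k \<le> N \<Longrightarrow> (s, t) \<in> Omega1 \<Longrightarrow>
      ((\<lambda>u. D j k (s, u)) has_real_derivative D j (Suc k) (s, t)) (at t within {u. (s, u) \<in> Omega1})"
begin

lemma C_unit_diagonal:
  "j + m \<le> N \<Longrightarrow> k + m \<le> N \<Longrightarrow> C_unit m (\<lambda>s. complex_of_real (D j k (s, s)))"
proof (induction m arbitrary: j k)
  case 0
  then show ?case
    using continuous_on_Omega1_diagonal[OF cont, of j k] by (auto intro!: continuous_intros)
next
  case (Suc m)
  show ?case
  proof (rule C_unit_SucI[of m "\<lambda>s. complex_of_real (D (Suc j) k (s, s)) + complex_of_real (D j (Suc k) (s, s))"])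
    show "C_unit m (\<lambda>s. complex_of_real (D (Suc j) k (s, s)) + complex_of_real (D j (Suc k) (s, s)))"
      using Suc.prems by (intro C_unit_add Suc.IH) auto
    fix s :: real assume s: "s \<in> {0..1}"
    have "((\<lambda>u. D j k (u, u)) has_real_derivative D (Suc j) k (s, s) + D j (Suc k) (s, s)) (at s within {0..1})"
      by (rule has_real_derivative_diagonal[OF cont cont deriv1 deriv2 s]) (use Suc.prems in auto)
    then have "((\<lambda>u. complex_of_real (D j k (u, u))) has_vector_derivative
        complex_of_real (D (Suc j) k (s, s) + D j (Suc k) (s, s))) (at s within {0..1})"
      by (intro has_vector_derivative_of_real) (simp add: has_real_derivative_iff_has_vector_derivative)
    then show "((\<lambda>u. complex_of_real (D j k (u, u))) has_vector_derivative
        complex_of_real (D (Suc j) k (s, s)) + complex_of_real (D j (Suc k) (s, s))) (at s within {0..1})"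
      by simp
  qed
qed

text \<open>A Volterra integral is one order smoother than its density: its derivative consists of the density times a
diagonal value of the kernel, and of a Volterra integral with the differentiated kernel.\<close>

lemma C_unit_volterra:
  "C_unit m f \<Longrightarrow> Suc (j + m) \<le> N \<Longrightarrow> C_unit (Suc m) (volterra (D j 0) f)"
proof (induction m arbitrary: j)
  case 0
  then have f: "continuous_on {0..1} f" by simp
  show ?case
  proof (rule C_unit_SucI)
    show "C_unit 0 (\<lambda>s. complex_of_real (D j 0 (s, s)) * f s + volterra (D (Suc j) 0) f s)"
      using continuous_on_Omega1_diagonal[OF cont, of j 0] 0 continuous_on_volterra[OF cont f, of "Suc j" 0]
      by (auto intro!: continuous_intros)
  qed (use 0 in \<open>auto intro!: has_vector_derivative_volterra cont deriv1 f\<close>)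
next
  case (Suc m)
  have f: "C_unit m f" "continuous_on {0..1} f"
    using Suc.prems(1) C_unit_Suc_imp C_unit_continuous by blast+
  show ?case
  proof (rule C_unit_SucI)
    show "C_unit (Suc m) (\<lambda>s. complex_of_real (D j 0 (s, s)) * f s + volterra (D (Suc j) 0) f s)"
      using Suc.prems by (intro C_unit_add C_unit_mult C_unit_diagonal Suc.IH f) auto
  qed (use Suc.prems in \<open>auto intro!: has_vector_derivative_volterra cont deriv1 f\<close>)
qed

end

section \<open>Green kernels\<close>

locale bounded_cont_partials =
  fixes A :: "(nat \<times> nat) set" and \<Omega> :: "(real \<times> real) set" and D :: "nat \<Rightarrow> nat \<Rightarrow> real \<times> real \<Rightarrow> real"
  assumes cont: "\<And>j k. (j, k) \<in> A \<Longrightarrow> continuous_on \<Omega> (D j k)"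
    and bounded: "\<And>j k. (j, k) \<in> A \<Longrightarrow> bounded (D j k ` \<Omega>)"
    and deriv1: "\<And>j k s t. (Suc j, k) \<in> A \<Longrightarrow> (s, t) \<in> \<Omega> \<Longrightarrow>
        ((\<lambda>u. D j k (u, t)) has_real_derivative D (Suc j) k (s, t)) (at s within {u. (u, t) \<in> \<Omega>})"
    and deriv2: "\<And>j k s t. (j, Suc k) \<in> A \<Longrightarrow> (s, t) \<in> \<Omega> \<Longrightarrow>
        ((\<lambda>u. D j k (s, u)) has_real_derivative D j (Suc k) (s, t)) (at t within {u. (s, u) \<in> \<Omega>})"

lemma has_bounded_cont_partialsE:
  assumes "has_bounded_cont_partials A \<Omega> f"
  obtains D where "bounded_cont_partials A \<Omega> D" "\<forall>p\<in>\<Omega>. D 0 0 p = f p"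
proof -
  obtain D where D: "\<forall>p\<in>\<Omega>. D 0 0 p = f p"
    "\<forall>(j, k)\<in>A. continuous_on \<Omega> (D j k) \<and> bounded (D j k ` \<Omega>)"
    "\<forall>j k. (Suc j, k) \<in> A \<longrightarrow> (\<forall>(s, t)\<in>\<Omega>.
        ((\<lambda>u. D j k (u, t)) has_real_derivative D (Suc j) k (s, t)) (at s within {u. (u, t) \<in> \<Omega>}))"
    "\<forall>j k. (j, Suc k) \<in> A \<longrightarrow> (\<forall>(s, t)\<in>\<Omega>.
        ((\<lambda>u. D j k (s, u)) has_real_derivative D j (Suc k) (s, t)) (at t within {u. (s, u) \<in> \<Omega>}))"
    using assms unfolding has_bounded_cont_partials_def by blast
  have "bounded_cont_partials A \<Omega> D"
  proof
    show "continuous_on \<Omega> (D j k)" "bounded (D j k ` \<Omega>)" if "(j, k) \<in> A" for j k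
      using D(2)[rule_format, OF that] by simp_all
    show "((\<lambda>u. D j k (u, t)) has_real_derivative D (Suc j) k (s, t)) (at s within {u. (u, t) \<in> \<Omega>})"
      if "(Suc j, k) \<in> A" "(s, t) \<in> \<Omega>" for j k s t
      using D(3)[rule_format, OF that] by simp
    show "((\<lambda>u. D j k (s, u)) has_real_derivative D j (Suc k) (s, t)) (at t within {u. (s, u) \<in> \<Omega>})"
      if "(j, Suc k) \<in> A" "(s, t) \<in> \<Omega>" for j k s t
      using D(4)[rule_format, OF that] by simp
  qed
  then show ?thesis using D(1) by (rule that)
qed

lemma triangle_partials_Omega1:
  assumes "has_bounded_cont_partials ({..N} \<times> {..N}) Omega1 f"
  obtains D where "triangle_partials N D" "\<And>p. p \<in> Omega1 \<Longrightarrow> D 0 0 p = f p"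
proof -
  obtain D where "bounded_cont_partials ({..N} \<times> {..N}) Omega1 D" and D: "\<forall>p\<in>Omega1. D 0 0 p = f p"
    using has_bounded_cont_partialsE[OF assms] .
  then interpret bounded_cont_partials "{..N} \<times> {..N}" Omega1 D by simp
  have "triangle_partials N D"
    by unfold_locales (auto intro: cont deriv1 deriv2)
  then show ?thesis using D that by blast
qed

text \<open>The point reflection \<open>(s, t) \<mapsto> (1 - s, 1 - t)\<close> exchanges the two triangles; each derivative contributes a
sign.\<close>

lemma triangle_partials_Omega2:
  assumes "has_bounded_cont_partials ({..N} \<times> {..N}) Omega2 f"
  obtains D where "triangle_partials N D" "\<And>s t. (s, t) \<in> Omega1 \<Longrightarrow> D 0 0 (s, t) = f (1 - s, 1 - t)"
proof -
  obtain D where "bounded_cont_partials ({..N} \<times> {..N}) Omega2 D" and D: "\<forall>p\<in>Omega2. D 0 0 p = f p"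
    using has_bounded_cont_partialsE[OF assms] .
  then interpret bounded_cont_partials "{..N} \<times> {..N}" Omega2 D by simp
  define R where "R j k p = (-1) ^ (j + k) * D j k (1 - fst p, 1 - snd p)" for j k p
  have reflect: "(1 - s, 1 - t) \<in> Omega2 \<longleftrightarrow> (s, t) \<in> Omega1" for s t
    by (auto simp: Omega1_def Omega2_def)
  have refl_der: "((\<lambda>u. 1 - u) has_real_derivative -1) (at u within S)" for u :: real and S
    by (auto intro!: derivative_eq_intros)
  have "triangle_partials N R"
  proof
    show "continuous_on Omega1 (R j k)" if "j \<le> N" "k \<le> N" for j k
    proof -
      have "continuous_on Omega2 (D j k)" by (rule cont) (use that in simp)
      then have "continuous_on Omega1 (\<lambda>p. D j k (1 - fst p, 1 - snd p))"
        by (rule continuous_on_compose2) (auto intro!: continuous_intros simp: reflect)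
      then show ?thesis unfolding R_def by (intro continuous_intros)
    qed
    show "((\<lambda>u. R j k (u, t)) has_real_derivative R (Suc j) k (s, t)) (at s within {u. (u, t) \<in> Omega1})"
      if "Suc j \<le> N" "k \<le> N" "(s, t) \<in> Omega1" for j k s t
    proof -
      have "((\<lambda>u. D j k (u, 1 - t)) has_real_derivative D (Suc j) k (1 - s, 1 - t))
          (at (1 - s) within {u. (u, 1 - t) \<in> Omega2})"
        by (rule deriv1) (use that reflect in auto)
      then have "((\<lambda>u. D j k (u, 1 - t)) has_real_derivative D (Suc j) k (1 - s, 1 - t))
          (at (1 - s) within (\<lambda>u. 1 - u) ` {u. (u, t) \<in> Omega1})"
        by (rule has_field_derivative_subset) (auto simp: reflect)
      from DERIV_image_chain[OF this refl_der]
      have "((\<lambda>u. D j k (1 - u, 1 - t)) has_real_derivative - D (Suc j) k (1 - s, 1 - t))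
          (at s within {u. (u, t) \<in> Omega1})" by (simp add: o_def)
      from DERIV_cmult[OF this, of "(-1) ^ (j + k)"] show ?thesis by (simp add: R_def)
    qed
    show "((\<lambda>u. R j k (s, u)) has_real_derivative R j (Suc k) (s, t)) (at t within {u. (s, u) \<in> Omega1})"
      if "j \<le> N" "Suc k \<le> N" "(s, t) \<in> Omega1" for j k s t
    proof -
      have "((\<lambda>u. D j k (1 - s, u)) has_real_derivative D j (Suc k) (1 - s, 1 - t))
          (at (1 - t) within {u. (1 - s, u) \<in> Omega2})"
        by (rule deriv2) (use that reflect in auto)
      then have "((\<lambda>u. D j k (1 - s, u)) has_real_derivative D j (Suc k) (1 - s, 1 - t))
          (at (1 - t) within (\<lambda>u. 1 - u) ` {u. (s, u) \<in> Omega1})"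
        by (rule has_field_derivative_subset) (auto simp: reflect)
      from DERIV_image_chain[OF this refl_der]
      have "((\<lambda>u. D j k (1 - s, 1 - u)) has_real_derivative - D j (Suc k) (1 - s, 1 - t))
          (at t within {u. (s, u) \<in> Omega1})" by (simp add: o_def)
      from DERIV_cmult[OF this, of "(-1) ^ (j + k)"] show ?thesis by (simp add: R_def)
    qed
  qed
  moreover have "R 0 0 (s, t) = f (1 - s, 1 - t)" if "(s, t) \<in> Omega1" for s t
    using D that reflect by (auto simp: R_def)
  ultimately show ?thesis by (rule that)
qed

lemma green_kernelD:
  assumes "green_kernel r \<kappa>"
  shows "continuous_on ({0..1} \<times> {0..1}) \<kappa>"
    and "has_bounded_cont_partials ({..2 * r + 2} \<times> {..2 * r + 2}) Omega1 \<kappa>"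
    and "has_bounded_cont_partials ({..2 * r + 2} \<times> {..2 * r + 2}) Omega2 \<kappa>"
proof -
  have cong: "has_bounded_cont_partials A \<Omega> f \<Longrightarrow> \<forall>p\<in>\<Omega>. g p = f p \<Longrightarrow> has_bounded_cont_partials A \<Omega> g"
    for A \<Omega> f g
  proof -
    assume f: "has_bounded_cont_partials A \<Omega> f" and eq: "\<forall>p\<in>\<Omega>. g p = f p"
    then have "(\<forall>p\<in>\<Omega>. D 0 0 p = f p) = (\<forall>p\<in>\<Omega>. D 0 0 p = g p)" for D :: "nat \<Rightarrow> nat \<Rightarrow> real \<times> real \<Rightarrow> real"
      by simp
    with f show ?thesis unfolding has_bounded_cont_partials_def by simp
  qed
  show "continuous_on ({0..1} \<times> {0..1}) \<kappa>"
    using assms by (simp add: green_kernel_def)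
  show "has_bounded_cont_partials ({..2 * r + 2} \<times> {..2 * r + 2}) Omega1 \<kappa>"
    "has_bounded_cont_partials ({..2 * r + 2} \<times> {..2 * r + 2}) Omega2 \<kappa>"
    using assms cong unfolding green_kernel_def by blast+
qed

lemma integral_reflect_interval:
  fixes h :: "real \<Rightarrow> complex"
  shows "integral {c - b..c - a} (\<lambda>t. h (c - t)) = integral {a..b} h"
  using integral_reflect_real[of b a h] integral_shift_real_ivl[of "-b" "-c" "-a" "\<lambda>x. h (- x)"]
  by (simp add: algebra_simps)

text \<open>Bootstrapping: the eigenvalue equation writes \<open>f\<close> as the sum of two Volterra integrals with density \<open>f\<close>,
one over each triangle, so smoothness of order \<open>m\<close> implies smoothness of order \<open>m + 1\<close> as long as the kernel
has enough derivatives.\<close>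

proposition green_kernel_eigenfunction_smooth:
  assumes \<kappa>: "green_kernel r \<kappa>" and f: "continuous_on {0..1} f" and "\<nu> \<noteq> 0"
    and eig: "\<And>s. s \<in> {0..1} \<Longrightarrow> \<nu> * f s = integral {0..1} (\<lambda>t. complex_of_real (\<kappa> (s, t)) * f t)"
  shows "C_unit (2 * r + 2) f"
proof -
  let ?N = "2 * r + 2"
  obtain D1 where D1: "triangle_partials ?N D1" "\<And>p. p \<in> Omega1 \<Longrightarrow> D1 0 0 p = \<kappa> p"
    using triangle_partials_Omega1[OF green_kernelD(2)[OF \<kappa>]] by blast
  obtain D2 where D2: "triangle_partials ?N D2"
    "\<And>s t. (s, t) \<in> Omega1 \<Longrightarrow> D2 0 0 (s, t) = \<kappa> (1 - s, 1 - t)"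
    using triangle_partials_Omega2[OF green_kernelD(3)[OF \<kappa>]] by blast
  let ?g = "\<lambda>t. f (1 - t)"
  have split: "f s = (1 / \<nu>) * (volterra (D1 0 0) f s + volterra (D2 0 0) ?g (1 - s))"
    if s: "s \<in> {0..1}" for s
  proof -
    let ?h = "\<lambda>t. complex_of_real (\<kappa> (s, t)) * f t"
    have "continuous_on {0..1} (\<lambda>t. \<kappa> (s, t))"
      by (rule continuous_on_section[of "{0..1}" _ "\<lambda>s t. \<kappa> (s, t)"])
        (use green_kernelD(1)[OF \<kappa>] s in simp_all)
    then have h: "?h integrable_on {0..1}" by (intro integrable_continuous_real continuous_intros f)
    have "\<nu> * f s = integral {0..s} ?h + integral {s..1} ?h"
      unfolding eig[OF s]
      by (rule Henstock_Kurzweil_Integration.integral_combine[symmetric]) (use s h in auto)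
    also have "integral {0..s} ?h = volterra (D1 0 0) f s"
      unfolding volterra_def by (rule integral_cong) (use s D1(2) in \<open>auto simp: Omega1_def\<close>)
    also have "integral {s..1} ?h = integral {0..1 - s} (\<lambda>t. ?h (1 - t))"
      using integral_reflect_interval[of 1 1 s ?h] by simp
    also have "\<dots> = volterra (D2 0 0) ?g (1 - s)"
      unfolding volterra_def by (rule integral_cong) (use s D2(2) in \<open>auto simp: Omega1_def\<close>)
    finally show ?thesis using \<open>\<nu> \<noteq> 0\<close> by (simp add: field_simps)
  qed
  have "m \<le> ?N \<Longrightarrow> C_unit m f" for m
  proof (induction m)
    case 0
    then show ?case using f by simp
  next
    case (Suc m)
    then have m: "C_unit m f" "Suc (0 + m) \<le> ?N" by simp_all
    have "C_unit (Suc m) (\<lambda>s. (1 / \<nu>) * (volterra (D1 0 0) f s + volterra (D2 0 0) ?g (1 - s)))"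
      by (intro C_unit_mult C_unit_const C_unit_add C_unit_reflect
          triangle_partials.C_unit_volterra[OF D1(1)] triangle_partials.C_unit_volterra[OF D2(1)] m)
    then show ?case by (rule C_unit_cong) (rule split)
  qed
  then show ?thesis by blast
qed

lemma bounded_partials_lipschitz:
  assumes f: "has_bounded_cont_partials A \<Omega> f" and A: "(0, 1) \<in> A" "(1, 0) \<in> A"
    and convex1: "\<And>t. convex {u. (u, t) \<in> \<Omega>}" and convex2: "\<And>s. convex {u. (s, u) \<in> \<Omega>}"
  obtains L where "\<And>s s' t. (s, t) \<in> \<Omega> \<Longrightarrow> (s', t) \<in> \<Omega> \<Longrightarrow> \<bar>f (s, t) - f (s', t)\<bar> \<le> L * \<bar>s - s'\<bar>"
    "\<And>s t t'. (s, t) \<in> \<Omega> \<Longrightarrow> (s, t') \<in> \<Omega> \<Longrightarrow> \<bar>f (s, t) - f (s, t')\<bar> \<le> L * \<bar>t - t'\<bar>"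
proof -
  obtain D where "bounded_cont_partials A \<Omega> D" and D: "\<forall>p\<in>\<Omega>. D 0 0 p = f p"
    using has_bounded_cont_partialsE[OF f] .
  then interpret bounded_cont_partials A \<Omega> D by simp
  obtain L1 where L1: "\<And>p. p \<in> \<Omega> \<Longrightarrow> norm (D 1 0 p) \<le> L1"
    using bounded[OF A(2)] unfolding bounded_iff by blast
  obtain L2 where L2: "\<And>p. p \<in> \<Omega> \<Longrightarrow> norm (D 0 1 p) \<le> L2"
    using bounded[OF A(1)] unfolding bounded_iff by blast
  show ?thesis
  proof (rule that[of "max L1 L2"])
    show "\<bar>f (s, t) - f (s', t)\<bar> \<le> max L1 L2 * \<bar>s - s'\<bar>" if "(s, t) \<in> \<Omega>" "(s', t) \<in> \<Omega>" for s s' t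
    proof -
      have "norm (D 0 0 (s, t) - D 0 0 (s', t)) \<le> max L1 L2 * norm (s - s')"
        by (rule field_differentiable_bound[OF convex1[of t], where f = "\<lambda>u. D 0 0 (u, t)" and f' = "\<lambda>u. D 1 0 (u, t)"])
          (use deriv1[of 0 0 _ t] A that L1 in \<open>auto simp: le_max_iff_disj\<close>)
      then show ?thesis using D that by simp
    qed
    show "\<bar>f (s, t) - f (s, t')\<bar> \<le> max L1 L2 * \<bar>t - t'\<bar>" if "(s, t) \<in> \<Omega>" "(s, t') \<in> \<Omega>" for s t t'
    proof -
      have "norm (D 0 0 (s, t) - D 0 0 (s, t')) \<le> max L1 L2 * norm (t - t')"
        by (rule field_differentiable_bound[OF convex2[of s], where f = "\<lambda>u. D 0 0 (s, u)" and f' = "\<lambda>u. D 0 1 (s, u)"])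
          (use deriv2[of 0 0 s] A that L2 in \<open>auto simp: le_max_iff_disj\<close>)
      then show ?thesis using D that by simp
    qed
  qed
qed

text \<open>A segment parallel to an axis that crosses the diagonal is cut there; continuity of the kernel across the
diagonal joins the Lipschitz bounds of the two triangles.\<close>

lemma green_kernel_lipschitz:
  assumes \<kappa>: "green_kernel r \<kappa>"
  obtains L where "L \<ge> 0"
    "\<And>s s' t. s \<in> {0..1} \<Longrightarrow> s' \<in> {0..1} \<Longrightarrow> t \<in> {0..1} \<Longrightarrow> \<bar>\<kappa> (s, t) - \<kappa> (s', t)\<bar> \<le> L * \<bar>s - s'\<bar>"
    "\<And>s t t'. s \<in> {0..1} \<Longrightarrow> t \<in> {0..1} \<Longrightarrow> t' \<in> {0..1} \<Longrightarrow> \<bar>\<kappa> (s, t) - \<kappa> (s, t')\<bar> \<le> L * \<bar>t - t'\<bar>"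
proof -
  have conv1: "convex {u. (u, t) \<in> Omega1}" "convex {u. (t, u) \<in> Omega1}"
    "convex {u. (u, t) \<in> Omega2}" "convex {u. (t, u) \<in> Omega2}" for t
    unfolding Omega1_def Omega2_def by (auto simp: is_interval_convex_1[symmetric] is_interval_1)
  obtain L1 where L1:
    "\<And>s s' t. (s, t) \<in> Omega1 \<Longrightarrow> (s', t) \<in> Omega1 \<Longrightarrow> \<bar>\<kappa> (s, t) - \<kappa> (s', t)\<bar> \<le> L1 * \<bar>s - s'\<bar>"
    "\<And>s t t'. (s, t) \<in> Omega1 \<Longrightarrow> (s, t') \<in> Omega1 \<Longrightarrow> \<bar>\<kappa> (s, t) - \<kappa> (s, t')\<bar> \<le> L1 * \<bar>t - t'\<bar>"
    by (rule bounded_partials_lipschitz[OF green_kernelD(2)[OF \<kappa>] _ _ conv1(1,2)]) auto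
  obtain L2 where L2:
    "\<And>s s' t. (s, t) \<in> Omega2 \<Longrightarrow> (s', t) \<in> Omega2 \<Longrightarrow> \<bar>\<kappa> (s, t) - \<kappa> (s', t)\<bar> \<le> L2 * \<bar>s - s'\<bar>"
    "\<And>s t t'. (s, t) \<in> Omega2 \<Longrightarrow> (s, t') \<in> Omega2 \<Longrightarrow> \<bar>\<kappa> (s, t) - \<kappa> (s, t')\<bar> \<le> L2 * \<bar>t - t'\<bar>"
    by (rule bounded_partials_lipschitz[OF green_kernelD(3)[OF \<kappa>] _ _ conv1(3,4)]) auto
  define L where "L = max 0 (max L1 L2)"
  have L: "0 \<le> L" "L1 \<le> L" "L2 \<le> L" by (auto simp: L_def)
  have le1: "L1 * \<bar>x\<bar> \<le> L * \<bar>x\<bar>" and le2: "L2 * \<bar>x\<bar> \<le> L * \<bar>x\<bar>" for x :: real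
    using L by (auto intro: mult_right_mono)
  note L1' = order.trans[OF L1(1) le1] order.trans[OF L1(2) le1]
    and L2' = order.trans[OF L2(1) le2] order.trans[OF L2(2) le2]
  have ordered: "\<bar>\<kappa> (a, t) - \<kappa> (b, t)\<bar> \<le> L * (b - a)" "\<bar>\<kappa> (t, a) - \<kappa> (t, b)\<bar> \<le> L * (b - a)"
    if "0 \<le> a" "a \<le> b" "b \<le> 1" "t \<in> {0..1}" for a b t
  proof -
    consider "t \<le> a" | "b \<le> t" | "a \<le> t" "t \<le> b" by linarith
    then have "\<bar>\<kappa> (a, t) - \<kappa> (b, t)\<bar> \<le> L * (b - a) \<and> \<bar>\<kappa> (t, a) - \<kappa> (t, b)\<bar> \<le> L * (b - a)"
    proof cases
      case 1
      then show ?thesis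
        using L1'(1)[of a t b] L2'(2)[of t a b] that by (auto simp: Omega1_def Omega2_def)
    next
      case 2
      then show ?thesis
        using L2'(1)[of a t b] L1'(2)[of t a b] that by (auto simp: Omega1_def Omega2_def)
    next
      case 3
      have "\<bar>\<kappa> (a, t) - \<kappa> (t, t)\<bar> \<le> L * (t - a)" "\<bar>\<kappa> (t, t) - \<kappa> (b, t)\<bar> \<le> L * (b - t)"
        "\<bar>\<kappa> (t, a) - \<kappa> (t, t)\<bar> \<le> L * (t - a)" "\<bar>\<kappa> (t, t) - \<kappa> (t, b)\<bar> \<le> L * (b - t)"
        using L2'(1)[of a t t] L1'(1)[of t t b] L1'(2)[of t a t] L2'(2)[of t t b] 3 that
        by (auto simp: Omega1_def Omega2_def)
      moreover have "L * (t - a) + L * (b - t) = L * (b - a)" by (simp add: algebra_simps)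
      ultimately show ?thesis by linarith
    qed
    then show "\<bar>\<kappa> (a, t) - \<kappa> (b, t)\<bar> \<le> L * (b - a)" "\<bar>\<kappa> (t, a) - \<kappa> (t, b)\<bar> \<le> L * (b - a)" by auto
  qed
  show ?thesis
  proof (rule that[OF L(1)])
    show "\<bar>\<kappa> (s, t) - \<kappa> (s', t)\<bar> \<le> L * \<bar>s - s'\<bar>" if "s \<in> {0..1}" "s' \<in> {0..1}" "t \<in> {0..1}" for s s' t
      using ordered(1)[of s s' t] ordered(1)[of s' s t] that by (cases "s \<le> s'") (auto simp: abs_minus_commute)
    show "\<bar>\<kappa> (s, t) - \<kappa> (s, t')\<bar> \<le> L * \<bar>t - t'\<bar>" if "s \<in> {0..1}" "t \<in> {0..1}" "t' \<in> {0..1}" for s t t'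
      using ordered(2)[of t t' s] ordered(2)[of t' t s] that by (cases "t \<le> t'") (auto simp: abs_minus_commute)
  qed
qed

section \<open>Local error of piecewise polynomial interpolation\<close>

text \<open>A bound, independent of \<open>n\<close> and of the cell, for the Lebesgue constant of interpolation at \<open>2 r + 1\<close>
equidistant nodes: each factor of a Lagrange basis polynomial is at most \<open>2 r\<close> on the cell. For \<open>r = 0\<close> the
convention \<open>0 ^ 0 = 1\<close> gives the correct value \<open>1\<close>.\<close>

definition lebesgue_bound :: "nat \<Rightarrow> real"
  where "lebesgue_bound r = real (2 * r + 1) * real (2 * r) ^ (2 * r)"

lemma lebesgue_bound_nonneg: "0 \<le> lebesgue_bound r"
  by (simp add: lebesgue_bound_def)

lemma norm_lagrange_basis_le:
  assumes n: "n \<ge> 1" and i: "i \<le> 2 * r" and t: "t \<in> partition_interval n j"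
  shows "norm (poly (lagrange_basis r n j i) (of_real t)) \<le> real (2 * r) ^ (2 * r)"
proof -
  have factor: "norm (poly (smult (1 / of_real (node r n j i - node r n j m)) [:- of_real (node r n j m), 1:])
      (complex_of_real t)) \<le> real (2 * r)" if m: "m \<in> {..2 * r} - {i}" for m
  proof -
    have r: "r \<noteq> 0" using m i by auto
    have "t \<in> {(real j - 1) / real n .. (real j - 1) / real n + 1 / real n}"
      "node r n j m \<in> {(real j - 1) / real n .. (real j - 1) / real n + 1 / real n}"
      using t node_in_interval[OF n, of m r j] m by (auto simp: partition_interval_def diff_divide_distrib)
    then have num: "\<bar>t - node r n j m\<bar> \<le> 1 / real n" by auto
    have "node r n j i - node r n j m = (real i - real m) / (2 * real r * real n)"
      using r n by (simp add: node_def diff_divide_distrib mult_ac)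
    moreover have "1 \<le> \<bar>real i - real m\<bar>" using m by auto
    ultimately have den: "1 / (2 * real r * real n) \<le> \<bar>node r n j i - node r n j m\<bar>"
      using r n by (simp add: abs_mult divide_right_mono)
    have pos: "0 < 1 / (2 * real r * real n)" using r n by simp
    have "norm (poly (smult (1 / of_real (node r n j i - node r n j m)) [:- of_real (node r n j m), 1:])
        (complex_of_real t)) = \<bar>t - node r n j m\<bar> / \<bar>node r n j i - node r n j m\<bar>"
    proof -
      have "poly (smult (1 / of_real (node r n j i - node r n j m)) [:- of_real (node r n j m), 1:])
        (complex_of_real t) = complex_of_real ((t - node r n j m) / (node r n j i - node r n j m))"
        by (simp add: diff_divide_distrib)
      then show ?thesis by (simp only: norm_of_real abs_divide)
    qed
    also have "\<dots> \<le> (1 / real n) / (1 / (2 * real r * real n))"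
      using num den pos by (intro frac_le) auto
    also have "\<dots> = real (2 * r)" using n by simp
    finally show ?thesis .
  qed
  have "norm (poly (lagrange_basis r n j i) (of_real t)) =
      (\<Prod>m\<in>{..2 * r} - {i}. norm (poly (smult (1 / of_real (node r n j i - node r n j m))
        [:- of_real (node r n j m), 1:]) (complex_of_real t)))"
    unfolding lagrange_basis_def poly_prod prod_norm ..
  also have "\<dots> \<le> (\<Prod>m\<in>{..2 * r} - {i}. real (2 * r))"
    by (intro prod_mono conjI norm_ge_zero factor)
  also have "\<dots> = real (2 * r) ^ (2 * r)" using i by (simp add: card_Diff_singleton)
  finally show ?thesis .
qed

lemma norm_interp_poly_le:
  assumes n: "n \<ge> 1" and t: "t \<in> partition_interval n j"
    and f: "\<And>u. u \<in> partition_interval n j \<Longrightarrow> norm (f u) \<le> B"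
  shows "norm (poly (interp_poly r n f j) (of_real t)) \<le> lebesgue_bound r * B"
proof -
  have "norm (poly (interp_poly r n f j) (of_real t))
      \<le> (\<Sum>i\<le>2 * r. B * real (2 * r) ^ (2 * r))"
    unfolding interp_poly_lagrange[OF n] poly_sum
  proof (rule sum_norm_le)
    fix i assume "i \<in> {..2 * r}"
    then have i: "i \<le> 2 * r" by simp
    have fi: "norm (f (node r n j i)) \<le> B" by (rule f[OF node_in_interval[OF n i]])
    then have "0 \<le> B" using norm_ge_zero order.trans by blast
    then show "norm (poly (smult (f (node r n j i)) (lagrange_basis r n j i)) (complex_of_real t))
        \<le> B * real (2 * r) ^ (2 * r)"
      unfolding poly_smult norm_mult
      by (intro mult_mono fi norm_lagrange_basis_le[OF n i t] norm_ge_zero)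
  qed
  also have "\<dots> = lebesgue_bound r * B" by (simp add: lebesgue_bound_def)
  finally show ?thesis .
qed

definition nodal_poly :: "nat \<Rightarrow> nat \<Rightarrow> nat \<Rightarrow> complex poly"
  where "nodal_poly r n j = (\<Prod>i\<le>2 * r. [:- of_real (node r n j i), 1:])"

lemma nodal_poly:
  shows degree_nodal_poly: "degree (nodal_poly r n j) = 2 * r + 1"
    and coeff_nodal_poly: "coeff (nodal_poly r n j) (2 * r + 1) = 1"
    and nodal_poly_node: "i \<le> 2 * r \<Longrightarrow> poly (nodal_poly r n j) (of_real (node r n j i)) = 0"
proof -
  show deg: "degree (nodal_poly r n j) = 2 * r + 1"
    unfolding nodal_poly_def by (subst degree_prod_eq_sum_degree) auto
  have "lead_coeff (nodal_poly r n j) = 1"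
    unfolding nodal_poly_def lead_coeff_prod by simp
  then show "coeff (nodal_poly r n j) (2 * r + 1) = 1" by (simp add: deg)
  show "i \<le> 2 * r \<Longrightarrow> poly (nodal_poly r n j) (of_real (node r n j i)) = 0"
    unfolding nodal_poly_def poly_prod by (auto intro!: prod_zero bexI[of _ i])
qed

text \<open>Subtracting the right multiple of the nodal polynomial lowers the degree of \<open>q\<close> to \<open>2 r\<close> without changing
its values at the nodes. The result is reproduced by the interpolation, so only the difference \<open>f - q\<close> and
its interpolant are left.\<close>

lemma interp_error_nodal:
  assumes n: "n \<ge> 1" and q: "degree q \<le> 2 * r + 1"
    and f: "\<And>u. u \<in> partition_interval n j \<Longrightarrow> norm (f u - poly q (of_real u)) \<le> \<epsilon>"
    and t: "t \<in> partition_interval n j"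
  shows "norm (f t - poly (interp_poly r n f j) (of_real t)
    - coeff q (2 * r + 1) * poly (nodal_poly r n j) (of_real t)) \<le> (1 + lebesgue_bound r) * \<epsilon>"
proof -
  let ?a = "coeff q (2 * r + 1)" and ?w = "nodal_poly r n j"
  define p where "p = q - smult ?a ?w"
  define g where "g u = f u - poly q (of_real u)" for u
  have "degree p \<le> 2 * r"
  proof (rule degree_le, intro allI impI)
    fix i assume i: "2 * r < i"
    show "coeff p i = 0"
    proof (cases "i = 2 * r + 1")
      case True
      then show ?thesis using coeff_nodal_poly[of r n j] by (simp add: p_def)
    next
      case False
      then have "degree q < i" "degree ?w < i" using i q degree_nodal_poly[of r n j] by auto
      then show ?thesis by (simp add: p_def coeff_eq_0)
    qed
  qed
  then have "interp_poly r n f j = p + interp_poly r n g j"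
    using interp_poly[OF n, where r = r and f = g and j = j] nodal_poly_node[of _ r n j]
    by (intro interp_poly_eqI n degree_add_le) (auto simp: p_def g_def)
  then have "f t - poly (interp_poly r n f j) (of_real t) - ?a * poly ?w (of_real t)
      = g t - poly (interp_poly r n g j) (of_real t)"
    by (simp add: p_def g_def)
  also have "norm \<dots> \<le> norm (g t) + norm (poly (interp_poly r n g j) (of_real t))"
    by (rule norm_triangle_ineq4)
  also have "\<dots> \<le> \<epsilon> + lebesgue_bound r * \<epsilon>"
    by (intro add_mono norm_interp_poly_le n t) (use f t in \<open>auto simp: g_def\<close>)
  finally show ?thesis by (simp add: algebra_simps)
qed

lemma norm_nodal_poly_le:
  assumes n: "n \<ge> 1" and t: "t \<in> partition_interval n j"
  shows "norm (poly (nodal_poly r n j) (of_real t)) \<le> (1 / real n) ^ (2 * r + 1)"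
proof -
  have factor: "norm (poly [:- complex_of_real (node r n j i), 1:] (of_real t)) \<le> 1 / real n" if "i \<le> 2 * r" for i
  proof -
    have "t \<in> {(real j - 1) / real n .. (real j - 1) / real n + 1 / real n}"
      "node r n j i \<in> {(real j - 1) / real n .. (real j - 1) / real n + 1 / real n}"
      using t node_in_interval[OF n that, of j] by (auto simp: partition_interval_def diff_divide_distrib)
    then have "\<bar>t - node r n j i\<bar> \<le> 1 / real n" by auto
    moreover have "poly [:- complex_of_real (node r n j i), 1:] (of_real t) = complex_of_real (t - node r n j i)"
      by simp
    ultimately show ?thesis by (simp only: norm_of_real)
  qed
  have "norm (poly (nodal_poly r n j) (of_real t))
      = (\<Prod>i\<le>2 * r. norm (poly [:- complex_of_real (node r n j i), 1:] (of_real t)))"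
    unfolding nodal_poly_def poly_prod prod_norm ..
  also have "\<dots> \<le> (\<Prod>i\<le>2 * r. 1 / real n)"
    by (intro prod_mono conjI norm_ge_zero factor) simp
  finally show ?thesis by simp
qed

lemma node_symmetric:
  assumes "n \<ge> 1" "i \<le> 2 * r"
  shows "node r n j (2 * r - i) = (real j - 1) / real n + real j / real n - node r n j i"
proof (cases "r = 0")
  case True
  have "x / 2 = x - x / 2" for x :: real by simp
  then show ?thesis unfolding node_def if_P[OF True] .
next
  case False
  then show ?thesis using assms by (simp add: node_def of_nat_diff field_simps)
qed

lemma nodal_poly_odd:
  assumes n: "n \<ge> 1"
  shows "poly (nodal_poly r n j) (of_real ((real j - 1) / real n + real j / real n - t))
    = - poly (nodal_poly r n j) (of_real t)"
proof -
  let ?c = "(real j - 1) / real n + real j / real n"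
  have "poly (nodal_poly r n j) (of_real (?c - t)) = (\<Prod>i\<le>2 * r. complex_of_real (?c - t - node r n j i))"
    unfolding nodal_poly_def poly_prod by (intro prod.cong) auto
  also have "\<dots> = (\<Prod>i\<le>2 * r. complex_of_real (?c - t - node r n j (2 * r - i)))"
    by (rule prod.reindex_bij_witness[of _ "\<lambda>i. 2 * r - i" "\<lambda>i. 2 * r - i"]) auto
  also have "\<dots> = (\<Prod>i\<le>2 * r. (-1) * complex_of_real (t - node r n j i))"
    by (intro prod.cong) (auto simp: node_symmetric[OF n])
  also have "\<dots> = (\<Prod>i\<le>2 * r. - 1) * (\<Prod>i\<le>2 * r. complex_of_real (t - node r n j i))"
    by (rule prod.distrib)
  also have "(\<Prod>i\<le>2 * r. complex_of_real (t - node r n j i)) = poly (nodal_poly r n j) (of_real t)"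
    unfolding nodal_poly_def poly_prod by (intro prod.cong) auto
  finally show ?thesis by simp
qed

text \<open>An odd number of nodes placed symmetrically in the cell makes the nodal polynomial odd about the midpoint.\<close>

lemma integral_nodal_poly:
  assumes n: "n \<ge> 1"
  shows "integral (partition_interval n j) (\<lambda>t. poly (nodal_poly r n j) (of_real t)) = 0"
proof -
  let ?w = "\<lambda>t. poly (nodal_poly r n j) (complex_of_real t)"
  let ?a = "(real j - 1) / real n" and ?b = "real j / real n"
  have "integral {?a..?b} ?w = integral {?a + ?b - ?b..?a + ?b - ?a} (\<lambda>t. ?w (?a + ?b - t))"
    by (rule integral_reflect_interval[symmetric])
  also have "\<dots> = - integral {?a..?b} ?w"
    unfolding nodal_poly_odd[OF n] by simp
  finally show ?thesis by (simp add: partition_interval_def)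
qed

lemma C_unit_derivatives:
  "C_unit m f \<Longrightarrow> \<exists>Df. Df 0 = f \<and> continuous_on {0..1} (Df m) \<and>
    (\<forall>i<m. \<forall>t\<in>{0..1}. (Df i has_vector_derivative Df (Suc i) t) (at t within {0..1}))"
proof (induction m arbitrary: f)
  case 0
  then show ?case by (intro exI[of _ "\<lambda>_. f"]) simp
next
  case (Suc m)
  obtain f' where f': "C_unit m f'"
    "\<And>s. s \<in> {0..1} \<Longrightarrow> (f has_vector_derivative f' s) (at s within {0..1})"
    using Suc.prems by (rule C_unit_SucE) blast
  obtain D where D: "D 0 = f'" "continuous_on {0..1} (D m)"
    "\<forall>i<m. \<forall>t\<in>{0..1}. (D i has_vector_derivative D (Suc i) t) (at t within {0..1})"
    using Suc.IH[OF f'(1)] by blast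
  show ?case
    by (rule exI[of _ "case_nat f D"]) (use D f'(2) in \<open>auto split: nat.split\<close>)
qed

lemma C_unit_taylor:
  assumes "C_unit (Suc m) f"
  obtains M where "M \<ge> 0" "\<And>a b. 0 \<le> a \<Longrightarrow> a \<le> b \<Longrightarrow> b \<le> 1 \<Longrightarrow> \<exists>q. degree q \<le> m \<and> norm (coeff q m) \<le> M \<and>
    (\<forall>t\<in>{a..b}. norm (f t - poly q (complex_of_real t)) \<le> M * (b - a) ^ Suc m)"
proof -
  obtain Df where Df: "Df 0 = f" "continuous_on {0..1} (Df (Suc m))"
    "\<And>i t. i < Suc m \<Longrightarrow> t \<in> {0..1} \<Longrightarrow> (Df i has_vector_derivative Df (Suc i) t) (at t within {0..1})"
    using C_unit_derivatives[OF assms] by blast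
  have "continuous_on {0..1} (Df m)"
    unfolding continuous_on_eq_continuous_within
    using has_vector_derivative_continuous[OF Df(3)[of m]] by blast
  then have "bounded (Df m ` {0..1} \<union> Df (Suc m) ` {0..1})"
    using Df(2) by (intro compact_imp_bounded compact_Un compact_continuous_image) auto
  then obtain M0 where "\<And>z. z \<in> Df m ` {0..1} \<union> Df (Suc m) ` {0..1} \<Longrightarrow> norm z \<le> M0"
    unfolding bounded_iff by blast
  then have M0: "norm (Df m t) \<le> max 0 M0" "norm (Df (Suc m) t) \<le> max 0 M0" if "t \<in> {0..1}" for t
    using that by (force simp: le_max_iff_disj)+
  define M where "M = max 0 M0"
  show ?thesis
  proof (rule that[of M])
    show "M \<ge> 0" by (simp add: M_def)
    fix a b :: real assume ab: "0 \<le> a" "a \<le> b" "b \<le> 1"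
    define q where "q = (\<Sum>i<Suc m. smult (Df i a / fact i) ([:- complex_of_real a, 1:] ^ i))"
    have "degree q \<le> m"
      unfolding q_def
      by (rule degree_sum_le) (auto intro!: order.trans[OF degree_smult_le] simp: degree_linear_power)
    moreover have "norm (coeff q m) \<le> M"
    proof -
      have "coeff q m = (\<Sum>i<Suc m. if i = m then Df m a / fact m else 0)"
        unfolding q_def coeff_sum
        by (rule sum.cong) (auto simp: coeff_linear_power coeff_eq_0 degree_linear_power)
      then have "coeff q m = Df m a / fact m" by simp
      then have "norm (coeff q m) = norm (Df m a) / fact m" by (simp add: norm_divide)
      also have "\<dots> \<le> norm (Df m a) / 1"
        by (intro divide_left_mono) auto
      also have "\<dots> \<le> M" using M0(1)[of a] ab by (simp add: M_def)
      finally show ?thesis .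
    qed
    moreover have "norm (f t - poly q (complex_of_real t)) \<le> M * (b - a) ^ Suc m" if t: "t \<in> {a..b}" for t
    proof -
      let ?i = "\<lambda>x. ((t - x) ^ (Suc m - 1) / fact (Suc m - 1)) *\<^sub>R Df (Suc m) x"
      have at: "a \<le> t" "{a..t} \<subseteq> {0..1}" using t ab by auto
      have "f t = (\<Sum>i<Suc m. ((t - a) ^ i / fact i) *\<^sub>R Df i a) + integral {a..t} ?i"
      proof (rule Taylor_integral[where p = "Suc m" and Df = Df and f = f and a = a and b = t, OF _ Df(1) _ at(1)])
        show "(Df k has_vector_derivative Df (Suc k) x) (at x within {a..t})"
          if "k < Suc m" "a \<le> x" "x \<le> t" for k x
          by (rule has_vector_derivative_within_subset[OF Df(3)[OF that(1)] at(2)]) (use that at in auto)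
      qed simp
      moreover have "poly q (of_real t) = (\<Sum>i<Suc m. ((t - a) ^ i / fact i) *\<^sub>R Df i a)"
        unfolding q_def poly_sum by (rule sum.cong) (auto simp: scaleR_conv_of_real)
      ultimately have "f t - poly q (of_real t) = integral {a..t} ?i" by simp
      also have "norm \<dots> \<le> ((b - a) ^ m * M) * (t - a)"
      proof (rule integral_bound[OF at(1)])
        show "continuous_on {a..t} ?i"
          using continuous_on_subset[OF Df(2) at(2)] by (intro continuous_intros) auto
        fix x assume x: "x \<in> {a..t}"
        have "\<bar>(t - x) ^ m / fact m\<bar> = (t - x) ^ m / fact m" using x by simp
        also have "\<dots> \<le> (b - a) ^ m / 1"
          using x t by (intro frac_le power_mono) auto
        finally have "\<bar>(t - x) ^ m / fact m\<bar> \<le> (b - a) ^ m" by simp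
        then show "norm (?i x) \<le> (b - a) ^ m * M"
          unfolding norm_scaleR using M0(2)[of x] x at ab
          by (intro mult_mono) (auto simp: M_def subset_eq)
      qed
      also have "\<dots> \<le> ((b - a) ^ m * M) * (b - a)"
        using t ab by (intro mult_left_mono) (auto simp: M_def)
      finally show ?thesis by (simp add: mult_ac)
    qed
    ultimately show "\<exists>q. degree q \<le> m \<and> norm (coeff q m) \<le> M \<and>
        (\<forall>t\<in>{a..b}. norm (f t - poly q (complex_of_real t)) \<le> M * (b - a) ^ Suc m)"
      by blast
  qed
qed

text \<open>A Taylor polynomial of degree \<open>2 r + 1\<close> at the left end of the cell is taken for \<open>q\<close> in
\<open>interp_error_nodal\<close>; its leading coefficient is the factor \<open>a\<close>.\<close>

proposition interp_error_expansion:
  assumes "C_unit (2 * r + 2) f"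
  obtains M where "M \<ge> 0" "\<And>n j. j \<in> {1..n} \<Longrightarrow> \<exists>a. norm a \<le> M \<and> (\<forall>t\<in>partition_interval n j.
    norm (f t - poly (interp_poly r n f j) (of_real t) - a * poly (nodal_poly r n j) (of_real t))
      \<le> M * (1 / real n) ^ (2 * r + 2))"
proof -
  have "C_unit (Suc (2 * r + 1)) f" using assms by simp
  then obtain M where M: "M \<ge> 0" "\<And>a b. 0 \<le> a \<Longrightarrow> a \<le> b \<Longrightarrow> b \<le> 1 \<Longrightarrow>
    \<exists>q. degree q \<le> 2 * r + 1 \<and> norm (coeff q (2 * r + 1)) \<le> M \<and>
      (\<forall>t\<in>{a..b}. norm (f t - poly q (complex_of_real t)) \<le> M * (b - a) ^ Suc (2 * r + 1))"
    using C_unit_taylor by blast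
  let ?M = "(1 + lebesgue_bound r) * M"
  show ?thesis
  proof (rule that[of ?M])
    show "0 \<le> ?M" using M(1) lebesgue_bound_nonneg[of r] by simp
    fix n j :: nat assume j: "j \<in> {1..n}"
    then have n: "n \<ge> 1" by simp
    let ?a = "(real j - 1) / real n" and ?b = "real j / real n"
    have "0 \<le> ?a" "?a \<le> ?b" "?b \<le> 1" using j by (auto simp: divide_simps)
    from M(2)[OF this] obtain q where q: "degree q \<le> 2 * r + 1" "norm (coeff q (2 * r + 1)) \<le> M"
      "\<forall>t\<in>{?a..?b}. norm (f t - poly q (complex_of_real t)) \<le> M * (?b - ?a) ^ Suc (2 * r + 1)"
      by blast
    have "?b - ?a = 1 / real n" by (simp add: diff_divide_distrib)
    then have q': "\<And>u. u \<in> partition_interval n j \<Longrightarrow>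
        norm (f u - poly q (of_real u)) \<le> M * (1 / real n) ^ (2 * r + 2)"
      using q(3) by (simp add: partition_interval_def)
    show "\<exists>a. norm a \<le> ?M \<and> (\<forall>t\<in>partition_interval n j.
        norm (f t - poly (interp_poly r n f j) (of_real t) - a * poly (nodal_poly r n j) (of_real t))
          \<le> ?M * (1 / real n) ^ (2 * r + 2))"
    proof (intro exI[of _ "coeff q (2 * r + 1)"] conjI ballI)
      have "1 * M \<le> ?M" using M(1) lebesgue_bound_nonneg[of r] by (intro mult_right_mono) auto
      then show "norm (coeff q (2 * r + 1)) \<le> ?M" using q(2) by simp
      show "norm (f t - poly (interp_poly r n f j) (of_real t)
          - coeff q (2 * r + 1) * poly (nodal_poly r n j) (of_real t)) \<le> ?M * (1 / real n) ^ (2 * r + 2)"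
        if "t \<in> partition_interval n j" for t
        using interp_error_nodal[OF n q(1) q' that] by (simp only: mult.assoc)
    qed
  qed
qed

section \<open>Consistency of the collocation operator\<close>

lemma piece_partition:
  assumes n: "n \<ge> 1" and t: "t \<in> {0..1}"
  shows "t \<in> partition_interval n (piece n t)"
proof (cases "t = 0")
  case True
  then show ?thesis by (simp add: piece_def partition_interval_def)
next
  case False
  then have "0 < real n * t" using n t by simp
  then have c: "0 < \<lceil>real n * t\<rceil>" by simp
  then have "1 \<le> nat \<lceil>real n * t\<rceil>" by linarith
  then have "piece n t = nat \<lceil>real n * t\<rceil>" by (simp add: piece_def)
  then have "real (piece n t) = of_int \<lceil>real n * t\<rceil>" using c by simp
  then have "real (piece n t) - 1 < real n * t" "real n * t \<le> real (piece n t)"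
    using ceiling_correct[of "real n * t"] by simp_all
  then show ?thesis using n by (simp add: partition_interval_def field_simps)
qed

lemma norm_interp_error_le:
  assumes n: "n \<ge> 1" and f: "continuous_on {0..1} f"
    and le: "\<And>j t. j \<in> {1..n} \<Longrightarrow> t \<in> partition_interval n j \<Longrightarrow>
      norm (f t - poly (interp_poly r n f j) (of_real t)) \<le> \<epsilon>"
  shows "norm (abs_linf f - interp r n f) \<le> \<epsilon>"
proof -
  note eb = ess_bounded_continuous[OF f] ess_bounded_interp[OF n, of r f]
  show ?thesis
    unfolding interp_def abs_linf_diff[OF eb] norm_abs_linf[OF ess_bounded_diff[OF eb]]
    by (intro ess_norm_le ess_bounded_diff eb AE_I2 le piece_in piece_partition n) auto
qed

lemma AE_rep_diff: "AE t in unit_measure. rep_linf (x - y) t = rep_linf x t - rep_linf y t"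
  using rep_abs_linf[OF ess_bounded_diff[OF ess_bounded_rep ess_bounded_rep], of x y]
  by (simp add: abs_linf_diff[OF ess_bounded_rep ess_bounded_rep, symmetric] abs_rep_linf)

lemma AE_unit_negligible:
  assumes "AE t in unit_measure. P t"
  obtains N where "negligible N" "\<And>t. t \<in> {0..1} - N \<Longrightarrow> P t"
proof -
  have "AE t in lebesgue. t \<in> {0..1} \<longrightarrow> P t"
    using assms by (subst (asm) AE_restrict_space_iff) auto
  then obtain N where "negligible N" "{t. \<not> (t \<in> {0..1} \<longrightarrow> P t)} \<subseteq> N"
    unfolding eventually_ae_filter_negligible by blast
  then show ?thesis by (intro that[of N]) auto
qed

lemma kernel_integral_eq_integral:
  assumes cont: "continuous_on ({0..1} \<times> {0..1}) \<kappa>" and s: "s \<in> {0..1}"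
  shows "(\<lambda>t. complex_of_real (\<kappa> (s, t)) * rep_linf x t) integrable_on {0..1}"
    and "kernel_integral \<kappa> x s = integral {0..1} (\<lambda>t. complex_of_real (\<kappa> (s, t)) * rep_linf x t)"
proof -
  have "integrable unit_measure (\<lambda>t. complex_of_real (\<kappa> (s, t)) * rep_linf x t)"
    by (rule integrable_ess_bounded[OF ess_bounded_mult[OF ess_bounded_section[OF cont s] ess_bounded_rep]])
  then show "(\<lambda>t. complex_of_real (\<kappa> (s, t)) * rep_linf x t) integrable_on {0..1}"
    "kernel_integral \<kappa> x s = integral {0..1} (\<lambda>t. complex_of_real (\<kappa> (s, t)) * rep_linf x t)"
    unfolding kernel_integral_def by (auto intro: integrable_on_lebesgue_on lebesgue_integral_eq_integral)
qed

text \<open>The discrete functions are known up to null sets on each cell, where they have a continuous representative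
\<open>g j\<close>; the bound for the whole interval is the sum of the bounds for the cells.\<close>

lemma norm_kernel_integral_pieces:
  assumes cont: "continuous_on ({0..1} \<times> {0..1}) \<kappa>" and s: "s \<in> {0..1}" and n: "n \<ge> 1"
    and g: "\<And>j. j \<in> {1..n} \<Longrightarrow> AE t in unit_measure. t \<in> partition_interval n j \<longrightarrow> rep_linf x t = g j t"
    and \<beta>: "\<And>j. j \<in> {1..n} \<Longrightarrow>
      norm (integral (partition_interval n j) (\<lambda>t. complex_of_real (\<kappa> (s, t)) * g j t)) \<le> \<beta>"
  shows "norm (kernel_integral \<kappa> x s) \<le> real n * \<beta>"
proof -
  let ?u = "\<lambda>t. complex_of_real (\<kappa> (s, t)) * rep_linf x t"
  note int = kernel_integral_eq_integral[OF cont s, of x]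
  have piece: "norm (integral (partition_interval n j) ?u) \<le> \<beta>" if j: "j \<in> {1..n}" for j
  proof -
    obtain N where N: "negligible N"
      "\<And>t. t \<in> {0..1} - N \<Longrightarrow> t \<in> partition_interval n j \<longrightarrow> rep_linf x t = g j t"
      using AE_unit_negligible[OF g[OF j]] by blast
    have "integral (partition_interval n j) ?u =
        integral (partition_interval n j) (\<lambda>t. complex_of_real (\<kappa> (s, t)) * g j t)"
      by (rule integral_spike[OF N(1)]) (use N(2) partition_interval_subset[OF j] in auto)
    then show ?thesis using \<beta>[OF j] by simp
  qed
  have "k \<le> n \<Longrightarrow> norm (integral {0..real k / real n} ?u) \<le> real k * \<beta>" for k
  proof (induction k)
    case (Suc k)
    have "real (Suc k) / real n \<le> 1" using Suc.prems n by simp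
    then have "integral {0..real (Suc k) / real n} ?u =
        integral {0..real k / real n} ?u + integral {real k / real n..real (Suc k) / real n} ?u"
      by (intro Henstock_Kurzweil_Integration.integral_combine[symmetric] integrable_on_subinterval[OF int(1)])
        (auto simp: divide_right_mono)
    also have "norm \<dots> \<le> real k * \<beta> + \<beta>"
      using Suc piece[of "Suc k"] by (intro norm_triangle_mono) (auto simp: partition_interval_def)
    finally show ?case by (simp add: algebra_simps)
  qed simp
  from this[of n] show ?thesis using int(2) n by simp
qed

lemma integral_op_scaleC:
  assumes "continuous_on ({0..1} \<times> {0..1}) \<kappa>"
  shows "blinfun_apply (integral_op \<kappa>) (c *\<^sub>C x) = c *\<^sub>C blinfun_apply (integral_op \<kappa>) x"
proof -
  note eb = ess_bounded_continuous[OF continuous_kernel_integral[OF assms]]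
  show ?thesis
    unfolding integral_op_apply[OF assms] abs_linf_scaleC[OF eb]
    by (intro abs_linf_eqI eb ess_bounded_cmult AE_I2) (simp add: kernel_integral_scaleC[OF assms])
qed

lemma collocation_op_scaleC:
  assumes n: "n \<ge> 1" and cont: "continuous_on ({0..1} \<times> {0..1}) \<kappa>"
  shows "blinfun_apply (collocation_op r n \<kappa>) (c *\<^sub>C x) = c *\<^sub>C blinfun_apply (collocation_op r n \<kappa>) x"
proof -
  note eb = ess_bounded_interp[OF n]
  have nd: "node r n j i \<in> {0..1}" if "j \<in> {1..n}" "i \<le> 2 * r" for i j
    using node_in_interval[OF n that(2), of j] partition_interval_subset[OF that(1)] by blast
  have "poly (interp_poly r n (kernel_integral \<kappa> (c *\<^sub>C x)) (piece n t)) (of_real t) =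
      c * poly (interp_poly r n (kernel_integral \<kappa> x) (piece n t)) (of_real t)" if "t \<in> {0..1}" for t
    unfolding interp_poly_lagrange[OF n] poly_sum sum_distrib_left
    by (rule sum.cong) (auto simp: kernel_integral_scaleC[OF cont nd[OF piece_in[OF n that]]])
  then show ?thesis
    unfolding collocation_op_apply[OF n cont] interp_def abs_linf_scaleC[OF eb]
    by (intro abs_linf_eqI eb ess_bounded_cmult AE_I2) auto
qed

lemma norm_integral_op_le:
  assumes cont: "continuous_on ({0..1} \<times> {0..1}) \<kappa>"
    and le: "\<And>s. s \<in> {0..1} \<Longrightarrow> norm (kernel_integral \<kappa> x s) \<le> C"
  shows "norm (blinfun_apply (integral_op \<kappa>) x) \<le> C"
proof -
  note eb = ess_bounded_continuous[OF continuous_kernel_integral[OF cont]]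
  show ?thesis
    unfolding integral_op_apply[OF cont] norm_abs_linf[OF eb]
    by (intro ess_norm_le eb AE_I2) (use le in auto)
qed

lemma kernel_integral_lipschitz:
  assumes cont: "continuous_on ({0..1} \<times> {0..1}) \<kappa>"
    and L: "\<And>t. t \<in> {0..1} \<Longrightarrow> \<bar>\<kappa> (s, t) - \<kappa> (s', t)\<bar> \<le> L"
    and s: "s \<in> {0..1}" "s' \<in> {0..1}"
  shows "norm (kernel_integral \<kappa> x s - kernel_integral \<kappa> x s') \<le> L * norm x"
proof -
  note eb = ess_bounded_mult[OF ess_bounded_section[OF cont] ess_bounded_rep[of x]]
  have "kernel_integral \<kappa> x s - kernel_integral \<kappa> x s' =
      (LINT t|unit_measure. complex_of_real (\<kappa> (s, t)) * rep_linf x t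
        - complex_of_real (\<kappa> (s', t)) * rep_linf x t)"
    unfolding kernel_integral_def
    using integrable_ess_bounded[OF eb[OF s(1)]] integrable_ess_bounded[OF eb[OF s(2)]] by simp
  also have "norm \<dots> \<le> L * norm x"
  proof (rule norm_integral_ess_bounded[OF ess_bounded_diff[OF eb[OF s(1)] eb[OF s(2)]]])
    have "AE t in unit_measure. t \<in> {0..1}" by (rule AE_I2) simp
    then show "AE t in unit_measure. norm (complex_of_real (\<kappa> (s, t)) * rep_linf x t
        - complex_of_real (\<kappa> (s', t)) * rep_linf x t) \<le> L * norm x"
      using AE_le_ess_norm[OF ess_bounded_rep[of x]]
    proof eventually_elim
      fix t :: real assume t: "t \<in> {0..1}" and xt: "norm (rep_linf x t) \<le> ess_norm (rep_linf x)"
      have "complex_of_real (\<kappa> (s, t)) * rep_linf x t - complex_of_real (\<kappa> (s', t)) * rep_linf x t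
          = complex_of_real (\<kappa> (s, t) - \<kappa> (s', t)) * rep_linf x t"
        by (simp add: algebra_simps)
      then have "norm (complex_of_real (\<kappa> (s, t)) * rep_linf x t - complex_of_real (\<kappa> (s', t)) * rep_linf x t)
          = \<bar>\<kappa> (s, t) - \<kappa> (s', t)\<bar> * norm (rep_linf x t)"
        by (simp only: norm_mult norm_of_real)
      also have "\<dots> \<le> L * norm x"
        using xt L[OF t] order.trans[OF abs_ge_zero L[OF t]]
        by (intro mult_mono) (auto simp: norm_linf_eq[symmetric])
      finally show "norm (complex_of_real (\<kappa> (s, t)) * rep_linf x t
          - complex_of_real (\<kappa> (s', t)) * rep_linf x t) \<le> L * norm x" .
    qed
  qed
  finally show ?thesis .
qed

proposition collocation_op_converges:
  assumes \<kappa>: "green_kernel r \<kappa>"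
  obtains C where "C \<ge> 0" "\<And>n x. n \<ge> 1 \<Longrightarrow>
    norm (blinfun_apply (integral_op \<kappa>) x - blinfun_apply (collocation_op r n \<kappa>) x) \<le> C * (1 / real n) * norm x"
proof -
  note cont = green_kernelD(1)[OF \<kappa>]
  obtain L where L: "L \<ge> 0"
    "\<And>s s' t. s \<in> {0..1} \<Longrightarrow> s' \<in> {0..1} \<Longrightarrow> t \<in> {0..1} \<Longrightarrow> \<bar>\<kappa> (s, t) - \<kappa> (s', t)\<bar> \<le> L * \<bar>s - s'\<bar>"
    using green_kernel_lipschitz[OF \<kappa>] by metis
  let ?C = "(1 + lebesgue_bound r) * L"
  show ?thesis
  proof (rule that[of ?C])
    show "0 \<le> ?C" using L(1) lebesgue_bound_nonneg[of r] by simp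
    fix n :: nat and x assume n: "n \<ge> 1"
    let ?f = "kernel_integral \<kappa> x"
    have "norm (abs_linf ?f - interp r n ?f) \<le> (1 + lebesgue_bound r) * (L * (1 / real n) * norm x)"
    proof (rule norm_interp_error_le[OF n continuous_kernel_integral[OF cont]])
      fix j t assume j: "j \<in> {1..n}" and t: "t \<in> partition_interval n j"
      let ?q = "[:?f t:]"
      have close: "norm (?f u - poly ?q (of_real u)) \<le> L * (1 / real n) * norm x"
        if u: "u \<in> partition_interval n j" for u
      proof -
        have ut: "u \<in> {0..1}" "t \<in> {0..1}" using u t partition_interval_subset[OF j] by auto
        have "\<bar>u - t\<bar> \<le> 1 / real n"
          using u t by (auto simp: partition_interval_def diff_divide_distrib)
        then have "L * \<bar>u - t\<bar> \<le> L * (1 / real n)" using L(1) by (rule mult_left_mono)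
        then have "norm (?f u - ?f t) \<le> L * (1 / real n) * norm x"
          using L(2)[OF ut] by (intro kernel_integral_lipschitz[OF cont _ ut]) (meson order.trans)
        then show ?thesis by simp
      qed
      show "norm (?f t - poly (interp_poly r n ?f j) (of_real t))
          \<le> (1 + lebesgue_bound r) * (L * (1 / real n) * norm x)"
        using interp_error_nodal[OF n, of ?q r j ?f, OF _ close t] by simp
    qed
    then show "norm (blinfun_apply (integral_op \<kappa>) x - blinfun_apply (collocation_op r n \<kappa>) x)
        \<le> ?C * (1 / real n) * norm x"
      by (simp add: integral_op_apply[OF cont] collocation_op_apply[OF n cont] mult_ac)
  qed
qed

text \<open>The interpolation error \<open>\<Delta> n\<close> of an eigenfunction is of order \<open>2 r + 1\<close>. Applying the integral operator gains
one order: up to a multiple of the nodal polynomial the error is of order \<open>2 r + 2\<close>, and the integral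
of the nodal polynomial against the kernel only sees the variation of the kernel over one cell, which is
\<open>O(1 / n)\<close> by the Lipschitz condition.\<close>

proposition collocation_op_consistency:
  assumes \<kappa>: "green_kernel r \<kappa>" and lam: "lam \<noteq> 0"
    and eig: "blinfun_apply (integral_op \<kappa>) \<psi> = lam *\<^sub>C \<psi>"
  defines "\<Delta> \<equiv> \<lambda>n. blinfun_apply (integral_op \<kappa>) \<psi> - blinfun_apply (collocation_op r n \<kappa>) \<psi>"
  obtains C where "C \<ge> 0" "\<And>n. n \<ge> 1 \<Longrightarrow> norm (\<Delta> n) \<le> C * (1 / real n) ^ (2 * r + 1)"
    "\<And>n. n \<ge> 1 \<Longrightarrow> norm (blinfun_apply (integral_op \<kappa>) (\<Delta> n)) \<le> C * (1 / real n) ^ (2 * r + 2)"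
proof -
  note cont = green_kernelD(1)[OF \<kappa>]
  define g where "g = kernel_integral \<kappa> \<psi>"
  define f where "f t = (1 / lam) * g t" for t
  have g: "continuous_on {0..1} g" unfolding g_def by (rule continuous_kernel_integral[OF cont])
  have f: "continuous_on {0..1} f" unfolding f_def by (intro continuous_intros g)
  have "\<psi> = (1 / lam) *\<^sub>C (lam *\<^sub>C \<psi>)" using lam by simp
  also have "\<dots> = abs_linf f"
    unfolding eig[symmetric] integral_op_apply[OF cont] g_def[symmetric] f_def[abs_def]
    by (rule abs_linf_scaleC[OF ess_bounded_continuous[OF g]])
  finally have "AE t in unit_measure. rep_linf \<psi> t = f t"
    using rep_abs_linf[OF ess_bounded_continuous[OF f]] by simp
  then obtain N where N: "negligible N" "\<And>t. t \<in> {0..1} - N \<Longrightarrow> rep_linf \<psi> t = f t"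
    using AE_unit_negligible by blast
  have "C_unit (2 * r + 2) f"
  proof (rule green_kernel_eigenfunction_smooth[OF \<kappa> f lam])
    fix s :: real assume s: "s \<in> {0..1}"
    have "lam * f s = g s" using lam by (simp add: f_def)
    also have "\<dots> = integral {0..1} (\<lambda>t. complex_of_real (\<kappa> (s, t)) * rep_linf \<psi> t)"
      unfolding g_def by (rule kernel_integral_eq_integral(2)[OF cont s])
    also have "\<dots> = integral {0..1} (\<lambda>t. complex_of_real (\<kappa> (s, t)) * f t)"
      by (rule integral_spike[OF N(1)]) (use N(2) in auto)
    finally show "lam * f s = integral {0..1} (\<lambda>t. complex_of_real (\<kappa> (s, t)) * f t)" .
  qed
  then have "C_unit (2 * r + 2) (\<lambda>t. lam * f t)" by (intro C_unit_mult C_unit_const)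
  then have "C_unit (2 * r + 2) g" by (rule C_unit_cong) (use lam in \<open>simp add: f_def\<close>)
  then obtain M where M: "M \<ge> 0" "\<And>n j. j \<in> {1..n} \<Longrightarrow> \<exists>a. norm a \<le> M \<and> (\<forall>t\<in>partition_interval n j.
      norm (g t - poly (interp_poly r n g j) (of_real t) - a * poly (nodal_poly r n j) (of_real t))
        \<le> M * (1 / real n) ^ (2 * r + 2))"
    using interp_error_expansion by blast
  obtain L where L: "L \<ge> 0"
    "\<And>s t t'. s \<in> {0..1} \<Longrightarrow> t \<in> {0..1} \<Longrightarrow> t' \<in> {0..1} \<Longrightarrow> \<bar>\<kappa> (s, t) - \<kappa> (s, t')\<bar> \<le> L * \<bar>t - t'\<bar>"
    using green_kernel_lipschitz[OF \<kappa>] by metis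
  have "bounded (\<kappa> ` ({0..1} \<times> {0..1}))"
    using cont by (intro compact_imp_bounded compact_continuous_image compact_Times) auto
  then obtain B0 where "\<And>p. p \<in> {0..1} \<times> {0..1} \<Longrightarrow> norm (\<kappa> p) \<le> B0" unfolding bounded_iff by blast
  then have B: "\<bar>\<kappa> (s, t)\<bar> \<le> \<bar>B0\<bar>" if "s \<in> {0..1}" "t \<in> {0..1}" for s t using that by fastforce
  let ?C = "2 * M + (\<bar>B0\<bar> + L) * M"
  have \<Delta>: "\<Delta> n = abs_linf g - interp r n g" if "n \<ge> 1" for n
    by (simp add: \<Delta>_def g_def integral_op_apply[OF cont] collocation_op_apply[OF that cont])
  show ?thesis
  proof (rule that[of ?C])
    show "0 \<le> ?C" using M(1) L(1) by simp
    fix n :: nat assume n: "n \<ge> 1"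
    define h where "h = 1 / real n"
    have h: "0 \<le> h" "h \<le> 1" "real n * h = 1" using n by (simp_all add: h_def)
    have "norm (\<Delta> n) \<le> 2 * M * h ^ (2 * r + 1)"
      unfolding \<Delta>[OF n]
    proof (rule norm_interp_error_le[OF n g])
      fix j t assume j: "j \<in> {1..n}" and t: "t \<in> partition_interval n j"
      obtain a where a: "norm a \<le> M" "norm (g t - poly (interp_poly r n g j) (of_real t)
          - a * poly (nodal_poly r n j) (of_real t)) \<le> M * h ^ (2 * r + 2)"
        using M(2)[OF j] t unfolding h_def by blast
      have "norm (a * poly (nodal_poly r n j) (of_real t)) \<le> M * h ^ (2 * r + 1)"
        unfolding norm_mult using a(1) norm_nodal_poly_le[OF n t] M(1)
        by (intro mult_mono) (simp_all add: h_def)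
      moreover have "M * h ^ (2 * r + 2) \<le> M * h ^ (2 * r + 1)"
        using M(1) h by (intro mult_left_mono power_decreasing) auto
      ultimately show "norm (g t - poly (interp_poly r n g j) (of_real t)) \<le> 2 * M * h ^ (2 * r + 1)"
        using a(2) norm_triangle_sub[of "g t - poly (interp_poly r n g j) (of_real t)"
            "a * poly (nodal_poly r n j) (of_real t)"] by linarith
    qed
    also have "\<dots> \<le> ?C * h ^ (2 * r + 1)"
      using M(1) L(1) h by (intro mult_right_mono) auto
    finally show "norm (\<Delta> n) \<le> ?C * (1 / real n) ^ (2 * r + 1)" by (simp add: h_def)
    have rep: "AE t in unit_measure. t \<in> partition_interval n j \<longrightarrow>
        rep_linf (\<Delta> n) t = g t - poly (interp_poly r n g j) (of_real t)" if j: "j \<in> {1..n}" for j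
      using AE_rep_diff[of "abs_linf g" "interp r n g"] rep_abs_linf[OF ess_bounded_continuous[OF g]]
        interp_on_interval[OF j, of r g]
      unfolding \<Delta>[OF n] by eventually_elim simp
    have pieces: "norm (kernel_integral \<kappa> (\<Delta> n) s) \<le> real n * ((\<bar>B0\<bar> + L) * M * h ^ (2 * r + 2) * h)"
      if s: "s \<in> {0..1}" for s
    proof (rule norm_kernel_integral_pieces[OF cont s n rep])
      fix j assume j: "j \<in> {1..n}"
      let ?a = "(real j - 1) / real n" and ?b = "real j / real n"
      have ab: "?a \<le> ?b" "?b - ?a = h" by (simp_all add: h_def divide_right_mono diff_divide_distrib)
      have I: "partition_interval n j = {?a..?b}" by (simp add: partition_interval_def)
      have sub: "{?a..?b} \<subseteq> {0..1}" using partition_interval_subset[OF j] by (simp add: I)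
      have a01: "?a \<in> {0..1}" using sub ab(1) by auto
      obtain a where a: "norm a \<le> M" "\<And>t. t \<in> {?a..?b} \<Longrightarrow> norm (g t - poly (interp_poly r n g j) (of_real t)
          - a * poly (nodal_poly r n j) (of_real t)) \<le> M * h ^ (2 * r + 2)"
        using M(2)[OF j] unfolding h_def I by blast
      let ?e = "\<lambda>t. g t - poly (interp_poly r n g j) (complex_of_real t)"
      let ?w = "\<lambda>t. poly (nodal_poly r n j) (complex_of_real t)"
      let ?k = "\<lambda>t. complex_of_real (\<kappa> (s, t))"
      have contk: "continuous_on {?a..?b} ?k"
        using continuous_on_section[of "{0..1}" "{0..1}" "\<lambda>s t. \<kappa> (s, t)" s] cont s
        by (intro continuous_intros continuous_on_subset[OF _ sub]) simp_all
      have conte: "continuous_on {?a..?b} ?e"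
        by (intro continuous_intros continuous_on_subset[OF g sub])
      have contw: "continuous_on {?a..?b} ?w" by (intro continuous_intros)
      \<comment> \<open>freezing the kernel at the left end of the cell costs nothing, as the nodal polynomial has mean zero\<close>
      have split: "integral {?a..?b} (\<lambda>t. ?k t * ?e t)
          = integral {?a..?b} (\<lambda>t. ?k t * ?e t - ?k ?a * a * ?w t)"
      proof -
        have "integral {?a..?b} (\<lambda>t. ?k t * ?e t - ?k ?a * a * ?w t)
            = integral {?a..?b} (\<lambda>t. ?k t * ?e t) - integral {?a..?b} (\<lambda>t. ?k ?a * a * ?w t)"
          by (intro integral_diff integrable_continuous_real continuous_intros contk conte contw)
        also have "integral {?a..?b} (\<lambda>t. ?k ?a * a * ?w t) = 0"
          using integral_nodal_poly[OF n, of j r] by (simp add: I)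
        finally show ?thesis by simp
      qed
      have "norm (integral {?a..?b} (\<lambda>t. ?k t * ?e t - ?k ?a * a * ?w t))
          \<le> ((\<bar>B0\<bar> + L) * M * h ^ (2 * r + 2)) * (?b - ?a)"
      proof (rule integral_bound[OF ab(1)])
        show "continuous_on {?a..?b} (\<lambda>t. ?k t * ?e t - ?k ?a * a * ?w t)"
          by (intro continuous_intros contk conte contw)
        fix t assume t: "t \<in> {?a..?b}"
        then have t01: "t \<in> {0..1}" using sub by blast
        have "\<bar>t - ?a\<bar> \<le> h" using t ab(2) by auto
        then have "L * \<bar>t - ?a\<bar> \<le> L * h" using L(1) by (rule mult_left_mono)
        then have \<kappa>: "norm (?k t - ?k ?a) \<le> L * h"
          using L(2)[OF s t01 a01] by (simp only: of_real_diff[symmetric] norm_of_real)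
        have w: "norm (?w t) \<le> h ^ (2 * r + 1)"
          using norm_nodal_poly_le[OF n, of t j r] t by (simp add: I h_def)
        have "?k t * ?e t - ?k ?a * a * ?w t = ?k t * (?e t - a * ?w t) + (?k t - ?k ?a) * (a * ?w t)"
          by (simp add: algebra_simps)
        also have "norm \<dots> \<le> \<bar>B0\<bar> * (M * h ^ (2 * r + 2)) + (L * h) * (M * h ^ (2 * r + 1))"
          unfolding norm_mult[symmetric]
        proof (rule norm_triangle_mono)
          show "norm (?k t * (?e t - a * ?w t)) \<le> \<bar>B0\<bar> * (M * h ^ (2 * r + 2))"
            unfolding norm_mult using B[OF s t01] a(2)[OF t] by (intro mult_mono) auto
          show "norm ((?k t - ?k ?a) * (a * ?w t)) \<le> (L * h) * (M * h ^ (2 * r + 1))"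
            unfolding norm_mult using \<kappa> a(1) w M(1) L(1) h by (intro mult_mono) auto
        qed
        also have "\<dots> = (\<bar>B0\<bar> + L) * M * h ^ (2 * r + 2)" by (simp add: algebra_simps)
        finally show "norm (?k t * ?e t - ?k ?a * a * ?w t) \<le> (\<bar>B0\<bar> + L) * M * h ^ (2 * r + 2)" .
      qed
      then show "norm (integral (partition_interval n j) (\<lambda>t. ?k t * ?e t))
          \<le> (\<bar>B0\<bar> + L) * M * h ^ (2 * r + 2) * h"
        unfolding I split ab(2) .
    qed
    have "real n * (c * h) = c" for c using h(3) by (simp only: mult.left_commute mult_1_right)
    then have "norm (blinfun_apply (integral_op \<kappa>) (\<Delta> n)) \<le> (\<bar>B0\<bar> + L) * M * h ^ (2 * r + 2)"
      using pieces by (intro norm_integral_op_le[OF cont]) (simp only:)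
    also have "\<dots> \<le> ?C * h ^ (2 * r + 2)"
      using M(1) L(1) h by (intro mult_right_mono) auto
    finally show "norm (blinfun_apply (integral_op \<kappa>) (\<Delta> n)) \<le> ?C * (1 / real n) ^ (2 * r + 2)"
      by (simp add: h_def)
  qed
qed

section \<open>Convergence of the eigenelements\<close>

lemma dim_one_span:
  assumes dim: "linf.dim V = 1" and \<psi>: "\<psi> \<in> V" "\<psi> \<noteq> 0" and x: "x \<in> V"
  obtains c where "x = c *\<^sub>C \<psi>"
proof -
  obtain B where B: "V \<subseteq> linf.span B" "card B = linf.dim V"
    using linf.basis_exists[of V] by blast
  then obtain b where "B = {b}" using dim card_1_singletonE by metis
  then have V: "V \<subseteq> range (\<lambda>k. k *\<^sub>C b)" using B(1) by (simp add: linf.span_singleton)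
  then obtain k c where k: "\<psi> = k *\<^sub>C b" and c: "x = c *\<^sub>C b" using \<psi>(1) x by blast
  have "k \<noteq> 0" using \<psi>(2) k by auto
  then have "x = (c / k) *\<^sub>C \<psi>" by (simp add: k c)
  then show ?thesis by (rule that)
qed

text \<open>An eigenvector \<open>\<psi>\<close> of \<open>K\<close>, the spectral projection \<open>E\<close> of rank one, and the reduced resolvents \<open>S \<mu>\<close> for \<open>\<mu>\<close>
close to the eigenvalue. That \<open>E\<close> fixes \<open>\<psi>\<close>, commutes with \<open>K\<close> and is complex linear is derived from the
two resolvent identities, which avoids going back to the curve integral.\<close>

locale simple_eigenvalue =
  fixes K E :: linf_op and lam :: complex and \<psi> :: linf and \<delta> C :: real and S :: "complex \<Rightarrow> linf_op"
  assumes lin: "\<And>c x. blinfun_apply K (c *\<^sub>C x) = c *\<^sub>C blinfun_apply K x"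
    and lam: "lam \<noteq> 0" and psi: "\<psi> \<noteq> 0" "blinfun_apply K \<psi> = lam *\<^sub>C \<psi>"
    and dim: "linf.dim (range (blinfun_apply E)) = 1"
    and \<delta>: "\<delta> > 0"
    and S1: "\<And>\<mu>. norm (\<mu> - lam) < \<delta> \<Longrightarrow> S \<mu> o\<^sub>L (K - scaleC_op \<mu> id_blinfun) = id_blinfun - E"
    and S2: "\<And>\<mu>. norm (\<mu> - lam) < \<delta> \<Longrightarrow> (K - scaleC_op \<mu> id_blinfun) o\<^sub>L S \<mu> = id_blinfun - E"
    and norm_S: "\<And>\<mu>. norm (\<mu> - lam) < \<delta> \<Longrightarrow> norm (S \<mu>) \<le> C"
begin

lemma residual:
  assumes "norm (\<mu> - lam) < \<delta>"
  shows "x - blinfun_apply E x = blinfun_apply (S \<mu>) (blinfun_apply K x - \<mu> *\<^sub>C x)"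
proof -
  have "blinfun_apply (S \<mu> o\<^sub>L (K - scaleC_op \<mu> id_blinfun)) x = blinfun_apply (id_blinfun - E) x"
    by (simp only: S1[OF assms])
  then show ?thesis by (simp add: blinfun.diff_left scaleC_op_apply)
qed

lemma norm_residual_le:
  assumes "norm (\<mu> - lam) < \<delta>"
  shows "norm (x - blinfun_apply E x) \<le> C * norm (blinfun_apply K x - \<mu> *\<^sub>C x)"
  unfolding residual[OF assms]
  by (rule order.trans[OF norm_blinfun mult_right_mono[OF norm_S[OF assms]]]) simp

lemma E_psi: "blinfun_apply E \<psi> = \<psi>"
  using residual[of lam \<psi>] \<delta> by (simp add: psi blinfun.zero_right)

lemma E_in_span:
  obtains c where "blinfun_apply E x = c *\<^sub>C \<psi>"
proof -
  have "\<psi> \<in> range (blinfun_apply E)" using E_psi by (metis rangeI)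
  then show ?thesis using dim_one_span[OF dim _ psi(1) rangeI] that by blast
qed

lemma K_E: "blinfun_apply K (blinfun_apply E x) = lam *\<^sub>C blinfun_apply E x"
proof -
  obtain c where c: "blinfun_apply E x = c *\<^sub>C \<psi>" by (rule E_in_span)
  show ?thesis unfolding c by (simp add: lin psi(2) mult.commute)
qed

text \<open>The two factorisations of \<open>1 - E\<close> show that \<open>E\<close> commutes with \<open>K - \<mu>\<close>.\<close>

lemma E_shift:
  assumes "norm (\<mu> - lam) < \<delta>"
  shows "blinfun_apply E (blinfun_apply K x - \<mu> *\<^sub>C x) = (lam - \<mu>) *\<^sub>C blinfun_apply E x"
proof -
  let ?A = "K - scaleC_op \<mu> id_blinfun"
  have A: "blinfun_apply ?A y = blinfun_apply K y - \<mu> *\<^sub>C y" for y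
    by (simp add: blinfun.diff_left scaleC_op_apply)
  have "blinfun_apply (?A o\<^sub>L S \<mu>) (blinfun_apply ?A x) = blinfun_apply (id_blinfun - E) (blinfun_apply ?A x)"
    by (simp only: S2[OF assms])
  then have "blinfun_apply E (blinfun_apply ?A x)
      = blinfun_apply ?A x - blinfun_apply ?A (blinfun_apply (S \<mu>) (blinfun_apply ?A x))"
    by (simp add: blinfun.diff_left[of id_blinfun E])
  also have "\<dots> = blinfun_apply ?A (x - blinfun_apply (S \<mu>) (blinfun_apply ?A x))"
    by (rule blinfun.diff_right[symmetric])
  also have "x - blinfun_apply (S \<mu>) (blinfun_apply ?A x) = blinfun_apply E x"
    unfolding A residual[OF assms, symmetric] by simp
  finally have "blinfun_apply E (blinfun_apply ?A x) = blinfun_apply ?A (blinfun_apply E x)" .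
  then show ?thesis by (simp add: A K_E linf.scale_left_diff_distrib)
qed

text \<open>Comparing \<open>E_shift\<close> for \<open>\<mu> = lam\<close> and \<open>\<mu> = lam - d\<close> gives homogeneity for small complex factors \<open>d\<close>; real
homogeneity extends it to all factors.\<close>

lemma E_scaleC: "blinfun_apply E (c *\<^sub>C x) = c *\<^sub>C blinfun_apply E x"
proof -
  have small: "blinfun_apply E (d *\<^sub>C x) = d *\<^sub>C blinfun_apply E x" if "norm d < \<delta>" for d
  proof -
    have "blinfun_apply E (blinfun_apply K x - lam *\<^sub>C x) = 0"
      using E_shift[of lam x] \<delta> by simp
    moreover have "blinfun_apply E (blinfun_apply K x - (lam - d) *\<^sub>C x) = d *\<^sub>C blinfun_apply E x"
      using E_shift[of "lam - d" x] that by simp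
    moreover have "blinfun_apply K x - (lam - d) *\<^sub>C x = (blinfun_apply K x - lam *\<^sub>C x) + d *\<^sub>C x"
      by (simp add: linf.scale_left_diff_distrib)
    ultimately show ?thesis by (simp add: blinfun.add_right)
  qed
  define \<rho> where "\<rho> = \<delta> / 2 / (norm c + 1)"
  have c: "norm c + 1 > 0" by (simp add: add_nonneg_pos)
  then have nz: "norm c + 1 \<noteq> 0" by linarith
  have \<rho>: "\<rho> > 0" "\<rho> * norm c < \<delta>"
  proof -
    show "\<rho> > 0" using \<delta> c by (simp add: \<rho>_def)
    then have "\<rho> * norm c \<le> \<rho> * (norm c + 1)" by (intro mult_left_mono) auto
    also have "\<dots> = \<delta> / 2"
      by (simp only: \<rho>_def divide_inverse mult.assoc left_inverse[OF nz] mult_1_right)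
    finally show "\<rho> * norm c < \<delta>" using \<delta> by simp
  qed
  have "\<rho> *\<^sub>R blinfun_apply E (c *\<^sub>C x) = blinfun_apply E ((\<rho> * c) *\<^sub>C x)"
    by (simp only: blinfun.scaleR_right[symmetric]) (simp add: scaleR_scaleC_linf)
  also have "\<dots> = (\<rho> * c) *\<^sub>C blinfun_apply E x"
    using \<rho> by (intro small) (simp add: norm_mult)
  also have "\<dots> = \<rho> *\<^sub>R (c *\<^sub>C blinfun_apply E x)" by (simp add: scaleR_scaleC_linf)
  finally show ?thesis using \<rho>(1) by simp
qed

lemma E_K: "blinfun_apply E (blinfun_apply K x) = lam *\<^sub>C blinfun_apply E x"
  using E_shift[of lam x] \<delta> by (simp add: blinfun.diff_right E_scaleC)

lemma norm_apply_E_le: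
  fixes A :: "linf \<Rightarrow> linf"
  assumes A: "\<And>c x. A (c *\<^sub>C x) = c *\<^sub>C A x" and "norm (A \<psi>) \<le> \<epsilon>"
  shows "norm (A (blinfun_apply E x)) \<le> norm E * norm x / norm \<psi> * \<epsilon>"
proof -
  obtain c where c: "blinfun_apply E x = c *\<^sub>C \<psi>" by (rule E_in_span)
  have "norm c * norm \<psi> \<le> norm E * norm x"
    using norm_blinfun[of E x] by (simp add: c norm_scaleC_linf)
  then have "norm c \<le> norm E * norm x / norm \<psi>" using psi(1) by (simp add: pos_le_divide_eq)
  then show ?thesis
    unfolding c A norm_scaleC_linf using assms(2) by (intro mult_mono) auto
qed

text \<open>The residual \<open>(K - \<mu>) x\<close> of a discrete eigenvector is \<open>A x\<close> with \<open>A = K - T\<close>. The first estimate bounds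
\<open>x - E x\<close> by \<open>C\<close> times \<open>A (E x) + A (x - E x)\<close> and absorbs the last term by the smallness of \<open>C * C1 * h\<close>. The
other two use that applying \<open>K\<close> to the residual gains a factor \<open>h\<close>: on \<open>E x\<close> by the second bound with
\<open>C2\<close>, on \<open>x - E x\<close> because \<open>A\<close> itself is of order \<open>h\<close>.\<close>

proposition eigenelement_errors:
  assumes \<mu>: "norm (\<mu> - lam) < \<delta>" "norm lam / 2 \<le> norm \<mu>"
    and T: "blinfun_apply T x = \<mu> *\<^sub>C x" "norm x = 1"
      "\<And>c x. blinfun_apply T (c *\<^sub>C x) = c *\<^sub>C blinfun_apply T x"
    and C1: "\<And>y. norm (blinfun_apply K y - blinfun_apply T y) \<le> C1 * h * norm y"
    and C2: "norm (blinfun_apply K \<psi> - blinfun_apply T \<psi>) \<le> C2 * h ^ m"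
      "norm (blinfun_apply K (blinfun_apply K \<psi> - blinfun_apply T \<psi>)) \<le> C2 * h ^ Suc m"
    and h: "0 \<le> h" "C * (C1 * h) \<le> 1 / 2"
  defines "D \<equiv> norm E / norm \<psi> * C2"
  defines "D' \<equiv> D + norm K * C1 * (2 * C * D)"
  defines "y \<equiv> (1 / \<mu>) *\<^sub>C blinfun_apply K x"
  shows "norm (x - blinfun_apply E x) \<le> 2 * C * D * h ^ m"
    and "norm (y - blinfun_apply E y) \<le> 2 * C * D' / norm lam * h ^ Suc m"
    and "2 * C * D * h ^ m \<le> 1 / 2 \<Longrightarrow> norm (lam - \<mu>) \<le> 2 * norm E * D' / norm lam * h ^ Suc m"
proof -
  define A where "A z = blinfun_apply K z - blinfun_apply T z" for z
  have C: "0 \<le> C" by (rule order.trans[OF norm_ge_zero norm_S[OF \<mu>(1)]])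
  have Alin: "A (c *\<^sub>C z) = c *\<^sub>C A z" for c z by (simp add: A_def lin T(3) linf.scale_right_diff_distrib)
  have Ax: "blinfun_apply K x - \<mu> *\<^sub>C x = A x" by (simp add: A_def T(1))
  let ?Ex = "blinfun_apply E x"
  have split: "A x = A ?Ex + A (x - ?Ex)" by (simp add: A_def blinfun.diff_right)
  have AE: "norm (A ?Ex) \<le> D * h ^ m"
    using norm_apply_E_le[of A "C2 * h ^ m" x] Alin C2(1) T(2) by (simp add: A_def D_def mult_ac)
  have KAE: "norm (blinfun_apply K (A ?Ex)) \<le> D * h ^ Suc m"
    using norm_apply_E_le[of "\<lambda>z. blinfun_apply K (A z)" "C2 * h ^ Suc m" x] Alin C2(2) T(2) lin
    by (simp add: A_def D_def mult_ac)
  have "norm (x - ?Ex) \<le> C * norm (A x)" using norm_residual_le[OF \<mu>(1), of x] by (simp only: Ax)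
  also have "\<dots> \<le> C * (D * h ^ m + C1 * h * norm (x - ?Ex))"
    unfolding split by (intro mult_left_mono C norm_triangle_mono AE) (simp add: A_def C1)
  also have "\<dots> = C * (D * h ^ m) + C * (C1 * h) * norm (x - ?Ex)" by (simp add: algebra_simps)
  also have "\<dots> \<le> C * (D * h ^ m) + 1 / 2 * norm (x - ?Ex)"
    by (intro add_left_mono mult_right_mono h(2)) simp
  finally show first: "norm (x - ?Ex) \<le> 2 * C * D * h ^ m" by simp
  have C1': "0 \<le> C1 * h" using C1[of \<psi>] norm_ge_zero order.trans psi(1)
    by (metis zero_le_mult_iff zero_less_norm_iff not_less)
  have KA: "norm (blinfun_apply K (A x)) \<le> D' * h ^ Suc m"
  proof -
    have "norm (A (x - ?Ex)) \<le> (C1 * h) * (2 * C * D * h ^ m)"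
      by (rule order.trans[OF C1[folded A_def] mult_left_mono[OF first C1']])
    then have "norm (blinfun_apply K (A (x - ?Ex))) \<le> norm K * ((C1 * h) * (2 * C * D * h ^ m))"
      by (rule order.trans[OF norm_blinfun mult_left_mono]) simp
    then have "norm (blinfun_apply K (A x)) \<le> D * h ^ Suc m + norm K * ((C1 * h) * (2 * C * D * h ^ m))"
      unfolding split blinfun.add_right by (intro norm_triangle_mono KAE)
    also have "\<dots> = D' * h ^ Suc m" by (simp add: D'_def algebra_simps)
    finally show ?thesis .
  qed
  have \<mu>0: "\<mu> \<noteq> 0" using \<mu>(2) lam by auto
  have "blinfun_apply K y - \<mu> *\<^sub>C y = (1 / \<mu>) *\<^sub>C blinfun_apply K (A x)"
    unfolding Ax[symmetric] y_def using \<mu>0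
    by (simp add: lin blinfun.diff_right linf.scale_right_diff_distrib)
  then have "norm (y - blinfun_apply E y) \<le> C * (1 / norm \<mu> * norm (blinfun_apply K (A x)))"
    using norm_residual_le[OF \<mu>(1), of y] by (simp add: norm_scaleC_linf norm_divide)
  also have "\<dots> \<le> C * (2 / norm lam * (D' * h ^ Suc m))"
  proof (intro mult_left_mono mult_mono KA C)
    show "1 / norm \<mu> \<le> 2 / norm lam" using \<mu>(2) lam \<mu>0 by (simp add: field_simps)
  qed auto
  finally show "norm (y - blinfun_apply E y) \<le> 2 * C * D' / norm lam * h ^ Suc m" by (simp add: mult_ac)
  assume "2 * C * D * h ^ m \<le> 1 / 2"
  then have half: "1 / 2 \<le> norm ?Ex" using first norm_triangle_sub[of x ?Ex] T(2) by simp
  have "lam *\<^sub>C (lam - \<mu>) *\<^sub>C ?Ex = blinfun_apply E (blinfun_apply K (A x))"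
    unfolding E_K Ax[symmetric] E_shift[OF \<mu>(1)] ..
  then have "norm lam * (norm (lam - \<mu>) * norm ?Ex) = norm (blinfun_apply E (blinfun_apply K (A x)))"
    by (metis norm_scaleC_linf)
  also have "\<dots> \<le> norm E * (D' * h ^ Suc m)"
    by (rule order.trans[OF norm_blinfun mult_left_mono[OF KA]]) simp
  finally have "norm lam * (norm (lam - \<mu>) * norm ?Ex) \<le> norm E * (D' * h ^ Suc m)" .
  moreover have "norm lam * (norm (lam - \<mu>) * (1 / 2)) \<le> norm lam * (norm (lam - \<mu>) * norm ?Ex)"
    by (intro mult_left_mono half) auto
  ultimately have "norm lam * (norm (lam - \<mu>) * (1 / 2)) \<le> norm E * (D' * h ^ Suc m)"
    by (rule order.trans[rotated])
  then have "norm (lam - \<mu>) * norm lam \<le> 2 * norm E * D' * h ^ Suc m"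
    by (simp add: mult_ac)
  then have "norm (lam - \<mu>) \<le> 2 * norm E * D' * h ^ Suc m / norm lam"
    using lam by (simp add: pos_le_divide_eq)
  then show "norm (lam - \<mu>) \<le> 2 * norm E * D' / norm lam * h ^ Suc m" by simp
qed

end

text \<open>For large \<open>n\<close> the discrete eigenvalue lies where the reduced resolvents are bounded, and \<open>h\<close> is small
enough both to absorb the error term and to keep \<open>E \<phi>\<^sub>n\<close> at norm at least \<open>1 / 2\<close>.\<close>

theorem theorem4p9:
  fixes r :: nat
    and \<kappa> :: "real \<times> real \<Rightarrow> real"
    and lam :: complex
    and \<Gamma> :: "real \<Rightarrow> complex"
    and lamC :: "nat \<Rightarrow> complex"
    and \<phi> \<phi>S :: "nat \<Rightarrow> linf"
  assumes kernel: "green_kernel r \<kappa>"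
    and eigen: "eigenvalue (integral_op \<kappa>) lam" "lam \<noteq> 0"
    and curve: "separating_curve (integral_op \<kappa>) lam \<Gamma>"
    and simple: "linf.dim (range (blinfun_apply (spectral_projection \<Gamma> (integral_op \<kappa>)))) = 1"
    and eigen_C: "\<forall>\<^sub>F n in sequentially. eigenvalue (collocation_op r n \<kappa>) (lamC n)"
    and conv_C: "lamC \<longlonglongrightarrow> lam"
    and eigenvector: "\<forall>\<^sub>F n in sequentially.
      \<phi> n \<in> range (blinfun_apply (spectral_projection \<Gamma> (collocation_op r n \<kappa>))) \<and>
      norm (\<phi> n) = 1 \<and>
      blinfun_apply (collocation_op r n \<kappa>) (\<phi> n) = lamC n *\<^sub>C \<phi> n"
    and iterated: "\<And>n. \<phi>S n = (1 / lamC n) *\<^sub>C blinfun_apply (integral_op \<kappa>) (\<phi> n)"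
  shows "(\<lambda>n. norm (\<phi> n - blinfun_apply (spectral_projection \<Gamma> (integral_op \<kappa>)) (\<phi> n)))
           \<in> O(\<lambda>n. (1 / real n) ^ (2 * r + 1)) \<and>
         (\<lambda>n. norm (\<phi>S n - blinfun_apply (spectral_projection \<Gamma> (integral_op \<kappa>)) (\<phi>S n)))
           \<in> O(\<lambda>n. (1 / real n) ^ (2 * r + 2)) \<and>
         (\<lambda>n. norm (lam - lamC n)) \<in> O(\<lambda>n. (1 / real n) ^ (2 * r + 2))"
proof -
  note cont = green_kernelD(1)[OF kernel]
  let ?K = "integral_op \<kappa>" and ?E = "spectral_projection \<Gamma> (integral_op \<kappa>)"
  obtain \<psi> where \<psi>: "\<psi> \<noteq> 0" "blinfun_apply ?K \<psi> = lam *\<^sub>C \<psi>"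
    using eigen(1) unfolding eigenvalue_def by blast
  obtain \<delta> C S where \<delta>: "\<delta> > 0"
    and S: "\<And>\<mu>. norm (\<mu> - lam) < \<delta> \<Longrightarrow> S \<mu> o\<^sub>L (?K - scaleC_op \<mu> id_blinfun) = id_blinfun - ?E"
      "\<And>\<mu>. norm (\<mu> - lam) < \<delta> \<Longrightarrow> (?K - scaleC_op \<mu> id_blinfun) o\<^sub>L S \<mu> = id_blinfun - ?E"
      "\<And>\<mu>. norm (\<mu> - lam) < \<delta> \<Longrightarrow> norm (S \<mu>) \<le> C"
    using reduced_resolvent[OF curve integral_op_scaleC[OF cont]] by metis
  interpret simple_eigenvalue ?K ?E lam \<psi> \<delta> C S
    by unfold_locales (use integral_op_scaleC[OF cont] eigen(2) \<psi> simple \<delta> S in auto)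
  obtain C1 where C1: "C1 \<ge> 0" "\<And>n x. n \<ge> 1 \<Longrightarrow> norm (blinfun_apply ?K x
      - blinfun_apply (collocation_op r n \<kappa>) x) \<le> C1 * (1 / real n) * norm x"
    using collocation_op_converges[OF kernel] by metis
  obtain C2 where C2: "C2 \<ge> 0" "\<And>n. n \<ge> 1 \<Longrightarrow> norm (blinfun_apply ?K \<psi>
      - blinfun_apply (collocation_op r n \<kappa>) \<psi>) \<le> C2 * (1 / real n) ^ (2 * r + 1)"
    "\<And>n. n \<ge> 1 \<Longrightarrow> norm (blinfun_apply ?K (blinfun_apply ?K \<psi>
      - blinfun_apply (collocation_op r n \<kappa>) \<psi>)) \<le> C2 * (1 / real n) ^ (2 * r + 2)"
    using collocation_op_consistency[OF kernel eigen(2) \<psi>(2)] by metis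
  define D where "D = norm ?E / norm \<psi> * C2"
  define D' where "D' = D + norm ?K * C1 * (2 * C * D)"
  have near: "\<forall>\<^sub>F n in sequentially. norm (lamC n - lam) < min \<delta> (norm lam / 2)"
    using tendstoD[OF conv_C, of "min \<delta> (norm lam / 2)"] \<delta> eigen(2) by (simp add: dist_norm)
  have small: "\<forall>\<^sub>F n in sequentially. c * (1 / real n) ^ Suc k \<le> 1 / 2" for c k
  proof -
    have "(\<lambda>n. c * (1 / real n) ^ Suc k) \<longlonglongrightarrow> c * 0 ^ Suc k"
      by (intro tendsto_intros lim_1_over_n)
    then have "\<forall>\<^sub>F n in sequentially. c * (1 / real n) ^ Suc k < 1 / 2"
      by (rule order_tendstoD) simp
    then show ?thesis by (rule eventually_mono) simp
  qed
  have errors: "\<forall>\<^sub>F n in sequentially.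
      norm (\<phi> n - blinfun_apply ?E (\<phi> n)) \<le> 2 * C * D * (1 / real n) ^ (2 * r + 1) \<and>
      norm (\<phi>S n - blinfun_apply ?E (\<phi>S n)) \<le> 2 * C * D' / norm lam * (1 / real n) ^ (2 * r + 2) \<and>
      norm (lam - lamC n) \<le> 2 * norm ?E * D' / norm lam * (1 / real n) ^ (2 * r + 2)"
    using near eigenvector eventually_ge_at_top[of 1] small[of "C * C1" 0] small[of "2 * C * D" "2 * r"]
  proof eventually_elim
    case (elim n)
    have "norm lam \<le> norm (lamC n) + norm (lamC n - lam)"
      using norm_triangle_sub[of lam "lamC n"] by (simp add: norm_minus_commute)
    then have \<mu>: "norm (lamC n - lam) < \<delta>" "norm lam / 2 \<le> norm (lamC n)" using elim(1) by auto
    have T: "blinfun_apply (collocation_op r n \<kappa>) (\<phi> n) = lamC n *\<^sub>C \<phi> n" "norm (\<phi> n) = 1"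
      using elim(2) by auto
    have bounds: "norm (blinfun_apply ?K \<psi> - blinfun_apply (collocation_op r n \<kappa>) \<psi>) \<le> C2 * (1 / real n) ^ (2 * r + 1)"
      "norm (blinfun_apply ?K (blinfun_apply ?K \<psi> - blinfun_apply (collocation_op r n \<kappa>) \<psi>))
        \<le> C2 * (1 / real n) ^ Suc (2 * r + 1)"
      "C * (C1 * (1 / real n)) \<le> 1 / 2"
      using C2(2,3)[OF elim(3)] elim(4) by (simp_all add: mult.assoc)
    have "2 * C * D * (1 / real n) ^ (2 * r + 1) \<le> 1 / 2" using elim(5) by simp
    then show ?case
      using eigenelement_errors[OF \<mu> T collocation_op_scaleC[OF elim(3) cont] C1(2)[OF elim(3)] bounds(1,2) _ bounds(3)]
      unfolding iterated D'_def D_def by simp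
  qed
  show ?thesis
  proof (intro conjI)
    show "(\<lambda>n. norm (\<phi> n - blinfun_apply ?E (\<phi> n))) \<in> O(\<lambda>n. (1 / real n) ^ (2 * r + 1))"
      by (rule bigoI[of _ "2 * C * D"]) (use errors in eventually_elim, simp)
    show "(\<lambda>n. norm (\<phi>S n - blinfun_apply ?E (\<phi>S n))) \<in> O(\<lambda>n. (1 / real n) ^ (2 * r + 2))"
      by (rule bigoI[of _ "2 * C * D' / norm lam"]) (use errors in eventually_elim, simp)
    show "(\<lambda>n. norm (lam - lamC n)) \<in> O(\<lambda>n. (1 / real n) ^ (2 * r + 2))"
      by (rule bigoI[of _ "2 * norm ?E * D' / norm lam"]) (use errors in eventually_elim, simp)
  qed
qed

end
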